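(* Let $\lambda\in(0,r^\alpha)$, and let $\Phi,\Psi$ be closed subsets of $K$ with $R(\Phi,\Psi)>0$. Then there exists $u=u_{\Phi,\Psi}\in\mathcal D_K$ with $u=1$ on $\Phi$ and $u=0$ on $\Psi$, and $$R(\Phi,\Psi)^{-1}=\mathcal E_K[u_{\Phi,\Psi}]=\inf\{\mathcal E_K[u']: u'\in\mathcal D_K,\ u'=1\text{ on }\Phi,\ u'=0\text{ on }\Psi\};$$ moreover $u_{\Phi,\Psi}$ is the unique minimizer of this infimum in $\mathcal D_K$.
   Context: Let $\{S_i\}_{i=1}^N$ ($N\ge2$) be contractive similitudes of $\mathbb R^d$ with ratios $r_i\in(0,1)$ satisfying the open set condition; $K$ the self-similar set, $\alpha$ its Hausdorff dimension, $\nu$ the normalized $\alpha$-Hausdorff measure on $K$, $r=\min r_i$. $\Sigma^*$ finite words over $\{1,\dots,N\}$ with empty word $\vartheta$, $S_{\mathbf x}=S_{i_1}\circ\cdots\circ S_{i_k}$, $r_{\mathbf x}=r_{i_1}\cdots r_{i_k}$. $\mathcal J_0=\{\vartheta\}$, $\mathcal J_n=\{i_1\cdots i_k: r_{i_1\cdots i_k}\le r^n<r_{i_1\cdots i_{k-1}}\}$, $X=\bigcup_n\mathcal J_n$, $X_n=\bigcup_{k\le n}\mathcal J_k$, $|\mathbf x|=n$ on $\mathcal J_n$, parent $\mathbf x^-$ the prefix in $\mathcal J_{n-1}$. Edges: $\{\mathbf x,\mathbf x^-\}$ and horizontal $\{\mathbf x,\mathbf y\}$, $\mathbf x\ne\mathbf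 y\in\mathcal J_n$, with $\inf_{\xi,\eta\in K}|S_{\mathbf x}(\xi)-S_{\mathbf y}(\eta)|\le\gamma r^n$. Geodesic rays $(\mathbf x_n)$ ($\mathbf x_n\in\mathcal J_n$, each a prefix of the next) converge to $\xi$ if $\xi\in S_{\mathbf x_n}(K)$ for all $n$. The $\lambda$-NRW is the reversible Markov chain with symmetric conductances $c(\mathbf x,\mathbf x^-)=r_{\mathbf x}^\alpha\lambda^{-|\mathbf x|}$, $c(\mathbf x,\mathbf y)=r^{\alpha|\mathbf x|}\lambda^{-|\mathbf x|}$ on horizontal edges, zero otherwise, $P(\mathbf x,\mathbf y)=c(\mathbf x,\mathbf y)/\sum_{\mathbf z}c(\mathbf x,\mathbf z)$; its Martin boundary is identified with $K$, its hitting distribution from $\vartheta$ is $\nu$, and $K(\mathbf x,\xi)$ is the Martin kernel (density w.r.t. $\nu$ of the hitting distribution from $\mathbf x$). $Hu(\mathbf x)=\int_KK(\mathbf x,\xi)u(\xi)d\nu(\xi)$; $\mathcal E_X[f]=\frac12\sum_{\mathbf x\sim\mathbf y}c(\mathbf x,\mathbf y)(f(\mathbf x)-f(\mathbf y))^2$; $\mathcal E_K[u]=\mathcal E_X[Hu]$ on $\mathcal D_K=\{u\in L^2(K,\nu):\mathcal E_K[u]<\infty\}$ (equal to the Besov space $\Lambda^{\alpha,\beta/2}_{2,2}$, $\beta=\log\lambda/\log r$; its elements are continuous when $\lambda<r^\alpha$). Effective resistance in $X_n$: $R_{X_n}(E,F)=(\min\{\mathcal E_{X_n}[f]: f=1$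 on $E$, $0$ on $F\})^{-1}$ for disjoint nonempty $E,F$, $0$ if they intersect. With a $\kappa$-sequence (maps $\kappa_n:K\to\mathcal J_n$ such that $(\kappa_n(\xi))_n$ is a geodesic ray converging to $\xi$), the limiting resistance of closed $\Phi,\Psi\subset K$ is $R(\Phi,\Psi)=\lim_nR_{X_n}(\kappa_n(\Phi),\kappa_n(\Psi))$, which exists and is independent of the $\kappa$-sequence. *)

theory Defs
  imports "HOL-Analysis.Analysis" "HOL-Library.Sublist"
begin

definition similitude :: "('a::real_normed_vector \<Rightarrow> 'a) \<Rightarrow> real \<Rightarrow> bool" where
  "similitude f c \<longleftrightarrow> (\<forall>x y. dist (f x) (f y) = c * dist x y)"

definition osc :: "nat \<Rightarrow> (nat \<Rightarrow> 'a::metric_space \<Rightarrow> 'a) \<Rightarrow> bool" where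
  "osc N S \<longleftrightarrow> (\<exists>V. open V \<and> V \<noteq> {} \<and> (\<forall>i\<in>{1..N}. S i ` V \<subseteq> V) \<and>
     (\<forall>i\<in>{1..N}. \<forall>j\<in>{1..N}. i \<noteq> j \<longrightarrow> S i ` V \<inter> S j ` V = {}))"

definition hpow :: "real \<Rightarrow> 'a::metric_space set \<Rightarrow> ennreal" where
  "hpow s A = (if A = {} then 0 else if s = 0 then 1 else ennreal (diameter A powr s))"

definition hausdorff_approx :: "real \<Rightarrow> real \<Rightarrow> 'a::metric_space set \<Rightarrow> ennreal" where
  "hausdorff_approx s \<delta> A =
     (INF C \<in> {C :: nat \<Rightarrow> 'a set. A \<subseteq> (\<Union>i. C i) \<and> (\<forall>i. bounded (C i) \<and> diameter (C i) \<le> \<delta>)}.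
        (\<Sum>i. hpow s (C i)))"

definition hausdorff_measure :: "real \<Rightarrow> 'a::metric_space set \<Rightarrow> ennreal" where
  "hausdorff_measure s A = (SUP \<delta>\<in>{0<..}. hausdorff_approx s \<delta> A)"

definition hausdorff_dim :: "'a::metric_space set \<Rightarrow> real" where
  "hausdorff_dim A = Inf {s. 0 \<le> s \<and> hausdorff_measure s A = 0}"

definition nu :: "'a::euclidean_space set \<Rightarrow> 'a measure" where
  "nu K = measure_of UNIV (sets borel)
     (\<lambda>B. hausdorff_measure (hausdorff_dim K) (B \<inter> K) / hausdorff_measure (hausdorff_dim K) K)"

fun Sw :: "(nat \<Rightarrow> 'a \<Rightarrow> 'a) \<Rightarrow> nat list \<Rightarrow> 'a \<Rightarrow> 'a" where
  "Sw S [] = id"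
| "Sw S (i # w) = S i \<circ> Sw S w"

definition rw :: "(nat \<Rightarrow> real) \<Rightarrow> nat list \<Rightarrow> real" where
  "rw \<rho> w = prod_list (map \<rho> w)"

definition rmin :: "nat \<Rightarrow> (nat \<Rightarrow> real) \<Rightarrow> real" where
  "rmin N \<rho> = Min (\<rho> ` {1..N})"

fun J :: "nat \<Rightarrow> (nat \<Rightarrow> real) \<Rightarrow> nat \<Rightarrow> nat list set" where
  "J N \<rho> 0 = {[]}"
| "J N \<rho> (Suc n) = {w. w \<noteq> [] \<and> set w \<subseteq> {1..N} \<and>
      rw \<rho> w \<le> rmin N \<rho> ^ Suc n \<and> rmin N \<rho> ^ Suc n < rw \<rho> (butlast w)}"

definition Xn :: "nat \<Rightarrow> (nat \<Rightarrow> real) \<Rightarrow> nat \<Rightarrow> nat list set" where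
  "Xn N \<rho> n = (\<Union>k\<le>n. J N \<rho> k)"

definition lev :: "nat \<Rightarrow> (nat \<Rightarrow> real) \<Rightarrow> nat list \<Rightarrow> nat" where
  "lev N \<rho> x = (THE n. x \<in> J N \<rho> n)"

definition gap :: "(nat \<Rightarrow> 'a::metric_space \<Rightarrow> 'a) \<Rightarrow> 'a set \<Rightarrow> nat list \<Rightarrow> nat list \<Rightarrow> real" where
  "gap S K x y = Inf {dist (Sw S x \<xi>) (Sw S y \<eta>) | \<xi> \<eta>. \<xi> \<in> K \<and> \<eta> \<in> K}"

definition cond :: "nat \<Rightarrow> (nat \<Rightarrow> 'a::euclidean_space \<Rightarrow> 'a) \<Rightarrow> (nat \<Rightarrow> real) \<Rightarrow> 'a set \<Rightarrow> real \<Rightarrow> real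
    \<Rightarrow> nat list \<Rightarrow> nat list \<Rightarrow> real" where
  "cond N S \<rho> K \<gamma> lam x y =
    (let \<alpha> = hausdorff_dim K; r = rmin N \<rho> in
     if (\<exists>n. x \<in> J N \<rho> (Suc n) \<and> y \<in> J N \<rho> n \<and> prefix y x)
       then rw \<rho> x powr \<alpha> * lam powr (- real (lev N \<rho> x))
     else if (\<exists>n. y \<in> J N \<rho> (Suc n) \<and> x \<in> J N \<rho> n \<and> prefix x y)
       then rw \<rho> y powr \<alpha> * lam powr (- real (lev N \<rho> y))
     else if (\<exists>n. x \<in> J N \<rho> n \<and> y \<in> J N \<rho> n \<and> x \<noteq> y \<and> gap S K x y \<le> \<gamma> * r ^ n)
       then r powr (\<alpha> * real (lev N \<rho> x)) * lam powr (- real (lev N \<rho> x))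
     else 0)"

definition nbrs :: "nat \<Rightarrow> (nat \<Rightarrow> 'a::euclidean_space \<Rightarrow> 'a) \<Rightarrow> (nat \<Rightarrow> real) \<Rightarrow> 'a set \<Rightarrow> real \<Rightarrow> real
    \<Rightarrow> nat list \<Rightarrow> nat list set" where
  "nbrs N S \<rho> K \<gamma> lam x = {y. cond N S \<rho> K \<gamma> lam x y \<noteq> 0}"

definition trans_prob :: "nat \<Rightarrow> (nat \<Rightarrow> 'a::euclidean_space \<Rightarrow> 'a) \<Rightarrow> (nat \<Rightarrow> real) \<Rightarrow> 'a set \<Rightarrow> real \<Rightarrow> real
    \<Rightarrow> nat list \<Rightarrow> nat list \<Rightarrow> real" where
  "trans_prob N S \<rho> K \<gamma> lam x y =
     cond N S \<rho> K \<gamma> lam x y / (\<Sum>z\<in>nbrs N S \<rho> K \<gamma> lam x. cond N S \<rho> K \<gamma> lam x z)"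

fun Pn :: "nat \<Rightarrow> (nat \<Rightarrow> 'a::euclidean_space \<Rightarrow> 'a) \<Rightarrow> (nat \<Rightarrow> real) \<Rightarrow> 'a set \<Rightarrow> real \<Rightarrow> real
    \<Rightarrow> nat \<Rightarrow> nat list \<Rightarrow> nat list \<Rightarrow> real" where
  "Pn N S \<rho> K \<gamma> lam 0 x y = (if x = y then 1 else 0)"
| "Pn N S \<rho> K \<gamma> lam (Suc n) x y =
     (\<Sum>z\<in>nbrs N S \<rho> K \<gamma> lam x. trans_prob N S \<rho> K \<gamma> lam x z * Pn N S \<rho> K \<gamma> lam n z y)"

definition green :: "nat \<Rightarrow> (nat \<Rightarrow> 'a::euclidean_space \<Rightarrow> 'a) \<Rightarrow> (nat \<Rightarrow> real) \<Rightarrow> 'a set \<Rightarrow> real \<Rightarrow> real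
    \<Rightarrow> nat list \<Rightarrow> nat list \<Rightarrow> real" where
  "green N S \<rho> K \<gamma> lam x y = (\<Sum>n. Pn N S \<rho> K \<gamma> lam n x y)"

definition geo_ray :: "nat \<Rightarrow> (nat \<Rightarrow> 'a \<Rightarrow> 'a) \<Rightarrow> (nat \<Rightarrow> real) \<Rightarrow> 'a set \<Rightarrow> 'a
    \<Rightarrow> (nat \<Rightarrow> nat list) \<Rightarrow> bool" where
  "geo_ray N S \<rho> K \<xi> xs \<longleftrightarrow>
     (\<forall>n. xs n \<in> J N \<rho> n \<and> prefix (xs n) (xs (Suc n)) \<and> \<xi> \<in> Sw S (xs n) ` K)"

text \<open>Martin kernel K(x,xi): limit of Green function ratios G(x,y)/G(root,y) as y tends
  to the boundary point xi (along a geodesic ray converging to xi).\<close>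
definition martin :: "nat \<Rightarrow> (nat \<Rightarrow> 'a::euclidean_space \<Rightarrow> 'a) \<Rightarrow> (nat \<Rightarrow> real) \<Rightarrow> 'a set \<Rightarrow> real \<Rightarrow> real
    \<Rightarrow> nat list \<Rightarrow> 'a \<Rightarrow> real" where
  "martin N S \<rho> K \<gamma> lam x \<xi> =
     (let ys = (SOME ys. geo_ray N S \<rho> K \<xi> ys) in
      lim (\<lambda>n. green N S \<rho> K \<gamma> lam x (ys n) / green N S \<rho> K \<gamma> lam [] (ys n)))"

definition Hext :: "nat \<Rightarrow> (nat \<Rightarrow> 'a::euclidean_space \<Rightarrow> 'a) \<Rightarrow> (nat \<Rightarrow> real) \<Rightarrow> 'a set \<Rightarrow> real \<Rightarrow> real
    \<Rightarrow> ('a \<Rightarrow> real) \<Rightarrow> nat list \<Rightarrow> real" where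
  "Hext N S \<rho> K \<gamma> lam u x = (\<integral>\<xi>. martin N S \<rho> K \<gamma> lam x \<xi> * u \<xi> \<partial>nu K)"

text \<open>Energy on X: (1/2) sum over ordered pairs (c vanishes off edges).\<close>
definition energyX :: "nat \<Rightarrow> (nat \<Rightarrow> 'a::euclidean_space \<Rightarrow> 'a) \<Rightarrow> (nat \<Rightarrow> real) \<Rightarrow> 'a set \<Rightarrow> real \<Rightarrow> real
    \<Rightarrow> (nat list \<Rightarrow> real) \<Rightarrow> ennreal" where
  "energyX N S \<rho> K \<gamma> lam f =
     (\<integral>\<^sup>+ p. ennreal (cond N S \<rho> K \<gamma> lam (fst p) (snd p) * (f (fst p) - f (snd p))\<^sup>2)
        \<partial>count_space UNIV) / 2"

definition EK :: "nat \<Rightarrow> (nat \<Rightarrow> 'a::euclidean_space \<Rightarrow> 'a) \<Rightarrow> (nat \<Rightarrow> real) \<Rightarrow> 'a set \<Rightarrow> real \<Rightarrow> real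
    \<Rightarrow> ('a \<Rightarrow> real) \<Rightarrow> ennreal" where
  "EK N S \<rho> K \<gamma> lam u = energyX N S \<rho> K \<gamma> lam (Hext N S \<rho> K \<gamma> lam u)"

definition DK :: "nat \<Rightarrow> (nat \<Rightarrow> 'a::euclidean_space \<Rightarrow> 'a) \<Rightarrow> (nat \<Rightarrow> real) \<Rightarrow> 'a set \<Rightarrow> real \<Rightarrow> real
    \<Rightarrow> ('a \<Rightarrow> real) set" where
  "DK N S \<rho> K \<gamma> lam = {u. u \<in> borel_measurable (nu K) \<and> integrable (nu K) (\<lambda>\<xi>. (u \<xi>)\<^sup>2) \<and>
      EK N S \<rho> K \<gamma> lam u < top}"

definition energyXn :: "nat \<Rightarrow> (nat \<Rightarrow> 'a::euclidean_space \<Rightarrow> 'a) \<Rightarrow> (nat \<Rightarrow> real) \<Rightarrow> 'a set \<Rightarrow> real \<Rightarrow> real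
    \<Rightarrow> nat \<Rightarrow> (nat list \<Rightarrow> real) \<Rightarrow> real" where
  "energyXn N S \<rho> K \<gamma> lam n f =
     (\<Sum>x\<in>Xn N \<rho> n. \<Sum>y\<in>Xn N \<rho> n. cond N S \<rho> K \<gamma> lam x y * (f x - f y)\<^sup>2) / 2"

definition effres :: "nat \<Rightarrow> (nat \<Rightarrow> 'a::euclidean_space \<Rightarrow> 'a) \<Rightarrow> (nat \<Rightarrow> real) \<Rightarrow> 'a set \<Rightarrow> real \<Rightarrow> real
    \<Rightarrow> nat \<Rightarrow> nat list set \<Rightarrow> nat list set \<Rightarrow> real" where
  "effres N S \<rho> K \<gamma> lam n E F =
     (if E \<inter> F \<noteq> {} then 0
      else 1 / (INF f \<in> {f. (\<forall>x\<in>E. f x = 1) \<and> (\<forall>x\<in>F. f x = 0)}. energyXn N S \<rho> K \<gamma> lam n f))"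

definition kappa_seq :: "nat \<Rightarrow> (nat \<Rightarrow> 'a \<Rightarrow> 'a) \<Rightarrow> (nat \<Rightarrow> real) \<Rightarrow> 'a set
    \<Rightarrow> (nat \<Rightarrow> 'a \<Rightarrow> nat list) \<Rightarrow> bool" where
  "kappa_seq N S \<rho> K \<kappa> \<longleftrightarrow> (\<forall>\<xi>\<in>K. geo_ray N S \<rho> K \<xi> (\<lambda>n. \<kappa> n \<xi>))"

definition Rlim :: "nat \<Rightarrow> (nat \<Rightarrow> 'a::euclidean_space \<Rightarrow> 'a) \<Rightarrow> (nat \<Rightarrow> real) \<Rightarrow> 'a set \<Rightarrow> real \<Rightarrow> real
    \<Rightarrow> 'a set \<Rightarrow> 'a set \<Rightarrow> real" where
  "Rlim N S \<rho> K \<gamma> lam \<Phi> \<Psi> =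
     (let \<kappa> = (SOME \<kappa>. kappa_seq N S \<rho> K \<kappa>) in
      lim (\<lambda>n. effres N S \<rho> K \<gamma> lam n (\<kappa> n ` \<Phi>) (\<kappa> n ` \<Psi>)))"

text \<open>Admissible functions: (continuous representative) equal to 1 on Phi and 0 on Psi.\<close>
definition admissible :: "'a::topological_space set \<Rightarrow> 'a set \<Rightarrow> 'a set \<Rightarrow> ('a \<Rightarrow> real) \<Rightarrow> bool" where
  "admissible K \<Phi> \<Psi> u \<longleftrightarrow> continuous_on K u \<and> (\<forall>\<xi>\<in>\<Phi>. u \<xi> = 1) \<and> (\<forall>\<xi>\<in>\<Psi>. u \<xi> = 0)"

end

theory Submission
  imports Defs "HOL-Library.Diagonal_Subsequence"
begin

text \<open>
  By Moran's theorem the weights \<open>rw x powr \<alpha>\<close> of the children of a vertex add up to the weight of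
  the vertex, hence \<open>lam ^ lv x\<close> is harmonic away from the root and the Green function with pole at the
  root is explicit. The ratio \<open>G(x,y) / G([],y)\<close>, as a function of \<open>y\<close>, is a bounded harmonic function of the
  reversed walk, which drifts towards the root. A Harnack chain and a barrier built from Euclidean
  distance show that its oscillation near a boundary point contracts geometrically along the levels,
  so that the Martin kernel exists everywhere and is continuous. Green's identity on \<open>X\<^sub>n\<close> then gives the Poisson
  representation: a (super)harmonic function with continuous boundary values \<open>u\<close> equals (dominates) \<open>Hu\<close>.

  Since \<open>lam < r powr \<alpha>\<close>, the conductances grow geometrically and every function of finite energy on the
  tree has a continuous trace on \<open>K\<close>. Near-minimizers of the resistance problems on \<open>X\<^sub>n\<close> converge pointwise
  along a subsequence to a function with the right trace, whose energy is the limit of the minimal energies; it is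
  harmonic because it can be perturbed at single vertices, so it is \<open>Hu\<close> for its trace \<open>u\<close>.
  Uniqueness is the parallelogram identity.
\<close>

section \<open>Hausdorff measures on Borel sets\<close>

text \<open>\<open>martin\<close> and \<open>Rlim\<close> are built from \<open>lim\<close> and
  \<open>SOME\<close>, so nothing can be said about them until convergence is proved, and the
  estimates have to hold uniformly over all cells containing a boundary point, not only along the
  chosen ray. Boundary behaviour is therefore recorded by \<open>bval\<close>, uniform convergence
  over all cells of a level, which takes the place of Besov norms throughout. The distance of base
  points is only approximately (super)harmonic. Its error on level n is of order
  \<open>a ^ n * r ^ n\<close> and is absorbed by a power \<open>t ^ lv y\<close>, to which
  horizontal edges contribute nothing. The two walks drift in opposite directions, so the correction
  is subtracted with t = r for the reversed walk and added with the larger t = \<open>t0\<close> for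
  the walk itself. The capacities on X_n converge because of two facts about the class
  \<open>inA\<close> of functions on the whole tree: every subsequential limit L is an energy bound
  of some member, and a member with energy bound M forces the capacities eventually below M + e. The
  same two facts identify L as the least energy in \<open>inA\<close>, and Poisson extension
  transfers this to K.\<close>

definition separated :: "'a::metric_space set \<Rightarrow> 'a set \<Rightarrow> bool" where
  "separated A B \<longleftrightarrow> (\<exists>d>0. \<forall>x\<in>A. \<forall>y\<in>B. d \<le> dist x y)"

text \<open>The chain \<open>T\<close> swallows all earlier pieces, so one separation per index is
  enough for the induction on partial sums. It will be applied to every second shell, with
  superlevel sets of the distance as \<open>T\<close>.\<close>

lemma separated_sum_le:
  fixes f :: "'a::metric_space set \<Rightarrow> ennreal"
  assumes add: "\<And>A B. separated A B \<Longrightarrow> f A + f B \<le> f (A \<union> B)"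
    and mono: "\<And>A B. A \<subseteq> B \<Longrightarrow> f A \<le> f B" and emp: "f {} = 0"
    and sep: "\<And>k. separated (T k) (C k)" and sub: "\<And>k. C k \<subseteq> T (Suc k)"
    and T: "\<And>k. T k \<subseteq> T (Suc k)" and A: "\<And>k. C k \<subseteq> A"
  shows "(\<Sum>k. f (C k)) \<le> f A"
proof (rule suminf_le_const)
  fix n
  have "(\<Sum>k<n. f (C k)) \<le> f (\<Union>k<n. C k) \<and> (\<Union>k<n. C k) \<subseteq> T n"
  proof (induction n)
    case 0
    then show ?case using emp by simp
  next
    case (Suc n)
    have "separated (\<Union>k<n. C k) (C n)"
      using sep[of n] Suc by (fastforce simp: separated_def)
    then have "f (\<Union>k<n. C k) + f (C n) \<le> f ((\<Union>k<n. C k) \<union> C n)" by (rule add)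
    moreover have "(\<Union>k<Suc n. C k) = (\<Union>k<n. C k) \<union> C n" by (auto simp: less_Suc_eq)
    ultimately show ?case using Suc T[of n] sub[of n]
      by (auto intro: order_trans add_right_mono)
  qed
  moreover have "f (\<Union>k<n. C k) \<le> f A" using A by (intro mono) auto
  ultimately show "(\<Sum>k<n. f (C k)) \<le> f A" by auto
qed auto

text \<open>The shells at distance between \<open>1/(k+2)\<close> and \<open>1/(k+1)\<close> from \<open>F\<close> are separated from each other when their indices differ
  by at least two, so their measures are summable and the tails of the series vanish.\<close>

lemma metric_outer_measure_closed:
  fixes f :: "'a::metric_space set \<Rightarrow> ennreal"
  assumes add: "\<And>A B. separated A B \<Longrightarrow> f A + f B \<le> f (A \<union> B)"
    and mono: "\<And>A B. A \<subseteq> B \<Longrightarrow> f A \<le> f B" and emp: "f {} = 0"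
    and subadd: "\<And>A :: nat \<Rightarrow> 'a set. f (\<Union>i. A i) \<le> (\<Sum>i. f (A i))"
    and F: "closed F"
  shows "f (A \<inter> F) + f (A - F) \<le> f A"
proof (cases "F = {} \<or> f A = top")
  case True
  then show ?thesis using emp by auto
next
  case False
  then have Fn: "F \<noteq> {}" and fin: "f A < top" by (auto simp: less_top)
  have subadd2: "f (X \<union> Y) \<le> f X + f Y" for X Y
  proof -
    have "f (X \<union> Y) \<le> (\<Sum>i. f ((\<lambda>i::nat. if i = 0 then X else if i = 1 then Y else {}) i))"
      by (intro order_trans[OF mono subadd]) (auto split: if_splits)
    also have "\<dots> = (\<Sum>i\<in>{0,1}. f ((\<lambda>i::nat. if i = 0 then X else if i = 1 then Y else {}) i))"
      by (intro suminf_finite) (auto simp: emp)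
    finally show ?thesis by simp
  qed
  define T where "T k = {x\<in>A. 1 / (real k + 1) \<le> infdist x F}" for k :: nat
  define B where "B k = T (Suc k) - T k" for k
  have Tmono: "T k \<subseteq> T (Suc k)" for k
  proof -
    have "1 / (real (Suc k) + 1) \<le> 1 / (real k + 1)" by (simp add: frac_le)
    then show ?thesis unfolding T_def by auto
  qed
  then have Tmono': "k \<le> l \<Longrightarrow> T k \<subseteq> T l" for k l
    by (metis lift_Suc_mono_le)
  have sepTB: "separated (T k) (B (Suc k))" for k
    unfolding separated_def
  proof (intro exI[of _ "1 / (real k + 1) - 1 / (real k + 2)"] conjI ballI)
    show "0 < 1 / (real k + 1) - 1 / (real k + 2)" by (simp add: frac_less2)
    fix x y assume "x \<in> T k" "y \<in> B (Suc k)"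
    then have "1 / (real k + 1) \<le> infdist x F" "infdist y F < 1 / (real k + 2)"
      by (auto simp: T_def B_def not_le add.commute)
    moreover have "infdist x F \<le> infdist y F + dist x y" by (rule infdist_triangle)
    ultimately show "1 / (real k + 1) - 1 / (real k + 2) \<le> dist x y" by linarith
  qed
  have BA: "B k \<subseteq> A" for k by (auto simp: B_def T_def)
  have BT: "B k \<subseteq> T (Suc k)" for k by (auto simp: B_def)
  have emptysep: "separated {} X" for X :: "'a set" unfolding separated_def by (intro exI[of _ 1]) auto
  have "(\<Sum>k. f (B (2*k+1))) \<le> f A"
    by (rule separated_sum_le[OF add mono emp, where T="\<lambda>k. T (2*k)"])
       (use sepTB BT BA Tmono' in \<open>auto\<close>)
  \<comment> \<open>Index 0 is special: truncated subtraction would yield \<open>T 0\<close>, which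
    need not be separated from the adjacent shell \<open>B 0\<close>, hence the empty set.\<close>
  moreover have "(\<Sum>k. f (B (2*k))) \<le> f A"
  proof (rule separated_sum_le[OF add mono emp, where T="\<lambda>k. if k = 0 then {} else T (2*k-1)"])
    fix k show "separated (if k = 0 then {} else T (2 * k - 1)) (B (2 * k))"
      using sepTB[of "2*k-1"] emptysep by (cases k) auto
    show "B (2 * k) \<subseteq> (if Suc k = 0 then {} else T (2 * Suc k - 1))" using BT[of "2*k"] by auto
    show "(if k = 0 then {} else T (2 * k - 1)) \<subseteq> (if Suc k = 0 then {} else T (2 * Suc k - 1))"
      using Tmono'[of "2 * k - 1" "2 * Suc k - 1"] by auto
    show "B (2*k) \<subseteq> A" by (rule BA)
  qed auto
  moreover have "(\<Sum>k. f (B k)) \<le> (\<Sum>k. f (B (2*k))) + (\<Sum>k. f (B (2*k+1)))"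
  proof (rule suminf_le_const)
    fix n
    have "(\<Sum>k<n. f (B k)) \<le> (\<Sum>k<2*n. f (B k))" by (intro sum_mono2) auto
    also have "\<dots> = (\<Sum>k<n. f (B (2*k))) + (\<Sum>k<n. f (B (2*k+1)))"
      by (induction n) (auto simp: algebra_simps)
    also have "\<dots> \<le> (\<Sum>k. f (B (2*k))) + (\<Sum>k. f (B (2*k+1)))"
      by (intro add_mono sum_le_suminf) auto
    finally show "(\<Sum>k<n. f (B k)) \<le> \<dots>" .
  qed auto
  ultimately have "(\<Sum>k. f (B k)) \<le> f A + f A"
    by (meson add_mono order_trans)
  then have Bfin: "(\<Sum>k. f (B k)) \<noteq> top" using fin
    by (metis add_le_same_cancel1 ennreal_add_less_top infinity_ennreal_def leD less_top top.extremum_unique)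
  have tail: "(\<lambda>n. \<Sum>k. f (B (k + n))) \<longlonglongrightarrow> 0"
  proof -
    define b where "b k = enn2real (f (B k))" for k
    have fb: "f (B k) = ennreal (b k)" for k
      using Bfin by (metis b_def ennreal_enn2real ennreal_suminf_lessD less_top)
    have b0: "b k \<ge> 0" for k by (simp add: b_def)
    have sb: "summable b"
      by (rule summable_suminf_not_top) (use b0 Bfin fb in auto)
    have "(\<lambda>n. \<Sum>k. b (k + n)) \<longlonglongrightarrow> 0"
      by (rule suminf_exist_split2[OF sb])
    then have "(\<lambda>n. ennreal (\<Sum>k. b (k + n))) \<longlonglongrightarrow> ennreal 0"
      by (intro tendsto_ennrealI)
    moreover have "(\<Sum>k. f (B (k + n))) = ennreal (\<Sum>k. b (k + n))" for n
      unfolding fb using b0 sb by (intro suminf_ennreal_eq summable_sums) (auto simp: summable_iff_shift)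
    ultimately show ?thesis by simp
  qed
  have "f (A \<inter> F) + f (A - F) \<le> f A + (\<Sum>k. f (B (k + n)))" for n
  proof -
    have "A - F \<subseteq> T n \<union> (\<Union>k. B (k + n))"
    proof
      fix x assume x: "x \<in> A - F"
      then have pos: "infdist x F > 0" using F Fn
        by (simp add: infdist_pos_not_in_closed)
      obtain k where "1 / (real k + 1) < infdist x F"
        using pos by (metis add.commute nat_approx_posE of_nat_Suc)
      then have ex: "\<exists>k. x \<in> T k" using x by (auto simp: T_def intro: exI[of _ k] less_imp_le)
      define k0 where "k0 = (LEAST k. x \<in> T k)"
      have k0: "x \<in> T k0" unfolding k0_def using ex by (rule LeastI_ex)
      show "x \<in> T n \<union> (\<Union>k. B (k + n))"
      proof (cases "k0 \<le> n")
        case True then show ?thesis using Tmono'[OF True] k0 by auto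
      next
        case False
        then obtain j where j: "k0 = Suc (j + n)" by (metis add.commute not_le less_imp_Suc_add)
        then have "x \<notin> T (j + n)" using not_less_Least[of "j+n" "\<lambda>k. x \<in> T k"] k0_def by auto
        then show ?thesis using k0 j by (auto simp: B_def)
      qed
    qed
    then have "f (A - F) \<le> f (T n) + (\<Sum>k. f (B (k + n)))"
      by (rule order_trans[OF mono order_trans[OF subadd2 add_left_mono[OF subadd]]])
    moreover have "separated (A \<inter> F) (T n)"
      unfolding separated_def
    proof (intro exI[of _ "1 / (real n + 1)"] conjI ballI)
      fix x y assume "x \<in> A \<inter> F" "y \<in> T n"
      then show "1 / (real n + 1) \<le> dist x y"
        using infdist_le[of x F y] by (auto simp: T_def dist_commute)
    qed simp
    then have "f (A \<inter> F) + f (T n) \<le> f A"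
      by (intro order_trans[OF add mono]) (auto simp: T_def)
    ultimately have "f (A \<inter> F) + f (A - F) \<le> f (A \<inter> F) + (f (T n) + (\<Sum>k. f (B (k + n))))"
      by (intro add_left_mono)
    also have "\<dots> = (f (A \<inter> F) + f (T n)) + (\<Sum>k. f (B (k + n)))" by (simp only: add.assoc)
    also have "\<dots> \<le> f A + (\<Sum>k. f (B (k + n)))"
      by (rule add_right_mono) fact
    finally show ?thesis .
  qed
  then show ?thesis
    by (intro LIMSEQ_le_const[OF tendsto_add[OF tendsto_const tail, of "f A", simplified]]) auto
qed

section \<open>Hausdorff measure as a metric outer measure\<close>

lemma hpow_empty [simp]: "hpow s {} = 0"
  by (simp add: hpow_def)

lemma hausdorff_approx_mono: "A \<subseteq> B \<Longrightarrow> hausdorff_approx s \<delta> A \<le> hausdorff_approx s \<delta> B"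
  unfolding hausdorff_approx_def by (intro INF_superset_mono) auto

lemma hausdorff_approx_antimono:
  "\<delta> \<le> \<delta>' \<Longrightarrow> hausdorff_approx s \<delta>' A \<le> hausdorff_approx s \<delta> A"
  unfolding hausdorff_approx_def by (rule INF_superset_mono) (auto intro: order_trans)

lemma hausdorff_approx_le:
  assumes "A \<subseteq> (\<Union>i. C i)" "\<And>i. bounded (C i)" "\<And>i. diameter (C i) \<le> \<delta>"
  shows "hausdorff_approx s \<delta> A \<le> (\<Sum>i. hpow s (C (i::nat)))"
  unfolding hausdorff_approx_def by (rule INF_lower) (use assms in auto)

lemma hausdorff_measure_ge: "\<delta> > 0 \<Longrightarrow> hausdorff_approx s \<delta> A \<le> hausdorff_measure s A"
  unfolding hausdorff_measure_def by (intro SUP_upper) auto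

lemma hausdorff_measure_mono: "A \<subseteq> B \<Longrightarrow> hausdorff_measure s A \<le> hausdorff_measure s B"
  unfolding hausdorff_measure_def by (intro SUP_mono) (auto intro: hausdorff_approx_mono)

lemma hausdorff_measure_empty: "hausdorff_measure s {} = 0"
proof -
  have "hausdorff_approx s \<delta> {} = 0" if "\<delta> > 0" for \<delta>
    using hausdorff_approx_le[of "{}" "\<lambda>_. {}" \<delta> s] that by simp
  then show ?thesis unfolding hausdorff_measure_def
    by (intro antisym SUP_least) auto
qed

text \<open>Subadditivity holds already at each fixed scale \<delta>: near-optimal covers with
  errors \<open>e * (1/2) ^ Suc n\<close> are merged into one. The supremum over \<delta> is taken
  only afterwards.\<close>

lemma hausdorff_measure_subadd:
  fixes A :: "nat \<Rightarrow> 'a::metric_space set"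
  shows "hausdorff_measure s (\<Union>i. A i) \<le> (\<Sum>i. hausdorff_measure s (A i))"
  unfolding hausdorff_measure_def[of s "\<Union>i. A i"]
proof (rule SUP_least)
  fix \<delta> :: real assume "\<delta> \<in> {0<..}"
  then have d: "\<delta> > 0" by simp
  let ?O = "hausdorff_approx s \<delta>"
  have "?O (\<Union>i. A i) \<le> (\<Sum>n. ?O (A n))"
  proof (rule ennreal_le_epsilon)
    fix e :: real assume e: "0 < e" "(\<Sum>n. ?O (A n)) < top"
    then have *: "\<And>n. ?O (A n) < ?O (A n) + e * (1/2)^Suc n"
      by (auto simp add: less_top dest!: ennreal_suminf_lessD)
    have "\<exists>B. A n \<subseteq> (\<Union>i. B i) \<and> (\<forall>i::nat. bounded (B i) \<and> diameter (B i) \<le> \<delta>) \<and>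
            (\<Sum>i. hpow s (B i)) \<le> ?O (A n) + e * (1/2)^(Suc n)" for n
      using *[of n] unfolding hausdorff_approx_def[of s \<delta> "A n"] INF_less_iff
      by (auto intro: less_imp_le)
    then obtain B where B: "\<And>n. A n \<subseteq> (\<Union>i. B n i)"
       "\<And>n i. bounded (B n i)" "\<And>n i. diameter (B n i) \<le> \<delta>"
       "\<And>n. (\<Sum>i::nat. hpow s (B n i)) \<le> ?O (A n) + e * (1/2)^(Suc n)"
      by metis
    define C where "C = case_prod B o prod_decode"
    have A_C: "(\<Union>i. A i) \<subseteq> (\<Union>i. C i)"
      using B(1) by (auto simp add: C_def subset_eq) (metis prod.case prod_encode_inverse)
    have "?O (\<Union>i. A i) \<le> (\<Sum>i. hpow s (C i))"
      by (rule hausdorff_approx_le[OF A_C]) (auto simp: C_def B split_def)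
    also have "\<dots> = (\<Sum>n. \<Sum>i. hpow s (B n i))"
      unfolding C_def comp_def
      using suminf_ennreal_2dimen[of "\<lambda>n. \<Sum>i. hpow s (B n i)" "\<lambda>(n,i). hpow s (B n i)"]
      by (simp add: split_def)
    also have "\<dots> \<le> (\<Sum>n. ?O (A n) + e * (1/2) ^ Suc n)"
      by (intro suminf_le B allI) auto
    also have "... = (\<Sum>n. ?O (A n)) + (\<Sum>n. ennreal e * ennreal ((1/2) ^ Suc n))"
      using \<open>0 < e\<close> by (subst suminf_add[symmetric])
                       (auto simp del: ennreal_suminf_cmult simp add: ennreal_mult[symmetric])
    also have "\<dots> = (\<Sum>n. ?O (A n)) + e"
      unfolding ennreal_suminf_cmult
      by (subst suminf_ennreal_eq[OF zero_le_power power_half_series]) auto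
    finally show "?O (\<Union>i. A i) \<le> (\<Sum>n. ?O (A n)) + e" .
  qed
  also have "\<dots> \<le> (\<Sum>n. hausdorff_measure s (A n))"
    by (intro suminf_le hausdorff_measure_ge d allI) auto
  finally show "?O (\<Union>i. A i) \<le> \<dots>" .
qed

text \<open>Covering sets smaller than the gap meet at most one of the two sets, so a cover of the
  union splits into two covers. Since the approximations increase as the scale shrinks, the two
  suprema may be taken independently.\<close>

lemma hausdorff_measure_separated:
  assumes "separated A B"
  shows "hausdorff_measure s A + hausdorff_measure s B \<le> hausdorff_measure s (A \<union> B)"
proof -
  from assms obtain d where d: "d > 0" "\<And>x y. x \<in> A \<Longrightarrow> y \<in> B \<Longrightarrow> d \<le> dist x y"
    by (auto simp: separated_def)
  have approx_add: "hausdorff_approx s \<delta> A + hausdorff_approx s \<delta> B \<le> hausdorff_approx s \<delta> (A \<union> B)"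
    if \<delta>: "\<delta> > 0" "\<delta> < d" for \<delta>
    unfolding hausdorff_approx_def[of s \<delta> "A \<union> B"]
  proof (rule INF_greatest, clarify)
    fix C :: "nat \<Rightarrow> 'a set"
    assume C: "A \<union> B \<subseteq> \<Union> (range C)" "\<forall>i. bounded (C i) \<and> diameter (C i) \<le> \<delta>"
    define CA where "CA i = (if C i \<inter> A = {} then {} else C i)" for i
    define CB where "CB i = (if C i \<inter> B = {} then {} else C i)" for i
    have disj: "C i \<inter> A = {} \<or> C i \<inter> B = {}" for i
    proof (rule ccontr)
      assume "\<not> ?thesis"
      then obtain x y where "x \<in> C i" "x \<in> A" "y \<in> C i" "y \<in> B" by auto
      then have "d \<le> diameter (C i)" using d(2) C(2) diameter_bounded_bound by fastforce
      then show False using C(2) \<delta> by (meson le_less_trans not_le)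
    qed
    have "hausdorff_approx s \<delta> A \<le> (\<Sum>i. hpow s (CA i))"
      by (rule hausdorff_approx_le) (use C \<delta> in \<open>auto simp: CA_def, blast\<close>)
    moreover have "hausdorff_approx s \<delta> B \<le> (\<Sum>i. hpow s (CB i))"
      by (rule hausdorff_approx_le) (use C \<delta> in \<open>auto simp: CB_def, blast\<close>)
    moreover have "(\<Sum>i. hpow s (CA i)) + (\<Sum>i. hpow s (CB i)) = (\<Sum>i. hpow s (CA i) + hpow s (CB i))"
      by (intro suminf_add) auto
    moreover have "\<dots> \<le> (\<Sum>i. hpow s (C i))"
      by (intro suminf_le) (use disj in \<open>auto simp: CA_def CB_def\<close>)
    ultimately show "hausdorff_approx s \<delta> A + hausdorff_approx s \<delta> B \<le> (\<Sum>i. hpow s (C i))"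
      by (metis add_mono order_trans)
  qed
  have le: "hausdorff_approx s d1 A + hausdorff_approx s d2 B \<le> hausdorff_measure s (A \<union> B)"
    if "d1 > 0" "d2 > 0" for d1 d2
  proof -
    define \<delta> where "\<delta> = min (d/2) (min d1 d2)"
    have \<delta>: "\<delta> > 0" "\<delta> < d" "\<delta> \<le> d1" "\<delta> \<le> d2" using that d(1) by (auto simp: \<delta>_def min_def)
    have "hausdorff_approx s d1 A + hausdorff_approx s d2 B \<le> hausdorff_approx s \<delta> A + hausdorff_approx s \<delta> B"
      using \<delta> by (intro add_mono hausdorff_approx_antimono)
    also have "\<dots> \<le> hausdorff_measure s (A \<union> B)"
      using approx_add[OF \<delta>(1,2)] hausdorff_measure_ge[OF \<delta>(1)] order_trans by blast
    finally show ?thesis .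
  qed
  have ne: "{0::real<..} \<noteq> {}" by (auto intro: exI[of _ 1])
  have "hausdorff_measure s A + hausdorff_measure s B
      = (SUP d1\<in>{0<..}. hausdorff_approx s d1 A + hausdorff_measure s B)"
    unfolding hausdorff_measure_def[of s A] by (rule ennreal_SUP_add_left[OF ne, symmetric])
  also have "\<dots> = (SUP d1\<in>{0<..}. SUP d2\<in>{0<..}. hausdorff_approx s d1 A + hausdorff_approx s d2 B)"
    unfolding hausdorff_measure_def[of s B] by (simp add: ennreal_SUP_add_right[OF ne])
  also have "\<dots> \<le> hausdorff_measure s (A \<union> B)"
    by (intro SUP_least le) auto
  finally show ?thesis .
qed

text \<open>Caratheodory's construction: closed sets split every set additively, hence belong to the
  lambda system, and they generate the Borel sets.\<close>

lemma hausdorff_measure_measure_space: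
  "measure_space UNIV (sets (borel :: 'a::metric_space measure)) (hausdorff_measure s)"
proof -
  interpret sigma_algebra UNIV "Pow UNIV :: 'a set set" by (rule sigma_algebra_Pow)
  have oms: "outer_measure_space (Pow UNIV) (hausdorff_measure s :: 'a set \<Rightarrow> ennreal)"
    unfolding outer_measure_space_def positive_def increasing_def countably_subadditive_def
    by (auto simp: hausdorff_measure_empty hausdorff_measure_mono hausdorff_measure_subadd)
  let ?L = "lambda_system UNIV (Pow UNIV) (hausdorff_measure s :: 'a set \<Rightarrow> ennreal)"
  have ms: "measure_space UNIV ?L (hausdorff_measure s)"
    by (rule caratheodory_lemma[OF oms])
  interpret L: sigma_algebra UNIV ?L using ms by (simp add: measure_space_def)
  have cl: "F \<in> ?L" if "closed F" for F
    unfolding lambda_system_eq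
  proof (clarsimp, rule antisym)
    fix x
    show "hausdorff_measure s (x \<inter> F) + hausdorff_measure s (x - F) \<le> hausdorff_measure s x"
      by (rule metric_outer_measure_closed)
         (auto intro: hausdorff_measure_separated hausdorff_measure_mono hausdorff_measure_empty
           hausdorff_measure_subadd that)
    have "subadditive (Pow UNIV) (hausdorff_measure s :: 'a set \<Rightarrow> ennreal)"
      using oms unfolding outer_measure_space_def by (metis countably_subadditive_subadditive)
    from subadditiveD[OF this, of "x \<inter> F" "x - F"]
    show "hausdorff_measure s x \<le> hausdorff_measure s (x \<inter> F) + hausdorff_measure s (x - F)"
      by (simp add: Int_Diff_Un Int_Diff_disjoint)
  qed
  have "sets (borel :: 'a measure) \<subseteq> ?L"
    unfolding borel_eq_closed
    by (subst sets_measure_of, simp, rule L.sigma_sets_subset) (use cl in auto)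
  moreover have "sigma_algebra UNIV (sets (borel :: 'a measure))"
    by (metis sets.sigma_algebra_axioms space_borel)
  ultimately show ?thesis using measure_down[OF ms] by blast
qed

section \<open>Words and cells of a self-similar set\<close>

text \<open>After translation and rescaling the map is an isometry fixing 0, hence orthogonal and
  onto in finite dimension. Surjectivity makes the images of balls balls again, which the volume
  packing needs.\<close>

lemma similitude_surj:
  fixes f :: "'a::euclidean_space \<Rightarrow> 'a"
  assumes "similitude f c" "c > 0"
  shows "surj f"
proof -
  define g where "g x = (1 / c) *\<^sub>R (f x - f 0)" for x
  have "dist (g x) (g y) = dist x y" for x y
  proof -
    have "dist (g x) (g y) = (1 / c) * dist (f x) (f y)"
      unfolding g_def dist_norm using assms(2)
      by (simp flip: scaleR_diff_right)
    then show ?thesis using assms by (simp add: similitude_def)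
  qed
  then have "orthogonal_transformation g"
    unfolding orthogonal_transformation_isometry by (simp add: g_def)
  then have "surj g" by (rule orthogonal_transformation_surj)
  show ?thesis
    unfolding surj_def
  proof
    fix y
    obtain x where "(1 / c) *\<^sub>R (y - f 0) = g x" using \<open>surj g\<close> unfolding surj_def by blast
    then have "y = f x" using assms(2) by (simp add: g_def)
    then show "\<exists>x. y = f x" ..
  qed
qed

lemma rw_simps [simp]: "rw \<rho> [] = 1" "rw \<rho> (i # w) = \<rho> i * rw \<rho> w" "rw \<rho> (u @ v) = rw \<rho> u * rw \<rho> v"
  by (simp_all add: rw_def)

lemma Sw_append: "Sw S (u @ v) = Sw S u \<circ> Sw S v"
  by (induction u) (auto simp: comp_assoc)

locale ifs =
  fixes N :: nat and S :: "nat \<Rightarrow> 'a::euclidean_space \<Rightarrow> 'a" and \<rho> :: "nat \<Rightarrow> real" and K :: "'a set"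
  assumes N2: "N \<ge> 2"
    and sim: "\<forall>i\<in>{1..N}. 0 < \<rho> i \<and> \<rho> i < 1 \<and> similitude (S i) (\<rho> i)"
    and osc: "osc N S"
    and K_compact: "compact K" and K_ne: "K \<noteq> {}" and K_self: "K = (\<Union>i\<in>{1..N}. S i ` K)"
begin

abbreviation "r \<equiv> rmin N \<rho>"
abbreviation "W \<equiv> {w. set w \<subseteq> {1..N}}"
abbreviation "Jn \<equiv> J N \<rho>"
abbreviation "Kw w \<equiv> Sw S w ` K"

section \<open>Words, ratios and levels\<close>

definition "rmax = Max (\<rho> ` {1..N})"

lemma rho: "i \<in> {1..N} \<Longrightarrow> 0 < \<rho> i" "i \<in> {1..N} \<Longrightarrow> \<rho> i < 1"
  "i \<in> {1..N} \<Longrightarrow> r \<le> \<rho> i" "i \<in> {1..N} \<Longrightarrow> \<rho> i \<le> rmax"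
  using sim by (auto simp: rmin_def rmax_def)

lemma r01: "0 < r" "r < 1"
proof -
  have "r \<in> \<rho> ` {1..N}" unfolding rmin_def using N2 by (intro Min_in) auto
  then show "0 < r" "r < 1" using sim by auto
qed

lemma rmax01: "0 < rmax" "rmax < 1"
proof -
  have "rmax \<in> \<rho> ` {1..N}" unfolding rmax_def using N2 by (intro Max_in) auto
  then show "0 < rmax" "rmax < 1" using sim by auto
qed

lemma rw_pos: "w \<in> W \<Longrightarrow> 0 < rw \<rho> w"
  by (induction w) (use rho(1) in auto)

lemma rw_le1: "w \<in> W \<Longrightarrow> rw \<rho> w \<le> 1"
proof (induction w)
  case (Cons i w)
  then show ?case using rho[of i] rw_pos[of w] by (auto intro: mult_le_one)
qed simp

lemma rw_prefix_le: "v \<in> W \<Longrightarrow> prefix u v \<Longrightarrow> rw \<rho> v \<le> rw \<rho> u"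
  using rw_le1 rw_pos by (auto simp: prefix_def mult_left_le less_imp_le)

text \<open>One formula for all levels, including 0: no product of ratios exceeds 1, so no nonempty
  word satisfies the strict inequality there.\<close>

lemma J_iff: "w \<in> Jn n \<longleftrightarrow> w \<in> W \<and> rw \<rho> w \<le> r ^ n \<and> (w = [] \<or> r ^ n < rw \<rho> (butlast w))"
proof (cases n)
  case 0
  have "\<not> 1 < rw \<rho> (butlast w)" if "w \<in> W"
    using that rw_le1[of "butlast w"] in_set_butlastD by fastforce
  then show ?thesis using 0 by auto
next
  case (Suc m)
  have "\<not> 1 \<le> r ^ Suc m" using r01 by (simp add: power_Suc_less_one not_le del: power_Suc)
  then show ?thesis using Suc by (auto simp del: power_Suc)
qed

lemma J_W: "w \<in> Jn n \<Longrightarrow> w \<in> W" by (simp add: J_iff)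

lemma J_le: "w \<in> Jn n \<Longrightarrow> rw \<rho> w \<le> r ^ n" by (simp add: J_iff)

text \<open>The last letter shrinks by a factor of at least r, so the ratio of a level-n word
  overshoots \<open>r ^ n\<close> by less than one more factor r. This makes the levels disjoint and
  all cells of a level comparable in size.\<close>

lemma J_gt:
  assumes "w \<in> Jn n" shows "r ^ Suc n < rw \<rho> w"
proof (cases w rule: rev_cases)
  case Nil
  then have "1 \<le> r ^ n" using assms by (simp add: J_iff)
  moreover have "r ^ Suc n < r ^ n" using r01 by simp
  moreover have "r ^ n \<le> 1" using r01 by (simp add: power_le_one)
  ultimately show ?thesis using Nil by simp
next
  case (snoc u i)
  then have "r ^ n < rw \<rho> u" "i \<in> {1..N}" using assms by (auto simp: J_iff)
  then have "r * r ^ n < \<rho> i * rw \<rho> u"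
    using rho(3)[of i] r01 by (smt (verit) mult_less_cancel_left_pos mult_right_mono zero_less_power)
  then show ?thesis using snoc by (simp add: mult.commute)
qed

lemma r_power_less: "m < n \<Longrightarrow> r ^ n < r ^ m" "m \<le> n \<Longrightarrow> r ^ n \<le> r ^ m"
  using r01 by (auto intro: power_strict_decreasing power_decreasing)

lemma J_disj: "w \<in> Jn n \<Longrightarrow> w \<in> Jn m \<Longrightarrow> n = m"
proof (induction n m rule: linorder_wlog)
  case (le a b)
  show ?case
  proof (rule ccontr)
    assume "a \<noteq> b"
    then have "r ^ b \<le> r ^ Suc a" using le by (intro r_power_less) auto
    then show False using J_gt[OF le(2)] J_le[OF le(3)] by linarith
  qed
qed auto

lemma lev_eq: "w \<in> Jn n \<Longrightarrow> lev N \<rho> w = n"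
  unfolding lev_def using J_disj by blast

lemma J_prefix_eq:
  assumes "y \<in> Jn n" "y' \<in> Jn n" "prefix y y'" shows "y = y'"
proof (rule ccontr)
  assume "y \<noteq> y'"
  then have p: "prefix y (butlast y')" and "y' \<noteq> []" using assms(3)
    by (metis prefix_snoc snoc_eq_iff_butlast prefix_Nil)+
  then have "r ^ n < rw \<rho> (butlast y')" "butlast y' \<in> W" using assms(2)
    by (auto simp: J_iff dest: in_set_butlastD)
  then show False using rw_prefix_le[OF _ p] J_le[OF assms(1)] by simp
qed

lemma J_prefix_unique:
  assumes "y \<in> Jn n" "y' \<in> Jn n" "prefix y v" "prefix y' v" shows "y = y'"
  using prefix_same_cases[OF assms(3,4)] J_prefix_eq assms(1,2) by metis

lemma J_prefix_exists: "v \<in> W \<Longrightarrow> rw \<rho> v \<le> r ^ n \<Longrightarrow> \<exists>y\<in>Jn n. prefix y v"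
proof (induction v rule: rev_induct)
  case Nil
  then show ?case by (auto simp: J_iff intro!: bexI[of _ "[]"])
next
  case (snoc i u)
  show ?case
  proof (cases "rw \<rho> u \<le> r ^ n")
    case True
    then show ?thesis using snoc by (auto intro: prefix_prefix)
  next
    case False
    then have "u @ [i] \<in> Jn n" using snoc by (auto simp: J_iff)
    then show ?thesis by blast
  qed
qed

text \<open>Backward induction from the cut \<open>Jn n\<close> to its prefixes. It is well founded
  because each appended letter multiplies the ratio by at most \<open>rmax < 1\<close>.\<close>

lemma cut_induct [consumes 2, case_names base step]:
  assumes "v \<in> W" "v \<in> Jn n \<or> r ^ n < rw \<rho> v"
    and base: "\<And>v. v \<in> Jn n \<Longrightarrow> P v"
    and step: "\<And>v. v \<in> W \<Longrightarrow> r ^ n < rw \<rho> v \<Longrightarrow> (\<And>i. i \<in> {1..N} \<Longrightarrow> P (v @ [i])) \<Longrightarrow> P v"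
  shows "P v"
proof -
  have "P v" if "rw \<rho> v * rmax ^ k \<le> r ^ n" "v \<in> W" "v \<in> Jn n \<or> r ^ n < rw \<rho> v" for k v
    using that
  proof (induction k arbitrary: v)
    case 0
    then show ?case using base by auto
  next
    case (Suc k)
    show ?case
    proof (cases "v \<in> Jn n")
      case False
      then have v: "r ^ n < rw \<rho> v" using Suc by auto
      show ?thesis
      proof (rule step[OF Suc(3) v])
        fix i assume i: "i \<in> {1..N}"
        have "rw \<rho> (v @ [i]) * rmax ^ k \<le> rw \<rho> v * rmax ^ Suc k"
          using rho(4)[OF i] rw_pos[OF Suc(3)] rmax01 by (simp add: mult_right_mono)
        then show "P (v @ [i])" using Suc i v by (intro Suc.IH) (auto simp: J_iff)
      qed
    qed (rule base)
  qed
  moreover obtain k where "rmax ^ k < r ^ n / rw \<rho> v"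
    using real_arch_pow_inv[of "r ^ n / rw \<rho> v" rmax] r01 rmax01 rw_pos[OF assms(1)] by auto
  then have "rw \<rho> v * rmax ^ k \<le> r ^ n" using rw_pos[OF assms(1)] by (simp add: field_simps)
  ultimately show ?thesis using assms(1,2) by blast
qed

section \<open>Extensions of a word to a given level\<close>

definition "ext n v = {z \<in> Jn n. prefix v z}"

lemma ext_self: "v \<in> Jn n \<Longrightarrow> ext n v = {v}"
  using J_prefix_eq by (auto simp: ext_def)

lemma ext_step:
  assumes "r ^ n < rw \<rho> v" shows "ext n v = (\<Union>i\<in>{1..N}. ext n (v @ [i]))"
proof (intro set_eqI iffI)
  fix z assume "z \<in> ext n v"
  then have z: "z \<in> Jn n" "prefix v z" by (auto simp: ext_def)
  then have "z \<noteq> v" using assms J_le[of v n] by auto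
  then obtain i u where "z = v @ i # u" using z by (metis append_Nil2 list.exhaust prefixE)
  then show "z \<in> (\<Union>i\<in>{1..N}. ext n (v @ [i]))" using z J_W[OF z(1)] by (auto simp: ext_def)
qed (auto simp: ext_def dest: append_prefixD)

lemma ext_disjoint: "i \<noteq> j \<Longrightarrow> ext n (v @ [i]) \<inter> ext n (v @ [j]) = {}"
  by (auto simp: ext_def prefix_def)

lemma finite_ext: "v \<in> W \<Longrightarrow> v \<in> Jn n \<or> r ^ n < rw \<rho> v \<Longrightarrow> finite (ext n v)"
  by (induction v rule: cut_induct) (auto simp: ext_self ext_step)

text \<open>A mass that is conserved when one letter is appended is conserved along every cut,
  although the words of a level have different lengths.\<close>

lemma sum_ext:
  fixes g :: "nat list \<Rightarrow> real"
  assumes "v \<in> W" "v \<in> Jn n \<or> r ^ n < rw \<rho> v"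
    and g: "\<And>u. u \<in> W \<Longrightarrow> (\<Sum>i\<in>{1..N}. g (u @ [i])) = g u"
  shows "(\<Sum>z\<in>ext n v. g z) = g v"
  using assms(1,2)
proof (induction v rule: cut_induct)
  case (base v)
  then show ?case by (simp add: ext_self)
next
  case (step v)
  have "finite (ext n (v @ [i]))" if "i \<in> {1..N}" for i
    using step that by (intro finite_ext) (auto simp: J_iff)
  then have "(\<Sum>z\<in>ext n v. g z) = (\<Sum>i\<in>{1..N}. \<Sum>z\<in>ext n (v @ [i]). g z)"
    unfolding ext_step[OF step(2)] using ext_disjoint by (intro sum.UNION_disjoint) auto
  then show ?case using step g by simp
qed

lemma ext_Nil: "ext n [] = Jn n" by (simp add: ext_def)

lemma Nil_cut: "[] \<in> Jn n \<or> r ^ n < rw \<rho> []"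
  using r01 by (cases n) (auto simp: J_iff power_Suc_less_one simp del: power_Suc)

lemma J_cut: "v \<in> Jn m \<Longrightarrow> m \<le> n \<Longrightarrow> v \<in> Jn n \<or> r ^ n < rw \<rho> v"
  using J_gt[of v m] r_power_less(2)[of "Suc m" n] by (cases "m = n") auto

lemma finite_J: "finite (Jn n)"
  using finite_ext[OF _ Nil_cut] by (simp add: ext_Nil)

section \<open>Cells of the self-similar set\<close>

lemma Sw_dist: "w \<in> W \<Longrightarrow> dist (Sw S w x) (Sw S w y) = rw \<rho> w * dist x y"
  by (induction w) (use sim in \<open>auto simp: similitude_def\<close>)

lemma Sw_inj: "w \<in> W \<Longrightarrow> inj (Sw S w)"
  by (intro injI) (metis Sw_dist dist_eq_0_iff mult_eq_0_iff rw_pos less_irrefl)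

lemma Sw_continuous: "w \<in> W \<Longrightarrow> continuous_on X (Sw S w)"
  by (intro continuous_on_subset[OF lipschitz_on_continuous_on[of "rw \<rho> w" UNIV]] lipschitz_onI)
     (auto simp: Sw_dist rw_pos less_imp_le)

lemma Kw_subset: "w \<in> W \<Longrightarrow> Kw w \<subseteq> K"
proof (induction w)
  case (Cons i w)
  then have "Kw (i # w) \<subseteq> S i ` K" "i \<in> {1..N}" by auto
  then show ?case using K_self by blast
qed simp

lemma Kw_prefix: "v \<in> W \<Longrightarrow> prefix u v \<Longrightarrow> Kw v \<subseteq> Kw u"
  using Kw_subset by (auto simp: prefix_def Sw_append) blast

lemma Kw_compact: "w \<in> W \<Longrightarrow> compact (Kw w)"
  using K_compact Sw_continuous by (intro compact_continuous_image) auto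

lemma Kw_step: "Kw w = (\<Union>i\<in>{1..N}. Kw (w @ [i]))"
  by (subst K_self) (auto simp: Sw_append)

abbreviation "dK \<equiv> diameter K"

lemma dK_ge: "0 \<le> dK" by (simp add: diameter_ge_0 K_compact compact_imp_bounded)

lemma Kw_dist:
  assumes "w \<in> W" "x \<in> Kw w" "y \<in> Kw w" shows "dist x y \<le> rw \<rho> w * dK"
proof -
  obtain a b where "x = Sw S w a" "y = Sw S w b" "a \<in> K" "b \<in> K" using assms by auto
  then show ?thesis using Sw_dist[OF assms(1)] rw_pos[OF assms(1)]
    diameter_bounded_bound[OF compact_imp_bounded[OF K_compact]] by (simp add: mult_left_mono)
qed

lemma Kw_dist_J: "w \<in> Jn n \<Longrightarrow> x \<in> Kw w \<Longrightarrow> y \<in> Kw w \<Longrightarrow> dist x y \<le> r ^ n * dK"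
  using Kw_dist[OF J_W] mult_right_mono[OF J_le dK_ge] by (meson order_trans)

lemma Kw_ext: "v \<in> W \<Longrightarrow> v \<in> Jn n \<or> r ^ n < rw \<rho> v \<Longrightarrow> x \<in> Kw v \<Longrightarrow> \<exists>z\<in>ext n v. x \<in> Kw z"
proof (induction v rule: cut_induct)
  case (base v)
  then show ?case by (simp add: ext_self)
next
  case (step v)
  then obtain i where "i \<in> {1..N}" "x \<in> Kw (v @ [i])" using Kw_step[of v] by blast
  then obtain z where "z \<in> ext n (v @ [i])" "x \<in> Kw z" using step by blast
  then show ?case using \<open>i \<in> {1..N}\<close> unfolding ext_step[OF step(2)] by blast
qed

lemma K_cover: "K = (\<Union>w\<in>Jn n. Kw w)"
  using Kw_ext[OF _ Nil_cut] Kw_subset[OF J_W] by (fastforce simp: ext_Nil)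

text \<open>Volume packing: the images of a fixed ball inside the open set are disjoint.\<close>

lemma J_count:
  "\<exists>M>0. \<forall>n p. real (card {y\<in>Jn n. \<exists>x\<in>Kw y. dist x p \<le> R * r ^ n}) \<le> M"
proof -
  obtain V where V0: "open V \<and> V \<noteq> {} \<and> (\<forall>i\<in>{1..N}. S i ` V \<subseteq> V) \<and>
     (\<forall>i\<in>{1..N}. \<forall>j\<in>{1..N}. i \<noteq> j \<longrightarrow> S i ` V \<inter> S j ` V = {})"
    using osc unfolding osc_def by (elim exE)
  then have V: "open V" "V \<noteq> {}" "\<And>i. i \<in> {1..N} \<Longrightarrow> S i ` V \<subseteq> V"
    "\<And>i j. i \<in> {1..N} \<Longrightarrow> j \<in> {1..N} \<Longrightarrow> i \<noteq> j \<Longrightarrow> S i ` V \<inter> S j ` V = {}"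
    by simp_all
  obtain a e where e: "e > 0" "ball a e \<subseteq> V" using V by (meson ex_in_conv openE)
  have SV: "Sw S w ` V \<subseteq> V" if "w \<in> W" for w
    using that
  proof (induction w)
    case (Cons i w)
    then have "Sw S (i # w) ` V \<subseteq> S i ` V" "i \<in> {1..N}" by auto
    then show ?case using V(3) by blast
  qed simp
  \<comment> \<open>Distinct words of one level are never prefixes of each other, so they part at
    some letter, where the open set condition applies.\<close>
  have disj: "Sw S u ` V \<inter> Sw S v ` V = {}" if uv: "u \<in> Jn n" "v \<in> Jn n" "u \<noteq> v" for u v n
  proof -
    have "parallel u v" using uv J_prefix_eq by (auto simp: parallel_def)
    then obtain q b bs c cs where q: "b \<noteq> c" "u = q @ b # bs" "v = q @ c # cs"
      using parallel_decomp by blast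
    then have in_: "q \<in> W" "b \<in> {1..N}" "c \<in> {1..N}" "bs \<in> W" "cs \<in> W"
      using J_W[OF uv(1)] J_W[OF uv(2)] by auto
    have "Sw S u ` V \<subseteq> Sw S q ` (S b ` V)" "Sw S v ` V \<subseteq> Sw S q ` (S c ` V)"
      using SV[OF in_(4)] SV[OF in_(5)] unfolding q(2,3) Sw_append by auto
    moreover have "Sw S q ` (S b ` V) \<inter> Sw S q ` (S c ` V) = {}"
      using V(4)[OF in_(2,3) q(1)] image_Int[OF Sw_inj[OF in_(1)], of "S b ` V" "S c ` V"]
      by simp
    ultimately show ?thesis by blast
  qed
  have ballsub: "ball (Sw S w a) (rw \<rho> w * e) \<subseteq> Sw S w ` V" if "w \<in> W" for w
  proof
    fix x assume x: "x \<in> ball (Sw S w a) (rw \<rho> w * e)"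
    have "surj (Sw S w)"
      using that by (intro similitude_surj[of _ "rw \<rho> w"] rw_pos) (auto simp: similitude_def Sw_dist)
    then obtain y where y: "x = Sw S w y" by (metis surjD)
    then have "rw \<rho> w * dist a y < rw \<rho> w * e" using x Sw_dist[OF that] by simp
    then have "y \<in> V" using rw_pos[OF that] e by auto
    then show "x \<in> Sw S w ` V" using y by blast
  qed
  obtain D0 where "\<forall>x\<in>K. dist a x \<le> D0"
    using compact_imp_bounded[OF K_compact] bounded_any_center[of K a] by auto
  then have "K \<subseteq> cball a (max D0 1)" by (auto intro: le_max_iff_disj[THEN iffD2])
  then obtain D where D: "D > 0" "K \<subseteq> cball a D" by (metis less_max_iff_disj zero_less_one)
  \<comment> \<open>Distance of the cell to p, spread of the cell around the image of
    \<open>a\<close>, and radius of the inner ball, each in units of \<open>r ^ n\<close>.\<close>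
  define R' where "R' = \<bar>R\<bar> + D + e"
  have R': "R' > 0" using D e by (simp add: R'_def)
  define d where "d = DIM('a)"
  define M where "M = (R' / (r * e)) ^ d"
  have "real (card {y\<in>Jn n. \<exists>x\<in>Kw y. dist x p \<le> R * r ^ n}) \<le> M" for n p
  proof -
    let ?A = "{y\<in>Jn n. \<exists>x\<in>Kw y. dist x p \<le> R * r ^ n}"
    \<comment> \<open>The radius uses the lower bound \<open>r ^ Suc n\<close> of the ratio, so all
      balls of a level have the same volume and the count is a quotient of volumes.\<close>
    let ?B = "\<lambda>y. ball (Sw S y a) (r ^ Suc n * e)"
    have rn: "r ^ n > 0" using r01 by simp
    have sub: "?B y \<subseteq> ball p (R' * r ^ n)" if "y \<in> ?A" for y
    proof
      fix z assume z: "z \<in> ?B y"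
      from that obtain k where y: "y \<in> Jn n" and k: "k \<in> K" "dist (Sw S y k) p \<le> R * r ^ n" by auto
      have "dist (Sw S y a) (Sw S y k) = rw \<rho> y * dist a k" using Sw_dist J_W y by blast
      also have "\<dots> \<le> r ^ n * D" using J_le[OF y] k(1) D rn by (intro mult_mono) auto
      finally have 1: "dist (Sw S y a) (Sw S y k) \<le> r ^ n * D" .
      have "r * r ^ n * e \<le> 1 * r ^ n * e" using r01 e by (intro mult_right_mono) auto
      then have 2: "dist (Sw S y a) z < r ^ n * e" using z by (simp add: mult.assoc)
      have "R * r ^ n \<le> \<bar>R\<bar> * r ^ n" using rn by simp
      moreover have "dist p z \<le> dist (Sw S y k) p + dist (Sw S y a) (Sw S y k) + dist (Sw S y a) z"
        using dist_triangle[of p z "Sw S y k"] dist_triangle[of "Sw S y k" z "Sw S y a"]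
        by (simp add: dist_commute)
      ultimately have "dist p z < \<bar>R\<bar> * r ^ n + r ^ n * D + r ^ n * e" using 1 2 k(2) by linarith
      then show "z \<in> ball p (R' * r ^ n)" by (simp add: R'_def algebra_simps)
    qed
    have dj: "disjoint_family_on ?B ?A"
      unfolding disjoint_family_on_def
    proof (intro ballI impI)
      fix u v assume uv: "u \<in> ?A" "v \<in> ?A" "u \<noteq> v"
      have "?B y \<subseteq> Sw S y ` V" if "y \<in> ?A" for y
      proof -
        have "?B y \<subseteq> ball (Sw S y a) (rw \<rho> y * e)"
          using that J_gt[of y n] e by (intro subset_ball) auto
        then show ?thesis using ballsub[OF J_W[of y n]] that by blast
      qed
      note Int_mono[OF this[OF uv(1)] this[OF uv(2)]]
      also have "Sw S u ` V \<inter> Sw S v ` V = {}" using disj[of u n v] uv by simp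
      finally show "?B u \<inter> ?B v = {}" by (simp only: subset_empty)
    qed
    have fin: "finite ?A" using finite_J by simp
    have "(\<Sum>y\<in>?A. measure lborel (?B y)) = measure lborel (\<Union>y\<in>?A. ?B y)"
    proof (rule measure_UNION'[symmetric, OF fin])
      show "pairwise (\<lambda>i j. disjnt (?B i) (?B j)) ?A"
        using dj unfolding disjoint_family_on_def pairwise_def disjnt_def .
      show "?B y \<in> fmeasurable lborel" for y using emeasure_lborel_ball_finite by (intro fmeasurableI) auto
    qed
    also have "\<dots> \<le> measure lborel (ball p (R' * r ^ n))"
    proof (rule measure_mono_fmeasurable)
      show "(\<Union>y\<in>?A. ?B y) \<subseteq> ball p (R' * r ^ n)" by (rule UN_least) (rule sub)
      show "(\<Union>y\<in>?A. ?B y) \<in> sets lborel"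
        unfolding sets_lborel by (intro borel_open open_UN ballI open_ball)
      show "ball p (R' * r ^ n) \<in> fmeasurable lborel" using emeasure_lborel_ball_finite by (intro fmeasurableI) auto
    qed
    finally have "(\<Sum>y\<in>?A. measure lborel (?B y)) \<le> measure lborel (ball p (R' * r ^ n))" .
    moreover have "measure lborel (ball c t) = unit_ball_vol (real d) * t ^ d" if "t \<ge> 0" for c :: 'a and t
      using content_ball[OF that, of c] by (simp add: d_def)
    ultimately have "card ?A * (unit_ball_vol (real d) * (r ^ Suc n * e) ^ d)
        \<le> unit_ball_vol (real d) * (R' * r ^ n) ^ d"
      using rn R' e r01 by simp
    then have "card ?A * (r ^ Suc n * e) ^ d \<le> (R' * r ^ n) ^ d"
      using unit_ball_vol_pos[of "real d"] by (simp add: mult.left_commute)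
    then have "card ?A \<le> (R' * r ^ n) ^ d / (r ^ Suc n * e) ^ d"
      using r01 e by (simp add: field_simps)
    also have "\<dots> = M" unfolding M_def power_divide[symmetric] using r01 by (simp add: field_simps)
    finally show ?thesis .
  qed
  moreover have "M > 0" unfolding M_def using R' r01 e by simp
  ultimately show ?thesis by blast
qed

end

section \<open>Dimension and normalized Hausdorff measure\<close>

lemma hausdorff_approx_le_finite:
  assumes "finite I" "A \<subseteq> (\<Union>i\<in>I. C i)" "\<And>i. i \<in> I \<Longrightarrow> bounded (C i)"
    "\<And>i. i \<in> I \<Longrightarrow> diameter (C i) \<le> \<delta>" "0 \<le> \<delta>"
  shows "hausdorff_approx s \<delta> A \<le> (\<Sum>i\<in>I. hpow s (C i))"
proof -
  obtain h where h: "bij_betw h {0..<card I} I" using ex_bij_betw_nat_finite[OF assms(1)] by blast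
  let ?D = "\<lambda>i. if i < card I then C (h i) else {}"
  have hI: "h i \<in> I" if "i < card I" for i using h that by (auto simp: bij_betw_def)
  have "hausdorff_approx s \<delta> A \<le> (\<Sum>i. hpow s (?D i))"
  proof (rule hausdorff_approx_le)
    show "A \<subseteq> (\<Union>i. ?D i)"
    proof
      fix x assume "x \<in> A"
      then obtain i where "i \<in> I" "x \<in> C i" using assms by blast
      moreover have "i \<in> h ` {0..<card I}" using h \<open>i \<in> I\<close> by (simp add: bij_betw_def)
      ultimately obtain j where "j < card I" "h j = i" by auto
      then show "x \<in> (\<Union>i. ?D i)" using \<open>x \<in> C i\<close> by (auto intro!: exI[of _ j])
    qed
  qed (use assms hI in auto)
  also have "\<dots> = (\<Sum>i<card I. hpow s (?D i))" by (intro suminf_finite) auto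
  also have "\<dots> = (\<Sum>i\<in>{0..<card I}. hpow s (C (h i)))" by (intro sum.cong) auto
  also have "\<dots> = (\<Sum>i\<in>I. hpow s (C i))" using sum.reindex_bij_betw[OF h] by simp
  finally show ?thesis .
qed

lemma sum_UN_le:
  fixes f :: "'b \<Rightarrow> real"
  assumes "finite I" "\<And>i. i \<in> I \<Longrightarrow> finite (A i)" "\<And>x. 0 \<le> f x"
  shows "sum f (\<Union>i\<in>I. A i) \<le> (\<Sum>i\<in>I. sum f (A i))"
  using assms(1,2)
proof (induction I rule: finite_induct)
  case (insert j I)
  have "sum f (A j \<union> (\<Union>i\<in>I. A i)) \<le> sum f (A j) + sum f (\<Union>i\<in>I. A i)"
    using insert assms(3) by (subst sum.union_inter[symmetric]) (auto intro!: sum_nonneg)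
  then show ?case using insert by simp
qed simp

text \<open>Images of covers are covers, with diameters scaled by c. One inequality suffices:
  equality for cells will follow from the total mass.\<close>

lemma hausdorff_measure_similitude_le:
  assumes f: "similitude f c" and "c > 0" "s > 0"
  shows "hausdorff_measure s (f ` A) \<le> ennreal (c powr s) * hausdorff_measure s A"
proof -
  have diam: "bounded (f ` C) \<and> diameter (f ` C) \<le> c * diameter C" if "bounded C" for C
  proof (cases "C = {}")
    case False
    have "dist x y \<le> c * diameter C" if "x \<in> f ` C" "y \<in> f ` C" for x y
      using that f \<open>c > 0\<close> diameter_bounded_bound[OF \<open>bounded C\<close>]
      by (auto simp: similitude_def intro!: mult_left_mono)
    then have "diameter (f ` C) \<le> c * diameter C"
      using False by (intro diameter_le) (auto simp: dist_norm)
    moreover have "bounded (f ` C)"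
      using \<open>\<And>x y. \<lbrakk>x \<in> f ` C; y \<in> f ` C\<rbrakk> \<Longrightarrow> dist x y \<le> c * diameter C\<close>
      unfolding bounded_two_points by blast
    ultimately show ?thesis by simp
  qed (use assms in auto)
  have "hausdorff_approx s \<delta> (f ` A) \<le> ennreal (c powr s) * hausdorff_measure s A" if "\<delta> > 0" for \<delta>
  proof -
    have "hausdorff_approx s \<delta> (f ` A) \<le> ennreal (c powr s) * (\<Sum>i. hpow s (C i))"
      if C: "A \<subseteq> \<Union> (range C)" "\<forall>i. bounded (C i) \<and> diameter (C i) \<le> \<delta> / c" for C :: "nat \<Rightarrow> 'a set"
    proof -
      have "hausdorff_approx s \<delta> (f ` A) \<le> (\<Sum>i. hpow s (f ` C i))"
      proof (rule hausdorff_approx_le)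
        show "f ` A \<subseteq> (\<Union>i. f ` C i)" using C by blast
        fix i
        show "bounded (f ` C i)" using diam C by blast
        have "c * diameter (C i) \<le> \<delta>" using C \<open>c > 0\<close> by (simp add: field_simps)
        then show "diameter (f ` C i) \<le> \<delta>" using diam C by (meson order_trans)
      qed
      also have "\<dots> \<le> (\<Sum>i. ennreal (c powr s) * hpow s (C i))"
      proof (intro suminf_le)
        fix i
        have "diameter (f ` C i) powr s \<le> (c * diameter (C i)) powr s"
          using diam C \<open>s > 0\<close> by (intro powr_mono2) (auto simp: diameter_ge_0)
        also have "\<dots> = c powr s * diameter (C i) powr s"
          using \<open>c > 0\<close> C by (intro powr_mult) 
        finally show "hpow s (f ` C i) \<le> ennreal (c powr s) * hpow s (C i)"
          using \<open>s > 0\<close> by (auto simp: hpow_def ennreal_mult[symmetric] intro!: ennreal_leI)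
      qed auto
      finally show ?thesis by simp
    qed
    then have "hausdorff_approx s \<delta> (f ` A) / ennreal (c powr s) \<le> hausdorff_approx s (\<delta> / c) A"
      unfolding hausdorff_approx_def[of s "\<delta> / c" A] using \<open>c > 0\<close>
      by (intro INF_greatest divide_le_posI_ennreal) (auto simp: mult.commute)
    then have "ennreal (c powr s) * (hausdorff_approx s \<delta> (f ` A) / ennreal (c powr s))
        \<le> ennreal (c powr s) * hausdorff_approx s (\<delta> / c) A"
      by (rule mult_left_mono) simp
    then have "hausdorff_approx s \<delta> (f ` A) \<le> ennreal (c powr s) * hausdorff_approx s (\<delta> / c) A"
      unfolding ennreal_times_divide mult.commute[of _ "hausdorff_approx s \<delta> (f ` A)"]
      using \<open>c > 0\<close> by (subst (asm) mult_divide_eq_ennreal) auto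
    also have "\<dots> \<le> ennreal (c powr s) * hausdorff_measure s A"
      using that \<open>c > 0\<close> by (intro mult_left_mono hausdorff_measure_ge) auto
    finally show ?thesis .
  qed
  then show ?thesis unfolding hausdorff_measure_def[of s "f ` A"] by (intro SUP_least) auto
qed

context ifs
begin

text \<open>Intermediate value theorem: the sum is \<open>N \<ge> 2\<close> at exponent 0 and drops
  below 1 once \<open>rmax ^ k < 1 / N\<close>.\<close>

lemma similarity_exponent: obtains s where "s > 0" "(\<Sum>i\<in>{1..N}. \<rho> i powr s) = 1"
proof -
  let ?f = "\<lambda>s. \<Sum>i\<in>{1..N}. \<rho> i powr s"
  obtain k where k: "rmax ^ k < 1 / N" using real_arch_pow_inv[of "1 / N" rmax] N2 rmax01 by auto
  have "?f (real k) \<le> (\<Sum>i\<in>{1..N}. rmax ^ k)"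
    using rho by (intro sum_mono) (auto simp: powr_realpow less_imp_le intro!: power_mono)
  also have "\<dots> < 1" using k N2 by (simp add: field_simps)
  finally have "?f (real k) \<le> 1" by simp
  moreover have "?f 0 = N" using rho by (simp add: order_less_imp_not_eq2)
  moreover have "continuous_on {0..real k} ?f"
    using rho(1) by (intro continuous_on_sum continuous_on_powr continuous_intros) force
  ultimately obtain s where s: "0 \<le> s" "?f s = 1"
    using IVT2'[of ?f "real k" 1 0] N2 by auto
  moreover have "s \<noteq> 0" using s \<open>?f 0 = N\<close> N2 by auto
  ultimately show ?thesis by (intro that[of s]) simp_all
qed

lemma sum_powr_step:
  assumes "(\<Sum>i\<in>{1..N}. \<rho> i powr s) = 1" "u \<in> W"
  shows "(\<Sum>i\<in>{1..N}. rw \<rho> (u @ [i]) powr s) = rw \<rho> u powr s"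
proof -
  have "(\<Sum>i\<in>{1..N}. rw \<rho> (u @ [i]) powr s) = (\<Sum>i\<in>{1..N}. rw \<rho> u powr s * \<rho> i powr s)"
    by (intro sum.cong) (auto simp: powr_mult)
  then show ?thesis using assms(1) by (simp flip: sum_distrib_left)
qed

lemma sum_powr_ext:
  assumes "(\<Sum>i\<in>{1..N}. \<rho> i powr s) = 1" "v \<in> W" "v \<in> Jn n \<or> r ^ n < rw \<rho> v"
  shows "(\<Sum>z\<in>ext n v. rw \<rho> z powr s) = rw \<rho> v powr s"
  by (rule sum_ext[OF assms(2,3) sum_powr_step[OF assms(1)]])

lemma sum_powr_J: "(\<Sum>i\<in>{1..N}. \<rho> i powr s) = 1 \<Longrightarrow> (\<Sum>z\<in>Jn n. rw \<rho> z powr s) = 1"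
  using sum_powr_ext[OF _ _ Nil_cut] by (simp add: ext_Nil)

text \<open>The level-n cells serve as a cover. Their s-weights add up to 1, and the excess exponent
  t - s leaves a power of the mesh, which tends to 0 when t > s.\<close>

lemma hausdorff_approx_K_le:
  assumes s: "s > 0" "(\<Sum>i\<in>{1..N}. \<rho> i powr s) = 1" and t: "t \<ge> s" and n: "r ^ n * dK \<le> \<delta>"
  shows "hausdorff_approx t \<delta> K \<le> ennreal ((r ^ n) powr (t - s) * dK powr t)"
proof -
  have "hausdorff_approx t \<delta> K \<le> (\<Sum>w\<in>Jn n. hpow t (Kw w))"
  proof (rule hausdorff_approx_le_finite[OF finite_J])
    show "K \<subseteq> \<Union> (Kw ` Jn n)" using K_cover by blast
    show "0 \<le> \<delta>" using n dK_ge r01 by (meson order_trans mult_nonneg_nonneg less_imp_le zero_less_power)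
    fix w assume w: "w \<in> Jn n"
    show "bounded (Kw w)" using Kw_compact[OF J_W[OF w]] compact_imp_bounded by blast
    have "diameter (Kw w) \<le> r ^ n * dK"
      using K_ne Kw_dist_J[OF w] by (intro diameter_le) (auto simp: dist_norm)
    then show "diameter (Kw w) \<le> \<delta>" using n by simp
  qed
  also have "\<dots> \<le> (\<Sum>w\<in>Jn n. ennreal (rw \<rho> w powr s * ((r ^ n) powr (t - s) * dK powr t)))"
  proof (rule sum_mono)
    fix w assume w: "w \<in> Jn n"
    have p: "rw \<rho> w > 0" using rw_pos[OF J_W[OF w]] .
    have "diameter (Kw w) \<le> rw \<rho> w * dK"
      using K_ne Kw_dist[OF J_W[OF w]] by (intro diameter_le) (auto simp: dist_norm)
    then have "diameter (Kw w) powr t \<le> (rw \<rho> w * dK) powr t"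
      using diameter_ge_0[OF compact_imp_bounded[OF Kw_compact[OF J_W[OF w]]]] s t
      by (intro powr_mono2) auto
    also have "\<dots> = rw \<rho> w powr s * rw \<rho> w powr (t - s) * dK powr t"
      using p dK_ge by (simp add: powr_mult powr_add[symmetric])
    also have "\<dots> \<le> rw \<rho> w powr s * (r ^ n) powr (t - s) * dK powr t"
      using p J_le[OF w] t by (intro mult_right_mono mult_left_mono powr_mono2) auto
    finally show "hpow t (Kw w) \<le> ennreal (rw \<rho> w powr s * ((r ^ n) powr (t - s) * dK powr t))"
      using s t K_ne by (auto simp: hpow_def mult.assoc intro!: ennreal_leI)
  qed
  also have "\<dots> = ennreal (\<Sum>w\<in>Jn n. rw \<rho> w powr s * ((r ^ n) powr (t - s) * dK powr t))"
    by (intro sum_ennreal) auto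
  also have "\<dots> = ennreal ((r ^ n) powr (t - s) * dK powr t)"
    using sum_powr_J[OF s(2)] by (simp flip: sum_distrib_right)
  finally show ?thesis .
qed

lemma ex_small_power: "\<delta> > 0 \<Longrightarrow> \<exists>n. r ^ n * dK \<le> \<delta>"
proof -
  assume "\<delta> > 0"
  then have "\<delta> / (dK + 1) > 0" using dK_ge by simp
  then obtain n where "r ^ n < \<delta> / (dK + 1)" using real_arch_pow_inv[of _ r] r01 by blast
  then have "r ^ n * (dK + 1) < \<delta>" using dK_ge by (simp add: field_simps)
  moreover have "r ^ n * dK \<le> r ^ n * (dK + 1)" using r01 by (intro mult_left_mono) auto
  ultimately show ?thesis by (intro exI[of _ n]) linarith
qed

lemma hausdorff_K_finite:
  assumes s: "s > 0" "(\<Sum>i\<in>{1..N}. \<rho> i powr s) = 1"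
  shows "hausdorff_measure s K < top"
proof -
  have "hausdorff_measure s K \<le> ennreal (dK powr s)"
    unfolding hausdorff_measure_def
  proof (rule SUP_least)
    fix \<delta> :: real assume "\<delta> \<in> {0<..}"
    then obtain n where "r ^ n * dK \<le> \<delta>" using ex_small_power by auto
    then show "hausdorff_approx s \<delta> K \<le> ennreal (dK powr s)"
      using hausdorff_approx_K_le[OF s order_refl] r01 by (fastforce simp: powr_def)
  qed
  then show ?thesis by (simp add: le_less_trans)
qed

lemma hausdorff_K_zero:
  assumes s: "s > 0" "(\<Sum>i\<in>{1..N}. \<rho> i powr s) = 1" and t: "t > s"
  shows "hausdorff_measure t K = 0"
proof -
  have "hausdorff_approx t \<delta> K = 0" if \<delta>: "\<delta> > 0" for \<delta>
  proof -
    obtain m where m: "r ^ m * dK \<le> \<delta>" using ex_small_power[OF \<delta>] by auto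
    have "hausdorff_approx t \<delta> K \<le> ennreal ((r ^ n) powr (t - s) * dK powr t)" if "n \<ge> m" for n
    proof (rule hausdorff_approx_K_le[OF s])
      have "r ^ n * dK \<le> r ^ m * dK" using r_power_less(2)[OF that] dK_ge by (intro mult_right_mono)
      then show "r ^ n * dK \<le> \<delta>" using m by simp
    qed (use t in auto)
    moreover have "(\<lambda>n. ennreal ((r ^ n) powr (t - s) * dK powr t)) \<longlonglongrightarrow> ennreal (0 powr (t - s) * dK powr t)"
      using r01 t by (intro tendsto_ennrealI tendsto_mult tendsto_powr' LIMSEQ_power_zero tendsto_const) auto
    ultimately have "hausdorff_approx t \<delta> K \<le> 0"
      by (intro LIMSEQ_le_const[of _ "0::ennreal"]) auto
    then show ?thesis by simp
  qed
  then show ?thesis unfolding hausdorff_measure_def by (intro antisym SUP_least) auto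
qed

text \<open>Mass distribution principle in finite form: a covering set of size about
  \<open>r ^ n\<close> meets at most M cells of level n, each of weight at most
  \<open>(d i / r) powr s\<close>. Refining all these cells to one common level m recovers the total
  mass 1.\<close>

lemma cover_sum_ge:
  assumes s: "s > 0" "(\<Sum>i\<in>{1..N}. \<rho> i powr s) = 1"
    and M: "\<And>n p. real (card {y\<in>Jn n. \<exists>x\<in>Kw y. dist x p \<le> 1 * r ^ n}) \<le> M"
    and I: "finite I" "K \<subseteq> (\<Union>i\<in>I. U i)"
    and d: "\<And>i. i \<in> I \<Longrightarrow> 0 < d i \<and> d i \<le> (1::real)"
    and U: "\<And>i x y. i \<in> I \<Longrightarrow> x \<in> U i \<Longrightarrow> y \<in> U i \<Longrightarrow> dist x y \<le> d i"
  shows "r powr s \<le> M * (\<Sum>i\<in>I. d i powr s)"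
proof -
  have "\<exists>n. r ^ Suc n < d i \<and> d i \<le> r ^ n" if "i \<in> I" for i
  proof -
    have "\<exists>n. r ^ n < d i" using real_arch_pow_inv[of "d i" r] d[OF that] r01 by auto
    then have l: "r ^ (LEAST n. r ^ n < d i) < d i" by (rule LeastI_ex)
    then have "(LEAST n. r ^ n < d i) \<noteq> 0" using d[OF that] by (intro notI) auto
    then obtain n where n: "(LEAST n. r ^ n < d i) = Suc n" using not0_implies_Suc by blast
    then have "\<not> r ^ n < d i" using not_less_Least[of n "\<lambda>n. r ^ n < d i"] by auto
    then show ?thesis using l n by (intro exI[of _ n]) auto
  qed
  then obtain n where n: "\<And>i. i \<in> I \<Longrightarrow> r ^ Suc (n i) < d i \<and> d i \<le> r ^ n i" by metis
  define Q where "Q i = {w\<in>Jn (n i). Kw w \<inter> U i \<noteq> {}}" for i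
  have finQ: "finite (Q i)" for i using finite_J by (simp add: Q_def)
  define m where "m = Max (n ` I \<union> {0})"
  have nm: "n i \<le> m" if "i \<in> I" for i using that I(1) by (auto simp: m_def)
  have M0: "M \<ge> 0" using M[of 0 undefined] by linarith
  have Qsum: "(\<Sum>w\<in>Q i. rw \<rho> w powr s) \<le> M * (d i powr s / r powr s)" if i: "i \<in> I" for i
  proof (cases "U i = {}")
    case True
    then show ?thesis using M0 by (simp add: Q_def)
  next
    case False
    then obtain p where p: "p \<in> U i" by auto
    have "Q i \<subseteq> {y\<in>Jn (n i). \<exists>x\<in>Kw y. dist x p \<le> 1 * r ^ n i}"
      using U[OF i _ p] n[OF i] by (fastforce simp: Q_def)
    then have "card (Q i) \<le> card {y\<in>Jn (n i). \<exists>x\<in>Kw y. dist x p \<le> 1 * r ^ n i}"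
      using finite_J by (intro card_mono) auto
    then have cQ: "real (card (Q i)) \<le> M" using M[of "n i" p] by linarith
    have "(\<Sum>w\<in>Q i. rw \<rho> w powr s) \<le> (\<Sum>w\<in>Q i. d i powr s / r powr s)"
    proof (rule sum_mono)
      fix w assume "w \<in> Q i"
      then have w: "w \<in> Jn (n i)" by (simp add: Q_def)
      have "r * rw \<rho> w \<le> r * r ^ n i" using J_le[OF w] r01 by simp
      then have "rw \<rho> w * r \<le> d i" using n[OF i] by (simp add: mult.commute)
      then have "rw \<rho> w \<le> d i / r" using r01 by (simp add: pos_le_divide_eq)
      then have "rw \<rho> w powr s \<le> (d i / r) powr s"
        using rw_pos[OF J_W[OF w]] s by (intro powr_mono2) auto
      then show "rw \<rho> w powr s \<le> d i powr s / r powr s"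
        using r01 d[OF i] by (simp add: powr_divide)
    qed
    also have "\<dots> \<le> M * (d i powr s / r powr s)"
      using cQ by (simp add: mult_right_mono divide_right_mono)
    finally show ?thesis .
  qed
  have sub: "Jn m \<subseteq> (\<Union>i\<in>I. \<Union>w\<in>Q i. ext m w)"
  proof
    fix z assume z: "z \<in> Jn m"
    obtain k where k: "k \<in> K" using K_ne by auto
    have "Sw S z k \<in> K" using Kw_subset[OF J_W[OF z]] k by auto
    then obtain i where i: "i \<in> I" "Sw S z k \<in> U i" using I(2) by blast
    have "rw \<rho> z \<le> r ^ n i" using J_le[OF z] r_power_less(2)[OF nm[OF i(1)]] by simp
    then obtain w where w: "w \<in> Jn (n i)" "prefix w z" using J_prefix_exists[OF J_W[OF z]] by blast
    have "Sw S z k \<in> Kw w" using Kw_prefix[OF J_W[OF z] w(2)] k by blast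
    then have "w \<in> Q i" using w i by (auto simp: Q_def)
    then show "z \<in> (\<Union>i\<in>I. \<Union>w\<in>Q i. ext m w)" using i z w by (auto simp: ext_def)
  qed
  have finE: "finite (ext m w)" for w using finite_J by (simp add: ext_def)
  have "1 = (\<Sum>z\<in>Jn m. rw \<rho> z powr s)" using sum_powr_J[OF s(2)] by simp
  also have "\<dots> \<le> (\<Sum>z\<in>(\<Union>i\<in>I. \<Union>w\<in>Q i. ext m w). rw \<rho> z powr s)"
    using sub I(1) finQ finE by (intro sum_mono2) auto
  also have "\<dots> \<le> (\<Sum>i\<in>I. \<Sum>z\<in>(\<Union>w\<in>Q i. ext m w). rw \<rho> z powr s)"
    using I(1) finQ finE by (intro sum_UN_le) auto
  also have "\<dots> \<le> (\<Sum>i\<in>I. \<Sum>w\<in>Q i. \<Sum>z\<in>ext m w. rw \<rho> z powr s)"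
    using finQ finE by (intro sum_mono sum_UN_le) auto
  also have "\<dots> = (\<Sum>i\<in>I. \<Sum>w\<in>Q i. rw \<rho> w powr s)"
  proof (intro sum.cong refl)
    fix i w assume i: "i \<in> I" and "w \<in> Q i"
    then have w: "w \<in> Jn (n i)" by (simp add: Q_def)
    show "(\<Sum>z\<in>ext m w. rw \<rho> z powr s) = rw \<rho> w powr s"
      by (rule sum_powr_ext[OF s(2) J_W[OF w] J_cut[OF w nm[OF i]]])
  qed
  also have "\<dots> \<le> (\<Sum>i\<in>I. M * (d i powr s / r powr s))" by (intro sum_mono Qsum)
  also have "\<dots> = (M * (\<Sum>i\<in>I. d i powr s)) / r powr s"
    by (simp add: sum_distrib_left sum_divide_distrib)
  finally show ?thesis using r01 by (simp add: field_simps)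
qed

text \<open>All exponents up to s are treated at once, since the infimum defining the dimension must
  be shown to start exactly at s. As diameters are at most 1, lowering the exponent only raises the
  cost of a cover.\<close>

lemma hausdorff_K_pos:
  assumes s: "s > 0" "(\<Sum>i\<in>{1..N}. \<rho> i powr s) = 1" and t: "0 \<le> t" "t \<le> s"
  shows "hausdorff_measure t K > 0"
proof -
  obtain M :: real where "M > 0 \<and> (\<forall>n p. real (card {y\<in>Jn n. \<exists>x\<in>Kw y. dist x p \<le> 1 * r ^ n}) \<le> M)"
    using J_count[of 1] by (elim exE)
  then have M: "M > 0" "\<And>n p. real (card {y\<in>Jn n. \<exists>x\<in>Kw y. dist x p \<le> 1 * r ^ n}) \<le> M"
    by (simp_all only: simp_thms)
  \<comment> \<open>Half of the lower bound from \<open>cover_sum_ge\<close>: one e is spent on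
    enlarging the cover, the other remains.\<close>
  define e where "e = r powr s / (2 * M)"
  have e: "e > 0" using M(1) r01 by (simp add: e_def)
  have "ennreal e \<le> hausdorff_approx t (1/2) K"
    unfolding hausdorff_approx_def
  proof (rule INF_greatest, clarify)
    fix C :: "nat \<Rightarrow> 'a set"
    assume C: "K \<subseteq> \<Union> (range C)" "\<forall>i. bounded (C i) \<and> diameter (C i) \<le> 1 / 2"
    have D0: "0 \<le> diameter (C i)" for i using C by (simp add: diameter_ge_0)
    \<comment> \<open>The covering sets are enlarged to open ones so that compactness of K applies.
      The costs \<open>e * (1/2) ^ Suc i\<close> add up to at most e, and the new sizes are positive
      even for singletons.\<close>
    have "\<exists>\<eta>. 0 < \<eta> \<and> \<eta> \<le> 1/4 \<and> (diameter (C i) + 2 * \<eta>) powr s \<le> diameter (C i) powr s + e * (1/2)^Suc i" for i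
    proof -
      have "((\<lambda>x. (diameter (C i) + 2 * x) powr s) \<longlongrightarrow> (diameter (C i) + 2 * 0) powr s) (at_right 0)"
        using s D0[of i] by (intro tendsto_powr' tendsto_intros)
          (auto simp: eventually_at_filter intro!: always_eventually)
      moreover have "(diameter (C i) + 2 * 0) powr s < diameter (C i) powr s + e * (1/2)^Suc i"
        using e by simp
      ultimately have "eventually (\<lambda>x. (diameter (C i) + 2 * x) powr s < diameter (C i) powr s + e * (1/2)^Suc i) (at_right 0)"
        using order_tendstoD(2) by blast
      moreover have "eventually (\<lambda>x::real. 0 < x \<and> x < 1/4) (at_right 0)"
        by (auto simp: eventually_at_right_field intro!: exI[of _ "1/4"])
      ultimately have "eventually (\<lambda>x. (diameter (C i) + 2 * x) powr s < diameter (C i) powr s + e * (1/2)^Suc i \<and> 0 < x \<and> x < 1/4) (at_right 0)"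
        by eventually_elim auto
      then obtain x where "(diameter (C i) + 2 * x) powr s < diameter (C i) powr s + e * (1/2)^Suc i \<and> 0 < x \<and> x < 1/4"
        using eventually_happens[of _ "at_right (0::real)"] by (auto simp: trivial_limit_at_right_real)
      then show ?thesis by (intro exI[of _ x]) auto
    qed
    then obtain \<eta> where \<eta>: "\<And>i. 0 < \<eta> i" "\<And>i. \<eta> i \<le> 1/4"
      "\<And>i. (diameter (C i) + 2 * \<eta> i) powr s \<le> diameter (C i) powr s + e * (1/2)^Suc i"
      by metis
    define U where "U i = (\<Union>x\<in>C i. ball x (\<eta> i))" for i
    define d where "d i = diameter (C i) + 2 * \<eta> i" for i
    have "open (U i)" for i by (auto simp: U_def)
    moreover have KU: "K \<subseteq> (\<Union>i. U i)"
    proof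
      fix x assume "x \<in> K"
      then obtain i where "x \<in> C i" using C by blast
      then have "x \<in> U i" using \<eta>(1)[of i] by (auto simp: U_def intro!: bexI[of _ x])
      then show "x \<in> (\<Union>i. U i)" by blast
    qed
    ultimately obtain I where I: "finite I" "K \<subseteq> (\<Union>i\<in>I. U i)"
      using compactE_image[OF K_compact, of UNIV U] by (metis subset_UNIV)
    have dU: "dist x y \<le> d i" if xy: "x \<in> U i" "y \<in> U i" for x y i
    proof -
      obtain x' y' where "x' \<in> C i" "y' \<in> C i" "dist x' x < \<eta> i" "dist y' y < \<eta> i"
        using xy by (auto simp: U_def)
      moreover have "dist x' y' \<le> diameter (C i)"
        using C(2) calculation diameter_bounded_bound by blast
      moreover have "dist x y \<le> dist x' x + dist x' y' + dist y' y" by metric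
      ultimately show ?thesis by (simp add: d_def)
    qed
    have d1: "0 < d i \<and> d i \<le> 1" for i
    proof -
      have "diameter (C i) \<le> 1/2" using C by blast
      then show ?thesis using \<eta>(1)[of i] \<eta>(2)[of i] D0[of i] by (auto simp: d_def)
    qed
    define I' where "I' = {i\<in>I. C i \<noteq> {}}"
    have I': "finite I'" "K \<subseteq> (\<Union>i\<in>I'. U i)" using I by (auto simp: I'_def U_def subset_iff) (metis empty_iff)
    have "r powr s \<le> M * (\<Sum>i\<in>I'. d i powr s)"
      by (rule cover_sum_ge[OF s M(2) I']) (use d1 dU in auto)
    then have "2 * e \<le> (\<Sum>i\<in>I'. d i powr s)" using M(1) by (simp add: e_def field_simps)
    also have "\<dots> \<le> (\<Sum>i\<in>I'. diameter (C i) powr s + e * (1/2)^Suc i)"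
      using \<eta>(3) by (intro sum_mono) (simp add: d_def)
    also have "\<dots> = (\<Sum>i\<in>I'. diameter (C i) powr s) + e * (\<Sum>i\<in>I'. (1/2)^Suc i)"
      by (simp add: sum.distrib sum_distrib_left)
    also have "(\<Sum>i\<in>I'. (1/2::real)^Suc i) \<le> 1"
      using sum_le_suminf[OF sums_summable[OF power_half_series] I'(1)] sums_unique[OF power_half_series] by simp
    finally have "e \<le> (\<Sum>i\<in>I'. diameter (C i) powr s)" using e by (simp add: mult_left_le)
    then have "ennreal e \<le> (\<Sum>i\<in>I'. ennreal (diameter (C i) powr s))"
      by (subst sum_ennreal) (auto intro: ennreal_leI)
    also have "\<dots> \<le> (\<Sum>i\<in>I'. hpow t (C i))"
    proof (rule sum_mono)
      fix i assume "i \<in> I'"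
      then have ne: "C i \<noteq> {}" by (simp add: I'_def)
      have "diameter (C i) \<le> 1" using C(2)[rule_format, of i] by simp
      show "ennreal (diameter (C i) powr s) \<le> hpow t (C i)"
      proof (cases "t = 0 \<or> diameter (C i) = 0")
        case True
        have "diameter (C i) powr s \<le> 1" using \<open>diameter (C i) \<le> 1\<close> D0[of i] s by (simp add: powr_le1)
        then show ?thesis using True ne s by (auto simp: hpow_def)
      next
        case False
        then have "diameter (C i) powr s \<le> diameter (C i) powr t"
          using D0[of i] \<open>diameter (C i) \<le> 1\<close> t by (intro powr_mono') auto
        then show ?thesis using False ne by (auto simp: hpow_def intro: ennreal_leI)
      qed
    qed
    also have "\<dots> \<le> (\<Sum>i. hpow t (C i))" by (rule sum_le_suminf) (use I' in auto)
    finally show "ennreal e \<le> (\<Sum>i. hpow t (C i))" .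
  qed
  also have "\<dots> \<le> hausdorff_measure t K" by (rule hausdorff_measure_ge) simp
  finally show ?thesis using e by (meson ennreal_less_zero_iff less_le_trans)
qed

section \<open>Moran's theorem and the masses of cells\<close>

abbreviation "\<alpha> \<equiv> hausdorff_dim K"

lemma hausdorff_dim_K: "\<alpha> > 0" "(\<Sum>i\<in>{1..N}. \<rho> i powr \<alpha>) = 1"
proof -
  obtain s where s: "s > 0" "(\<Sum>i\<in>{1..N}. \<rho> i powr s) = 1" by (rule similarity_exponent)
  have "{t. 0 \<le> t \<and> hausdorff_measure t K = 0} = {s<..}"
    using hausdorff_K_zero[OF s] hausdorff_K_pos[OF s] s(1) by (fastforce simp: not_le)
  then have "\<alpha> = s" by (simp add: hausdorff_dim_def)
  then show "\<alpha> > 0" "(\<Sum>i\<in>{1..N}. \<rho> i powr \<alpha>) = 1" using s by auto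
qed

text \<open>\<open>measure_of\<close> keeps a set function only if it is a measure and is
  identically 0 otherwise, so this is what gives \<open>nu\<close> its intended values.\<close>

lemma nu_measure_space:
  "measure_space UNIV (sets borel) (\<lambda>B. hausdorff_measure \<alpha> (B \<inter> K) / hausdorff_measure \<alpha> K)"
proof -
  have ca: "countably_additive (sets borel) (hausdorff_measure \<alpha> :: 'a set \<Rightarrow> ennreal)"
    using hausdorff_measure_measure_space[where 'a='a, of \<alpha>] by (simp add: measure_space_def)
  have Kb: "K \<in> sets borel" using K_compact by (simp add: borel_closed compact_imp_closed)
  have "countably_additive (sets borel) (\<lambda>B. hausdorff_measure \<alpha> (B \<inter> K) / hausdorff_measure \<alpha> K)"
    unfolding countably_additive_def
  proof (intro allI impI)
    fix A :: "nat \<Rightarrow> 'a set"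
    assume A: "range A \<subseteq> sets borel" "disjoint_family A" "\<Union> (range A) \<in> sets borel"
    have "(\<Sum>i. hausdorff_measure \<alpha> (A i \<inter> K)) = hausdorff_measure \<alpha> (\<Union>i. A i \<inter> K)"
    proof (rule ca[unfolded countably_additive_def, rule_format])
      show "range (\<lambda>i. A i \<inter> K) \<subseteq> sets borel" using A Kb by auto
      then show "(\<Union>i. A i \<inter> K) \<in> sets borel" by (intro sets.countable_UN) auto
      show "disjoint_family (\<lambda>i. A i \<inter> K)" using A(2) by (auto simp: disjoint_family_on_def)
    qed
    then show "(\<Sum>i. hausdorff_measure \<alpha> (A i \<inter> K) / hausdorff_measure \<alpha> K) =
       hausdorff_measure \<alpha> (\<Union> (range A) \<inter> K) / hausdorff_measure \<alpha> K"
      by (simp add: ennreal_suminf_divide)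
  qed
  moreover have "sigma_algebra UNIV (sets (borel :: 'a measure))"
    by (metis sets.sigma_algebra_axioms space_borel)
  ultimately show ?thesis
    by (simp add: measure_space_def positive_def hausdorff_measure_empty)
qed

lemma sets_nu [measurable_cong, simp]: "sets (nu K) = sets borel"
  unfolding nu_def by (subst sets_measure_of) (auto simp: sets.sigma_sets_eq[of borel, simplified])

lemma space_nu [simp]: "space (nu K) = UNIV"
  unfolding nu_def by (subst space_measure_of) auto

lemma emeasure_nu:
  "B \<in> sets borel \<Longrightarrow> emeasure (nu K) B = hausdorff_measure \<alpha> (B \<inter> K) / hausdorff_measure \<alpha> K"
  using nu_measure_space unfolding nu_def measure_space_def
  by (intro emeasure_measure_of_sigma) auto

lemma K_borel [measurable, simp]: "K \<in> sets borel"
  using K_compact by (simp add: borel_closed compact_imp_closed)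

lemma Kw_borel [simp]: "w \<in> W \<Longrightarrow> Kw w \<in> sets borel"
  using Kw_compact by (simp add: borel_closed compact_imp_closed)

lemma HK: "hausdorff_measure \<alpha> K \<noteq> 0" "hausdorff_measure \<alpha> K \<noteq> top"
  using hausdorff_K_pos[OF hausdorff_dim_K, of \<alpha>] hausdorff_K_finite[OF hausdorff_dim_K] hausdorff_dim_K(1)
  by (auto simp: less_imp_le)

lemma emeasure_nu_UNIV: "emeasure (nu K) UNIV = 1" and emeasure_nu_K: "emeasure (nu K) K = 1"
  using HK mult_divide_eq_ennreal[of "hausdorff_measure \<alpha> K" 1] by (simp_all add: emeasure_nu)

sublocale nu: finite_measure "nu K"
  by (rule finite_measureI) (simp add: emeasure_nu_UNIV)

lemma AE_nu_K: "AE x in nu K. x \<in> K"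
proof -
  have "emeasure (nu K) (UNIV - K) = 0"     using Diff_disjoint[of K UNIV] by (simp add: emeasure_nu hausdorff_measure_empty Int_commute)
  then show ?thesis by (intro AE_I[of _ _ "UNIV - K"]) auto
qed

definition "ww x = rw \<rho> x powr \<alpha>"

lemma ww_pos: "x \<in> Jn n \<Longrightarrow> ww x > 0"
  using rw_pos[OF J_W] by (simp add: ww_def order_less_imp_not_eq2)

lemma sum_ww_J: "(\<Sum>z\<in>Jn n. ww z) = 1"
  unfolding ww_def by (rule sum_powr_J[OF hausdorff_dim_K(2)])

text \<open>Scaling bounds each cell by its weight. The cells cover K, of mass 1, and the weights
  also add up to 1, so none of the inequalities can be strict.\<close>

lemma measure_nu_Kw:
  assumes "w \<in> Jn n" shows "measure (nu K) (Kw w) = ww w"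
proof -
  have le: "measure (nu K) (Kw v) \<le> ww v" if v: "v \<in> Jn n" for v
  proof -
    have vW: "v \<in> W" using J_W[OF v] .
    have "Kw v \<inter> K = Kw v" using Kw_subset[OF vW] by blast
    then have "emeasure (nu K) (Kw v) = hausdorff_measure \<alpha> (Kw v) / hausdorff_measure \<alpha> K"
      using emeasure_nu[OF Kw_borel[OF vW]] by simp
    also have "\<dots> \<le> ennreal (ww v) * hausdorff_measure \<alpha> K / hausdorff_measure \<alpha> K"
      unfolding ww_def using rw_pos[OF vW] hausdorff_dim_K(1) Sw_dist[OF vW]
      by (intro divide_right_mono_ennreal hausdorff_measure_similitude_le) (auto simp: similitude_def)
    also have "\<dots> = ennreal (ww v)" using HK by (rule mult_divide_eq_ennreal)
    finally show ?thesis using nu.emeasure_eq_measure by (simp add: ww_def)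
  qed
  have "1 \<le> (\<Sum>v\<in>Jn n. measure (nu K) (Kw v))"
  proof -
    have "1 = measure (nu K) (\<Union>v\<in>Jn n. Kw v)"
      using emeasure_nu_K K_cover[of n] by (simp add: measure_def)
    also have "\<dots> \<le> (\<Sum>v\<in>Jn n. measure (nu K) (Kw v))"
      using finite_J Kw_borel[OF J_W] by (intro nu.finite_measure_subadditive_finite) auto
    finally show ?thesis .
  qed
  then have "(\<Sum>v\<in>Jn n. ww v - measure (nu K) (Kw v)) \<le> 0"
    using sum_ww_J by (simp add: sum_subtractf)
  moreover have "0 \<le> (\<Sum>v\<in>Jn n. ww v - measure (nu K) (Kw v))" using le by (intro sum_nonneg) auto
  ultimately have "\<forall>v\<in>Jn n. ww v - measure (nu K) (Kw v) = 0"
    using le by (subst sum_nonneg_eq_0_iff[OF finite_J, symmetric]) auto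
  then show ?thesis using assms by auto
qed

text \<open>Overlaps are null: the number of level-n cells containing a point is at least 1 on K and
  has integral 1.\<close>

lemma AE_cells: "AE x in nu K. (\<Sum>w\<in>Jn n. indicator (Kw w) x) = (1::real)"
proof -
  have m[measurable]: "Kw w \<in> sets borel" if "w \<in> Jn n" for w using Kw_borel[OF J_W[OF that]] .
  have int: "integrable (nu K) (indicator (Kw w) :: 'a \<Rightarrow> real)" if "w \<in> Jn n" for w
    using m[OF that] by (intro nu.integrable_const_bound[of _ 1]) (auto simp: indicator_def)
  have ge: "1 \<le> (\<Sum>w\<in>Jn n. indicator (Kw w) x :: real)" if x: "x \<in> K" for x
  proof -
    obtain w where w: "w \<in> Jn n" "x \<in> Kw w" using K_cover[of n] x by blast
    have "(indicator (Kw w) x :: real) \<le> (\<Sum>w\<in>Jn n. indicator (Kw w) x)"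
      using w finite_J by (intro member_le_sum) auto
    then show ?thesis using w by simp
  qed
  have "integral\<^sup>L (nu K) (\<lambda>x. (\<Sum>w\<in>Jn n. indicator (Kw w) x) - (1::real)) = (\<Sum>w\<in>Jn n. ww w) - 1"
    using int measure_nu_Kw emeasure_nu_UNIV m
    by (subst Bochner_Integration.integral_diff) (auto simp: integrable_sum measure_def)
  then have "integral\<^sup>L (nu K) (\<lambda>x. (\<Sum>w\<in>Jn n. indicator (Kw w) x) - (1::real)) = 0"
    by (simp add: sum_ww_J)
  moreover have "AE x in nu K. 0 \<le> (\<Sum>w\<in>Jn n. indicator (Kw w) x) - (1::real)"
    using AE_nu_K by eventually_elim (use ge in auto)
  ultimately have "AE x in nu K. (\<Sum>w\<in>Jn n. indicator (Kw w) x) - (1::real) = 0"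
    using int by (subst (asm) integral_nonneg_eq_0_iff_AE) auto
  then show ?thesis by eventually_elim auto
qed

text \<open>Weighted sums over a level are Riemann sums for \<open>nu\<close>. This is how sums of
  Green functions over a level turn into integrals of the Martin kernel.\<close>

lemma riemann_sum_bound:
  assumes psi: "integrable (nu K) \<psi>"
    and e: "\<And>y x. y \<in> Jn n \<Longrightarrow> x \<in> Kw y \<Longrightarrow> \<bar>\<phi> y - \<psi> x\<bar> \<le> e"
  shows "\<bar>(\<Sum>y\<in>Jn n. ww y * \<phi> y) - (\<integral>x. \<psi> x \<partial>nu K)\<bar> \<le> e"
proof -
  let ?f = "\<lambda>x. \<Sum>y\<in>Jn n. indicator (Kw y) x * \<phi> y"
  have m: "Kw w \<in> sets borel" if "w \<in> Jn n" for w using Kw_borel[OF J_W[OF that]] .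
  have int: "integrable (nu K) (indicator (Kw w) :: 'a \<Rightarrow> real)" if "w \<in> Jn n" for w
    using m[OF that] by (intro nu.integrable_const_bound[of _ 1]) (auto simp: indicator_def)
  have intf: "integrable (nu K) ?f" by (intro Bochner_Integration.integrable_sum integrable_mult_left int)
  have "integral\<^sup>L (nu K) ?f = (\<Sum>y\<in>Jn n. ww y * \<phi> y)"
    using int measure_nu_Kw m by (subst Bochner_Integration.integral_sum) auto
  then have "(\<Sum>y\<in>Jn n. ww y * \<phi> y) - (\<integral>x. \<psi> x \<partial>nu K) = (\<integral>x. ?f x - \<psi> x \<partial>nu K)"
    using intf psi by simp
  also have "\<bar>\<dots>\<bar> \<le> (\<integral>x. \<bar>?f x - \<psi> x\<bar> \<partial>nu K)"
    using integral_norm_bound[of "nu K" "\<lambda>x. ?f x - \<psi> x"] by simp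
  also have "\<dots> \<le> (\<integral>x. e \<partial>nu K)"
  proof (rule integral_mono_AE)
    show "AE x in nu K. \<bar>?f x - \<psi> x\<bar> \<le> e"
      using AE_cells[of n]
    proof eventually_elim
      case (elim x)
      have "?f x - \<psi> x = ?f x - (\<Sum>w\<in>Jn n. indicator (Kw w) x) * \<psi> x" using elim by simp
      also have "\<dots> = (\<Sum>y\<in>Jn n. indicator (Kw y) x * (\<phi> y - \<psi> x))"
        by (simp add: sum_distrib_right sum_subtractf[symmetric] right_diff_distrib)
      also have "\<bar>\<dots>\<bar> \<le> (\<Sum>y\<in>Jn n. indicator (Kw y) x * e)"
        using e by (intro order_trans[OF sum_abs] sum_mono) (auto simp: indicator_def)
      also have "\<dots> = e" using elim by (simp flip: sum_distrib_right)
      finally show ?case .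
    qed
  qed (use intf psi in auto)
  also have "\<dots> = e" using emeasure_nu_UNIV by (simp add: measure_def)
  finally show ?thesis .
qed

end

section \<open>The augmented tree as a weighted graph\<close>

declare J.simps [simp del]

locale nrw = ifs N S \<rho> K
  for N :: nat and S :: "nat \<Rightarrow> 'a::euclidean_space \<Rightarrow> 'a" and \<rho> :: "nat \<Rightarrow> real" and K :: "'a set" +
  fixes \<gamma> lam :: real
  assumes gamma_pos: "0 < \<gamma>" and lam_pos: "0 < lam" and lam_less: "lam < rmin N \<rho> powr hausdorff_dim K"
begin

abbreviation "c x y \<equiv> cond N S \<rho> K \<gamma> lam x y"
abbreviation "nb x \<equiv> nbrs N S \<rho> K \<gamma> lam x"
abbreviation "lv x \<equiv> lev N \<rho> x"
definition "a = r powr \<alpha>"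
definition "par x = (THE y. y \<in> Jn (lv x - 1) \<and> prefix y x)"
definition "ch x = ext (Suc (lv x)) x"
definition "hn x = {y \<in> Jn (lv x). y \<noteq> x \<and> gap S K x y \<le> \<gamma> * r ^ lv x}"
definition "X = (\<Union>n. Jn n)"
definition "pt y = Sw S y (SOME p. p \<in> K)"

section \<open>Weights, parents and children\<close>

lemma a01: "0 < a" "a < 1" "lam < a" "lam < 1"
proof -
  show "0 < a" using r01 by (simp add: a_def)
  show "a < 1" using r01 hausdorff_dim_K(1) by (simp add: a_def powr01_less_one)
  show "lam < a" using lam_less by (simp add: a_def)
  then show "lam < 1" using \<open>a < 1\<close> by simp
qed

lemma X_J: "x \<in> X \<Longrightarrow> x \<in> Jn (lv x)"
  using lev_eq by (auto simp: X_def)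

lemma J_X: "x \<in> Jn n \<Longrightarrow> x \<in> X" by (auto simp: X_def)

lemma ww_le: "x \<in> Jn n \<Longrightarrow> ww x \<le> a ^ n"
proof -
  assume x: "x \<in> Jn n"
  have "ww x \<le> (r ^ n) powr \<alpha>" unfolding ww_def
    using J_le[OF x] rw_pos[OF J_W[OF x]] hausdorff_dim_K(1) by (intro powr_mono2) auto
  also have "\<dots> = a ^ n"
    using r01 by (simp add: a_def powr_realpow[symmetric] powr_powr mult.commute del: powr_realpow)
  finally show ?thesis .
qed

lemma ww_ge: "x \<in> Jn n \<Longrightarrow> a ^ Suc n \<le> ww x"
proof -
  assume x: "x \<in> Jn n"
  have "a ^ Suc n = (r ^ Suc n) powr \<alpha>"
    using r01 by (simp add: a_def powr_realpow[symmetric] powr_powr mult.commute del: powr_realpow power_Suc)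
  also have "\<dots> \<le> ww x" unfolding ww_def
    using J_gt[OF x] r01 hausdorff_dim_K(1) by (intro powr_mono2) auto
  finally show ?thesis .
qed

lemma par_J: "x \<in> Jn (Suc n) \<Longrightarrow> par x \<in> Jn n \<and> prefix (par x) x"
proof -
  assume x: "x \<in> Jn (Suc n)"
  have "rw \<rho> x \<le> r ^ n" using J_le[OF x] r_power_less(2)[of n "Suc n"] by simp
  then obtain y where y: "y \<in> Jn n" "prefix y x" using J_prefix_exists[OF J_W[OF x]] by blast
  then have "\<exists>!y. y \<in> Jn n \<and> prefix y x" using J_prefix_unique by blast
  then show ?thesis unfolding par_def lev_eq[OF x] using theI'[of "\<lambda>y. y \<in> Jn n \<and> prefix y x"] by simp
qed

lemma par_eq: "x \<in> Jn (Suc n) \<Longrightarrow> y \<in> Jn n \<Longrightarrow> prefix y x \<Longrightarrow> par x = y"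
  using par_J J_prefix_unique by blast

lemma ch_iff: "x \<in> Jn n \<Longrightarrow> z \<in> ch x \<longleftrightarrow> z \<in> Jn (Suc n) \<and> par z = x"
  using par_J par_eq by (auto simp: ch_def ext_def lev_eq)

lemma hn_iff: "x \<in> Jn n \<Longrightarrow> y \<in> hn x \<longleftrightarrow> y \<in> Jn n \<and> y \<noteq> x \<and> gap S K x y \<le> \<gamma> * r ^ n"
  by (simp add: hn_def lev_eq)

lemma gap_sym: "gap S K x y = gap S K y x"
  unfolding gap_def by (rule arg_cong[of _ _ Inf]) (auto, (metis dist_commute)+)

lemma hn_sym: "x \<in> Jn n \<Longrightarrow> y \<in> hn x \<Longrightarrow> x \<in> hn y"
  using hn_iff[of x n] hn_iff[of y n] gap_sym by auto

lemma finite_ch: "finite (ch x)" using finite_J by (simp add: ch_def ext_def)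

lemma finite_hn: "finite (hn x)" using finite_J by (simp add: hn_def)

lemma sum_ch: "x \<in> Jn n \<Longrightarrow> (\<Sum>z\<in>ch x. ww z) = ww x"
  unfolding ww_def ch_def
  by (intro sum_powr_ext[OF hausdorff_dim_K(2)] J_W[of x n]) (use J_gt[of x n] lev_eq[of x n] in auto)

lemma sum_par: "(\<Sum>z\<in>Jn (Suc n). F z) = (\<Sum>x\<in>Jn n. \<Sum>z\<in>ch x. F z)"
proof -
  have "(\<Sum>x\<in>Jn n. \<Sum>z\<in>ch x. F z) = (\<Sum>x\<in>Jn n. \<Sum>z\<in>{z\<in>Jn (Suc n). par z = x}. F z)"
    by (intro sum.cong) (auto simp: ch_iff)
  also have "\<dots> = (\<Sum>z\<in>Jn (Suc n). F z)"
    by (rule sum.group[OF finite_J finite_J]) (use par_J in blast)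
  finally show ?thesis ..
qed

section \<open>Horizontal neighbours and Euclidean distance\<close>

lemma gap_le:
  assumes "\<xi> \<in> Kw x" "\<eta> \<in> Kw y" shows "gap S K x y \<le> dist \<xi> \<eta>"
  unfolding gap_def
proof (rule cInf_lower)
  obtain u v where "\<xi> = Sw S x u" "u \<in> K" "\<eta> = Sw S y v" "v \<in> K" using assms by (elim imageE)
  then show "dist \<xi> \<eta> \<in> {dist (Sw S x \<xi>) (Sw S y \<eta>) | \<xi> \<eta>. \<xi> \<in> K \<and> \<eta> \<in> K}"
    by blast
qed (auto intro!: bdd_belowI[of _ 0])

lemma hn_close:
  assumes "x \<in> Jn n" "y \<in> hn x"
  shows "\<exists>\<xi>\<in>Kw x. \<exists>\<eta>\<in>Kw y. dist \<xi> \<eta> < 2 * \<gamma> * r ^ n"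
proof -
  let ?A = "{dist (Sw S x \<xi>) (Sw S y \<eta>) | \<xi> \<eta>. \<xi> \<in> K \<and> \<eta> \<in> K}"
  have "?A \<noteq> {}" using K_ne by auto
  moreover have "Inf ?A < 2 * \<gamma> * r ^ n"
  proof -
    have "Inf ?A \<le> \<gamma> * r ^ n" using hn_iff[OF assms(1)] assms(2) by (simp add: gap_def)
    also have "\<dots> < 2 * \<gamma> * r ^ n" using gamma_pos r01 by simp
    finally show ?thesis .
  qed
  ultimately have "\<exists>t\<in>?A. t < 2 * \<gamma> * r ^ n" by (rule cInf_lessD)
  then show ?thesis by auto
qed

lemma p0: "(SOME p. p \<in> K) \<in> K" using K_ne by (simp add: some_in_eq)

lemma pt_Kw: "pt y \<in> Kw y" using p0 by (auto simp: pt_def)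

lemma pt_dist: "y \<in> Jn n \<Longrightarrow> \<xi> \<in> Kw y \<Longrightarrow> dist (pt y) \<xi> \<le> dK * r ^ n"
  using Kw_dist_J[OF _ pt_Kw] by (simp add: mult.commute)

lemma par_pt_dist:
  assumes "x \<in> Jn (Suc n)" shows "dist (pt (par x)) (pt x) \<le> dK * r ^ n"
  using pt_dist[of "par x" n "pt x"] par_J[OF assms] Kw_prefix[OF J_W[OF assms], of "par x"] pt_Kw[of x]
  by (simp add: subsetD)

text \<open>Bounds the distance between base points of horizontal neighbours in units of
  \<open>r ^ n\<close>: two cell diameters and a gap below \<open>2 * \<gamma> * r ^ n\<close>. The
  factor 2 avoids having to attain the infimum in \<open>gap\<close>.\<close>

definition "C1 = 2 * \<gamma> + 2 * dK"

lemma C1: "C1 > 0" "dK \<le> C1" using gamma_pos dK_ge by (auto simp: C1_def)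

lemma hn_pt_dist:
  assumes "x \<in> Jn n" "y \<in> hn x" shows "dist (pt y) (pt x) \<le> C1 * r ^ n"
proof -
  obtain \<xi> \<eta> where e: "\<xi> \<in> Kw x" "\<eta> \<in> Kw y" "dist \<xi> \<eta> < 2 * \<gamma> * r ^ n" using hn_close[OF assms] by blast
  have y: "y \<in> Jn n" using assms hn_iff by blast
  have "dist (pt y) (pt x) \<le> dist (pt y) \<eta> + dist \<xi> \<eta> + dist (pt x) \<xi>"
    using dist_triangle[of "pt y" "pt x" \<eta>] dist_triangle[of \<eta> "pt x" \<xi>] by (simp add: dist_commute)
  then show ?thesis using e pt_dist[OF y e(2)] pt_dist[OF assms(1) e(1)] by (simp add: C1_def algebra_simps)
qed

text \<open>Horizontal degrees are bounded by the packing count around the base point. The drift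
  estimates and the Harnack constant rest on this.\<close>

lemma hn_card_ex: "\<exists>M>0. \<forall>n x. x \<in> Jn n \<longrightarrow> real (card (hn x)) \<le> M"
proof -
  obtain M where M: "M > 0 \<and> (\<forall>n p. real (card {y\<in>Jn n. \<exists>x\<in>Kw y. dist x p \<le> C1 * r ^ n}) \<le> M)"
    using J_count[of C1] by (elim exE)
  have "real (card (hn x)) \<le> M" if x: "x \<in> Jn n" for n x
  proof -
    let ?A = "{y\<in>Jn n. \<exists>z\<in>Kw y. dist z (pt x) \<le> C1 * r ^ n}"
    have "hn x \<subseteq> ?A"
    proof
      fix y assume y: "y \<in> hn x"
      then have "y \<in> Jn n" using hn_iff[OF x] by simp
      then show "y \<in> ?A" using pt_Kw[of y] hn_pt_dist[OF x y] by blast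
    qed
    then have "card (hn x) \<le> card ?A" using finite_J by (intro card_mono) simp_all
    moreover have "real (card ?A) \<le> M" by (rule M[THEN conjunct2, rule_format])
    ultimately show ?thesis by linarith
  qed
  then show ?thesis using M[THEN conjunct1] by (intro exI[of _ M] conjI allI impI)
qed

definition "Mh = (SOME M. M > 0 \<and> (\<forall>n x. x \<in> Jn n \<longrightarrow> real (card (hn x)) \<le> M))"

lemma Mh: "Mh > 0" "x \<in> Jn n \<Longrightarrow> real (card (hn x)) \<le> Mh"
proof -
  have "Mh > 0 \<and> (\<forall>n x. x \<in> Jn n \<longrightarrow> real (card (hn x)) \<le> Mh)"
    unfolding Mh_def by (rule someI_ex[OF hn_card_ex])
  then show "Mh > 0" "x \<in> Jn n \<Longrightarrow> real (card (hn x)) \<le> Mh" by auto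
qed

section \<open>Conductances\<close>

lemma lam_powr: "lam powr (- real n) = (1 / lam) ^ n"
  using lam_pos by (simp add: powr_minus powr_realpow divide_inverse power_inverse)

lemma r_powr: "r powr (\<alpha> * real n) = a ^ n"
  using r01 by (simp add: a_def powr_realpow[symmetric] powr_powr del: powr_realpow)

lemma c_down:
  assumes "x \<in> Jn n" "z \<in> ch x" shows "c x z = ww z * (1 / lam) ^ Suc n" "c z x = ww z * (1 / lam) ^ Suc n"
proof -
  have z: "z \<in> Jn (Suc n)" "par z = x" using ch_iff[OF assms(1)] assms(2) by auto
  then have pr: "prefix x z" using par_J by blast
  have 1: "\<exists>m. z \<in> Jn (Suc m) \<and> x \<in> Jn m \<and> prefix x z" using z assms(1) pr by blast
  have 2: "\<not> (\<exists>m. x \<in> Jn (Suc m) \<and> z \<in> Jn m \<and> prefix z x)"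
  proof
    assume "\<exists>m. x \<in> Jn (Suc m) \<and> z \<in> Jn m \<and> prefix z x"
    then obtain m where "x \<in> Jn (Suc m)" "z \<in> Jn m" by auto
    then show False using J_disj[OF assms(1)] J_disj[OF z(1)] by fastforce
  qed
  show "c x z = ww z * (1 / lam) ^ Suc n"
    unfolding cond_def Let_def if_not_P[OF 2] if_P[OF 1] lev_eq[OF z(1)] lam_powr ww_def ..
  show "c z x = ww z * (1 / lam) ^ Suc n"
    unfolding cond_def Let_def if_P[OF 1] lev_eq[OF z(1)] lam_powr ww_def ..
qed

lemma c_up: "x \<in> Jn (Suc n) \<Longrightarrow> c x (par x) = ww x * (1 / lam) ^ Suc n"
  using c_down(2)[of "par x" n x] par_J[of x n] ch_iff[of "par x" n x] by simp

lemma c_hor: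
  assumes "x \<in> Jn n" "y \<in> hn x" shows "c x y = a ^ n * (1 / lam) ^ n"
proof -
  have y: "y \<in> Jn n" "y \<noteq> x" "gap S K x y \<le> \<gamma> * r ^ n" using hn_iff[OF assms(1)] assms(2) by auto
  have 1: "\<not> (\<exists>m. x \<in> Jn (Suc m) \<and> y \<in> Jn m \<and> prefix y x)" "\<not> (\<exists>m. y \<in> Jn (Suc m) \<and> x \<in> Jn m \<and> prefix x y)"
    using J_disj[OF assms(1)] J_disj[OF y(1)] by (metis n_not_Suc_n)+
  have 2: "\<exists>m. x \<in> Jn m \<and> y \<in> Jn m \<and> x \<noteq> y \<and> gap S K x y \<le> \<gamma> * r ^ m"
    using assms(1) y by blast
  show ?thesis
    unfolding cond_def Let_def if_not_P[OF 1(1)] if_not_P[OF 1(2)] if_P[OF 2] lev_eq[OF assms(1)] lam_powr r_powr ..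
qed

lemma c_nonzero:
  assumes "c x y \<noteq> 0"
  shows "\<exists>n. x \<in> Jn n \<and> ((\<exists>m. n = Suc m \<and> y = par x) \<or> y \<in> ch x \<or> y \<in> hn x)"
proof -
  have "(\<exists>n. x \<in> Jn (Suc n) \<and> y \<in> Jn n \<and> prefix y x) \<or> (\<exists>n. y \<in> Jn (Suc n) \<and> x \<in> Jn n \<and> prefix x y)
     \<or> (\<exists>n. x \<in> Jn n \<and> y \<in> Jn n \<and> x \<noteq> y \<and> gap S K x y \<le> \<gamma> * r ^ n)"
    using assms unfolding cond_def Let_def by argo
  then consider n where "x \<in> Jn (Suc n)" "y \<in> Jn n" "prefix y x"
    | n where "y \<in> Jn (Suc n)" "x \<in> Jn n" "prefix x y"
    | n where "x \<in> Jn n" "y \<in> Jn n" "x \<noteq> y" "gap S K x y \<le> \<gamma> * r ^ n"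
    by (elim disjE exE conjE)
  then show ?thesis
  proof cases
    case 1
    then show ?thesis using par_eq by blast
  next
    case 2
    then have "y \<in> ch x" using par_eq[of y n x] ch_iff[of x n y] by simp
    then show ?thesis using 2 by blast
  next
    case 3
    then show ?thesis using hn_iff[of x n y] by blast
  qed
qed

lemma c_pos: 
  "x \<in> Jn (Suc n) \<Longrightarrow> c x (par x) > 0"
  "x \<in> Jn n \<Longrightarrow> z \<in> ch x \<Longrightarrow> c x z > 0"
  "x \<in> Jn n \<Longrightarrow> y \<in> hn x \<Longrightarrow> c x y > 0"
  using c_up c_down c_hor ww_pos lam_pos a01 ch_iff by (auto simp del: power_Suc)

lemma c_nonneg: "c x y \<ge> 0"
proof (cases "c x y = 0")
  case False
  then obtain n where "x \<in> Jn n" "(\<exists>m. n = Suc m \<and> y = par x) \<or> y \<in> ch x \<or> y \<in> hn x"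
    using c_nonzero by blast
  then show ?thesis using c_pos less_imp_le by metis
qed simp

lemma c_sym: "c x y = c y x"
proof -
  have *: "c x y = c y x" if nz: "c x y \<noteq> 0" for x y
  proof -
    obtain n where n: "x \<in> Jn n" "(\<exists>m. n = Suc m \<and> y = par x) \<or> y \<in> ch x \<or> y \<in> hn x"
      using c_nonzero[OF nz] by blast
    consider m where "n = Suc m" "y = par x" | "y \<in> ch x" | "y \<in> hn x" using n(2) by blast
    then show ?thesis
    proof cases
      case 1
      then have "y \<in> Jn m" "x \<in> ch y" using par_J[of x m] ch_iff[of y m x] n(1) by auto
      then show ?thesis using c_down by simp
    next
      case 2
      then show ?thesis using c_down n(1) by simp
    next
      case 3
      then show ?thesis using c_hor[OF n(1)] c_hor[of y n x] hn_sym[OF n(1)] hn_iff[OF n(1)] by simp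
    qed
  qed
  show ?thesis
  proof (cases "c x y = 0")
    case True
    then show ?thesis using *[of y x] by (cases "c y x = 0") auto
  qed (rule *)
qed

lemma nb_eq: "x \<in> Jn n \<Longrightarrow> nb x = (if n = 0 then {} else {par x}) \<union> ch x \<union> hn x"
proof -
  assume x: "x \<in> Jn n"
  show ?thesis
  proof (rule set_eqI)
    fix y
    have "c x y \<noteq> 0 \<longleftrightarrow> (\<exists>m. n = Suc m \<and> y = par x) \<or> y \<in> ch x \<or> y \<in> hn x"
    proof
      assume "c x y \<noteq> 0"
      then obtain n' where "x \<in> Jn n'" "(\<exists>m. n' = Suc m \<and> y = par x) \<or> y \<in> ch x \<or> y \<in> hn x"
        using c_nonzero by blast
      then show "(\<exists>m. n = Suc m \<and> y = par x) \<or> y \<in> ch x \<or> y \<in> hn x" using J_disj[OF x] by blast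
    next
      assume "(\<exists>m. n = Suc m \<and> y = par x) \<or> y \<in> ch x \<or> y \<in> hn x"
      then show "c x y \<noteq> 0" using c_pos x by (metis less_irrefl)
    qed
    then show "y \<in> nb x \<longleftrightarrow> y \<in> (if n = 0 then {} else {par x}) \<union> ch x \<union> hn x"
      unfolding nbrs_def by (cases n) auto
  qed
qed

lemma nb_X: "x \<in> X \<Longrightarrow> y \<in> nb x \<Longrightarrow> y \<in> X"
proof -
  assume x: "x \<in> X" and y: "y \<in> nb x"
  have "c y x \<noteq> 0" using y c_sym by (simp add: nbrs_def)
  then show ?thesis using c_nonzero J_X by blast
qed

lemma nb_sym: "y \<in> nb x \<longleftrightarrow> x \<in> nb y" using c_sym by (simp add: nbrs_def)

lemma nb_empty: "x \<notin> X \<Longrightarrow> nb x = {}" using c_nonzero J_X by (fastforce simp: nbrs_def)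

lemma finite_nb: "finite (nb x)"
proof (cases "x \<in> X")
  case True
  then show ?thesis using nb_eq[OF X_J[OF True]] finite_ch finite_hn by simp
qed (simp add: nb_empty)

lemma sum_nb:
  fixes f :: "nat list \<Rightarrow> real"
  assumes x: "x \<in> Jn n"
  shows "(\<Sum>z\<in>nb x. c x z * f z) = (if n = 0 then 0 else ww x * (1 / lam) ^ n * f (par x))
     + (\<Sum>z\<in>ch x. ww z * (1 / lam) ^ Suc n * f z) + (\<Sum>y\<in>hn x. a ^ n * (1 / lam) ^ n * f y)"
proof -
  define Q where "Q = (if n = 0 then {} else {par x})"
  have ch: "z \<in> ch x \<Longrightarrow> z \<in> Jn (Suc n)" and hn: "z \<in> hn x \<Longrightarrow> z \<in> Jn n" for z
    using ch_iff[OF x] hn_iff[OF x] by auto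
  have P: "z \<in> Q \<Longrightarrow> \<exists>m. n = Suc m \<and> z \<in> Jn m" for z using par_J x unfolding Q_def by (cases n) auto
  have finQ: "finite Q" by (simp add: Q_def)
  have d1: "Q \<inter> ch x = {}"
  proof (rule ccontr)
    assume "Q \<inter> ch x \<noteq> {}"
    then obtain z where z: "z \<in> Q" "z \<in> ch x" by blast
    obtain m where "n = Suc m" "z \<in> Jn m" using P[OF z(1)] by (elim exE conjE)
    then show False using J_disj[OF _ ch[OF z(2)], of m] by simp
  qed
  have d2: "(Q \<union> ch x) \<inter> hn x = {}"
  proof (rule ccontr)
    assume "(Q \<union> ch x) \<inter> hn x \<noteq> {}"
    then obtain z where z: "z \<in> Q \<or> z \<in> ch x" "z \<in> hn x" by blast
    from z(1) have "(\<exists>m. n = Suc m \<and> z \<in> Jn m) \<or> z \<in> Jn (Suc n)" using P[of z] ch[of z] by argo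
    then show False using J_disj[OF hn[OF z(2)], of "n - 1"] J_disj[OF hn[OF z(2)], of "Suc n"] by force
  qed
  have "(\<Sum>z\<in>nb x. c x z * f z) = (\<Sum>z\<in>Q. c x z * f z) + (\<Sum>z\<in>ch x. c x z * f z) + (\<Sum>z\<in>hn x. c x z * f z)"
    unfolding nb_eq[OF x] Q_def[symmetric] using d1 d2 finite_ch finite_hn finQ
    by (subst sum.union_disjoint, simp_all)+
  moreover have "(\<Sum>z\<in>Q. c x z * f z) = (if n = 0 then 0 else ww x * (1 / lam) ^ n * f (par x))"
    using c_up x unfolding Q_def by (cases n) simp_all
  moreover have "(\<Sum>z\<in>ch x. c x z * f z) = (\<Sum>z\<in>ch x. ww z * (1 / lam) ^ Suc n * f z)"
    using c_down(1)[OF x] by (intro sum.cong) simp_all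
  moreover have "(\<Sum>z\<in>hn x. c x z * f z) = (\<Sum>z\<in>hn x. a ^ n * (1 / lam) ^ n * f z)"
    using c_hor[OF x] by (intro sum.cong) simp_all
  ultimately show ?thesis by (simp only:)
qed

section \<open>Laplacian and Doob transform\<close>

definition "Lap f x = (\<Sum>z\<in>nb x. c x z * (f z - f x))"

text \<open>\<open>Lop 1 (1 / lam)\<close> is the generator of the walk (up to the factor \<open>lam ^ (- n)\<close> on level \<open>n\<close>), and
  \<open>Lop (1 / lam) 1\<close> that of its Doob transform by \<open>lam ^ lv x\<close>, the walk reversed towards the root.\<close>

definition "Lop b1 b2 f x = (if lv x = 0 then 0 else b1 * ww x * (f (par x) - f x))
   + b2 * (\<Sum>z\<in>ch x. ww z * (f z - f x)) + a ^ lv x * (\<Sum>y\<in>hn x. f y - f x)" for b1 b2 :: real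

lemma Lap_Lop: "x \<in> Jn n \<Longrightarrow> Lap f x = (1 / lam) ^ n * Lop 1 (1 / lam) f x"
proof -
  assume x: "x \<in> Jn n"
  have "Lap f x = (if n = 0 then 0 else ww x * (1 / lam) ^ n * (f (par x) - f x))
     + (\<Sum>z\<in>ch x. ww z * (1 / lam) ^ Suc n * (f z - f x)) + (\<Sum>y\<in>hn x. a ^ n * (1 / lam) ^ n * (f y - f x))"
    unfolding Lap_def by (rule sum_nb[OF x])
  also have "\<dots> = (1 / lam) ^ n * Lop 1 (1 / lam) f x"
    unfolding Lop_def lev_eq[OF x] by (simp add: sum_distrib_left distrib_left mult.assoc mult.left_commute)
  finally show ?thesis .
qed

text \<open>Conjugating by \<open>lam ^ lv y\<close> multiplies the edge to the parent by
  \<open>1 / lam\<close> and those to the children by lam, which swaps the vertical coefficients.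
  The leftover multiples of h x from above and below cancel by \<open>sum_ch\<close>; at the root,
  which has no parent, one of them survives.\<close>

lemma Lap_conj:
  assumes x: "x \<in> Jn n"
  shows "Lap (\<lambda>y. lam ^ lv y * h y) x
     = Lop (1 / lam) 1 h x + (if n = 0 then (1 - 1 / lam) * ww x * h x else 0)"
proof -
  have chl: "z \<in> ch x \<Longrightarrow> lv z = Suc n" and hnl: "z \<in> hn x \<Longrightarrow> lv z = n" for z
    using ch_iff[OF x] hn_iff[OF x] lev_eq by auto
  have 1: "(\<Sum>z\<in>ch x. ww z * (1 / lam) ^ Suc n * (lam ^ lv z * h z - lam ^ n * h x)) =
      (\<Sum>z\<in>ch x. ww z * (h z - h x)) + (1 - 1 / lam) * ww x * h x"
  proof -
    have "(\<Sum>z\<in>ch x. ww z * (1 / lam) ^ Suc n * (lam ^ lv z * h z - lam ^ n * h x)) =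
       (\<Sum>z\<in>ch x. ww z * (h z - h x) + ww z * ((1 - 1 / lam) * h x))"
      using lam_pos chl by (intro sum.cong refl) (simp add: field_simps)
    also have "\<dots> = (\<Sum>z\<in>ch x. ww z * (h z - h x)) + (\<Sum>z\<in>ch x. ww z) * ((1 - 1 / lam) * h x)"
      by (simp add: sum.distrib sum_distrib_right)
    finally show ?thesis using sum_ch[OF x] by (simp add: mult.commute mult.left_commute)
  qed
  have 2: "(\<Sum>y\<in>hn x. a ^ n * (1 / lam) ^ n * (lam ^ lv y * h y - lam ^ n * h x)) = a ^ n * (\<Sum>y\<in>hn x. h y - h x)"
    unfolding sum_distrib_left using lam_pos hnl by (intro sum.cong refl) (simp add: field_simps)
  have 3: "ww x * (1 / lam) ^ n * (lam ^ lv (par x) * h (par x) - lam ^ n * h x)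
      = (1 / lam) * ww x * (h (par x) - h x) - (1 - 1 / lam) * ww x * h x" if "n \<noteq> 0"
  proof -
    obtain m where m: "n = Suc m" using \<open>n \<noteq> 0\<close> not0_implies_Suc by blast
    then have "lv (par x) = m" using par_J x lev_eq by blast
    then show ?thesis using m lam_pos by (simp add: field_simps)
  qed
  have "Lap (\<lambda>y. lam ^ lv y * h y) x =
     (if n = 0 then 0 else ww x * (1 / lam) ^ n * (lam ^ lv (par x) * h (par x) - lam ^ n * h x))
     + (\<Sum>z\<in>ch x. ww z * (1 / lam) ^ Suc n * (lam ^ lv z * h z - lam ^ n * h x))
     + (\<Sum>y\<in>hn x. a ^ n * (1 / lam) ^ n * (lam ^ lv y * h y - lam ^ n * h x))"
    unfolding Lap_def using sum_nb[OF x, of "\<lambda>z. lam ^ lv z * h z - lam ^ lv x * h x"] lev_eq[OF x] by simp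
  then show ?thesis unfolding 1 2 Lop_def lev_eq[OF x] using 3 by (cases "n = 0") simp_all
qed

lemma Nil_J: "[] \<in> Jn 0" by (simp add: J.simps)

lemma connected_to_root:
  assumes "\<And>x. x \<in> Jn 0 \<Longrightarrow> P x" "\<And>n x. x \<in> Jn (Suc n) \<Longrightarrow> P (par x) \<Longrightarrow> P x" "x \<in> X"
  shows "P x"
proof -
  have "x \<in> Jn n \<Longrightarrow> P x" for n x
  proof (induction n arbitrary: x)
    case (Suc n)
    then show ?case using assms(2) par_J by blast
  qed (rule assms(1))
  then show ?thesis using assms(3) X_J by blast
qed

end

section \<open>Green functions\<close>

context nrw
begin

section \<open>Transition probabilities and reversibility\<close>

definition "mm x = (\<Sum>z\<in>nb x. c x z)"
abbreviation "p x y \<equiv> trans_prob N S \<rho> K \<gamma> lam x y"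
abbreviation "PP n x y \<equiv> Pn N S \<rho> K \<gamma> lam n x y"
abbreviation "GG x y \<equiv> green N S \<rho> K \<gamma> lam x y"

lemma p_eq: "p x y = c x y / mm x" by (simp add: trans_prob_def mm_def)

lemma ch_ne: "x \<in> Jn n \<Longrightarrow> \<exists>z. z \<in> ch x"
  using sum_ch[of x n] ww_pos[of x n] by (metis ex_in_conv less_irrefl sum.empty)

lemma mm_pos: "x \<in> X \<Longrightarrow> mm x > 0"
proof -
  assume x: "x \<in> X"
  then obtain z where z: "z \<in> ch x" using ch_ne X_J by blast
  have "c x z \<le> mm x" unfolding mm_def
    using z nb_eq[OF X_J[OF x]] by (intro member_le_sum[OF _ c_nonneg finite_nb]) simp
  then show ?thesis using c_pos(2)[OF X_J[OF x] z] by linarith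
qed

lemma mm_p: "x \<in> X \<Longrightarrow> mm x * p x y = c x y"
  using mm_pos[of x] by (simp add: p_eq)

lemma p_nonneg: "p x y \<ge> 0"
  unfolding p_eq mm_def by (intro divide_nonneg_nonneg sum_nonneg c_nonneg)

lemma p_zero: "y \<notin> nb x \<Longrightarrow> p x y = 0" by (simp add: p_eq nbrs_def)

lemma p_pos: "x \<in> X \<Longrightarrow> y \<in> nb x \<Longrightarrow> p x y > 0"
  using p_nonneg[of x y] mm_pos[of x] by (auto simp: p_eq nbrs_def less_le)

lemma Lap_p: "x \<in> X \<Longrightarrow> Lap f x = mm x * ((\<Sum>z\<in>nb x. p x z * f z) - f x)"
  using mm_p[of x]
  by (simp add: Lap_def right_diff_distrib sum_subtractf sum_distrib_left mult.assoc[symmetric] mm_def sum_distrib_right)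

lemma PP_nonneg: "PP n x y \<ge> 0"
  by (induction n arbitrary: x) (auto intro!: sum_nonneg mult_nonneg_nonneg p_nonneg)

lemma PP_mult_le: "PP m x z * PP n z y \<le> PP (m + n) x y"
proof (induction m arbitrary: x)
  case 0
  then show ?case using PP_nonneg by simp
next
  case (Suc m)
  have "PP (Suc m) x z * PP n z y = (\<Sum>u\<in>nb x. p x u * (PP m u z * PP n z y))"
    by (simp add: sum_distrib_right mult.assoc)
  also have "\<dots> \<le> (\<Sum>u\<in>nb x. p x u * PP (m + n) u y)"
    using Suc p_nonneg by (intro sum_mono mult_left_mono)
  finally show ?case by simp
qed

lemma PP_Suc_right: "PP (Suc n) x y = (\<Sum>z\<in>nb y. PP n x z * p z y)"
proof (induction n arbitrary: x)
  case 0
  have "PP (Suc 0) x y = p x y"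
    using finite_nb p_zero by (auto simp: if_distrib[of "\<lambda>t. _ * t"] sum.delta cong: if_cong)
  moreover have "(\<Sum>z\<in>nb y. PP 0 x z * p z y) = p x y"
    using finite_nb p_zero[of y x] nb_sym[of x y]
    by (auto simp: if_distrib[of "\<lambda>t. t * _"] sum.delta cong: if_cong)
  ultimately show ?case by simp
next
  case (Suc n)
  have "PP (Suc (Suc n)) x y = (\<Sum>u\<in>nb x. p x u * (\<Sum>z\<in>nb y. PP n u z * p z y))"
    using Suc by (simp only: Pn.simps(2)[of _ _ _ _ _ _ "Suc n"])
  also have "\<dots> = (\<Sum>z\<in>nb y. \<Sum>u\<in>nb x. p x u * PP n u z * p z y)"
    by (simp add: sum_distrib_left mult.assoc sum.swap[of _ "nb y"])
  also have "\<dots> = (\<Sum>z\<in>nb y. PP (Suc n) x z * p z y)"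
    by (simp add: sum_distrib_right)
  finally show ?case .
qed

lemma PP_reversible: "x \<in> X \<Longrightarrow> y \<in> X \<Longrightarrow> mm x * PP n x y = mm y * PP n y x"
proof (induction n arbitrary: x)
  case 0
  then show ?case by auto
next
  case (Suc n)
  have "mm x * PP (Suc n) x y = (\<Sum>z\<in>nb x. (mm x * p x z) * PP n z y)"
    by (simp add: sum_distrib_left mult.assoc)
  also have "\<dots> = (\<Sum>z\<in>nb x. p z x * (mm z * PP n z y))"
  proof (intro sum.cong refl)
    fix z assume "z \<in> nb x"
    then have "z \<in> X" using nb_X Suc by blast
    then have "mm x * p x z = mm z * p z x" using mm_p Suc c_sym by metis
    then show "(mm x * p x z) * PP n z y = p z x * (mm z * PP n z y)" by simp
  qed
  also have "\<dots> = (\<Sum>z\<in>nb x. p z x * (mm y * PP n y z))"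
  proof (intro sum.cong refl)
    fix z assume "z \<in> nb x"
    then have "z \<in> X" using nb_X Suc by blast
    then show "p z x * (mm z * PP n z y) = p z x * (mm y * PP n y z)" using Suc by simp
  qed
  also have "\<dots> = mm y * PP (Suc n) y x"
    unfolding PP_Suc_right by (simp add: sum_distrib_left mult.assoc mult.left_commute mult.commute)
  finally show ?case .
qed

text \<open>The bound \<open>C * lam ^ lv x\<close> makes the set where \<psi> is at least
  \<open>\<psi> x0\<close> finite, so the maximum is attained, and harmonicity passes it to all
  neighbours.\<close>

lemma max_principle_decay:
  assumes nn: "\<And>x. x \<in> X \<Longrightarrow> 0 \<le> \<psi> x" and le: "\<And>x. x \<in> X \<Longrightarrow> \<psi> x \<le> C * lam ^ lv x"
    and harm: "\<And>x. x \<in> X \<Longrightarrow> Lap \<psi> x = 0" and x0: "x0 \<in> X"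
  shows "\<psi> x0 = 0"
proof (rule ccontr)
  assume "\<psi> x0 \<noteq> 0"
  then have pos: "\<psi> x0 > 0" using nn[OF x0] by simp
  have C: "C > 0" using le[OF x0] pos lam_pos by (smt (verit) mult_nonpos_nonneg zero_le_power)
  obtain n0 where n0: "lam ^ n0 < \<psi> x0 / C" using real_arch_pow_inv[of "\<psi> x0 / C" lam] pos C a01 lam_pos by auto
  define A where "A = {x\<in>X. \<psi> x \<ge> \<psi> x0}"
  have "A \<subseteq> (\<Union>n\<le>n0. Jn n)"
  proof
    fix x assume x: "x \<in> A"
    have "lv x \<le> n0"
    proof (rule ccontr)
      assume "\<not> lv x \<le> n0"
      then have "lam ^ lv x \<le> lam ^ n0" using lam_pos a01 by (intro power_decreasing) auto
      then have "C * lam ^ lv x \<le> C * lam ^ n0" using C by simp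
      also have "\<dots> < \<psi> x0" using n0 C by (simp add: field_simps)
      finally show False using le[of x] x by (auto simp: A_def)
    qed
    then show "x \<in> (\<Union>n\<le>n0. Jn n)" using X_J[of x] x by (auto simp: A_def)
  qed
  then have finA: "finite A" using finite_J finite_subset by blast
  have x0A: "x0 \<in> A" using x0 by (simp add: A_def)
  obtain x1 where x1: "x1 \<in> A" "\<And>x. x \<in> A \<Longrightarrow> \<psi> x \<le> \<psi> x1"
  proof -
    have "Max (\<psi> ` A) \<in> \<psi> ` A" using finA x0A by (intro Max_in) auto
    then obtain x1 where "x1 \<in> A" "\<psi> x1 = Max (\<psi> ` A)" by auto
    then show thesis using finA by (intro that[of x1]) simp_all
  qed
  have max: "\<psi> x \<le> \<psi> x1" if "x \<in> X" for x
    using x1 that by (cases "x \<in> A") (auto simp: A_def)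
  define B where "B = {x\<in>X. \<psi> x = \<psi> x1}"
  have finB: "finite B" using x1 by (intro finite_subset[OF _ finA]) (auto simp: A_def B_def)
  have x1B: "x1 \<in> B" using x1 by (simp add: A_def B_def)
  \<comment> \<open>A deepest point of maximum: its children share the maximum and lie deeper, a
    contradiction.\<close>
  obtain x2 where x2: "x2 \<in> B" "\<And>x. x \<in> B \<Longrightarrow> lv x \<le> lv x2"
  proof -
    have "Max (lv ` B) \<in> lv ` B" using finB x1B by (intro Max_in) auto
    then obtain x2 where "x2 \<in> B" "lv x2 = Max (lv ` B)" by auto
    then show thesis using finB by (intro that[of x2]) simp_all
  qed
  have x2X: "x2 \<in> X" using x2 by (simp add: B_def)
  obtain z where z: "z \<in> ch x2" using ch_ne X_J[OF x2X] by blast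
  have znb: "z \<in> nb x2" using nb_eq[OF X_J[OF x2X]] z by simp
  have zJ: "z \<in> Jn (Suc (lv x2))" using ch_iff[OF X_J[OF x2X]] z by simp
  have "(\<Sum>z\<in>nb x2. c x2 z * (\<psi> x2 - \<psi> z)) = 0"
    using harm[OF x2X] by (simp add: Lap_def right_diff_distrib sum_subtractf)
  moreover have "0 \<le> c x2 u * (\<psi> x2 - \<psi> u)" if "u \<in> nb x2" for u
    using max[OF nb_X[OF x2X that]] x2(1) c_nonneg by (simp add: B_def)
  ultimately have "c x2 z * (\<psi> x2 - \<psi> z) = 0"
    using sum_nonneg_eq_0_iff[OF finite_nb[of x2], of "\<lambda>z. c x2 z * (\<psi> x2 - \<psi> z)"] znb by simp
  then have "\<psi> z = \<psi> x2" using c_pos(2)[OF X_J[OF x2X] z] by simp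
  then have "z \<in> B" using x2(1) J_X[OF zJ] by (simp add: B_def)
  then show False using x2(2)[of z] lev_eq[OF zJ] by simp
qed

section \<open>The Green function with pole at the root\<close>

lemma ww_Nil: "ww [] = 1" by (simp add: ww_def)

lemma Nil_X: "[] \<in> X" using J_X[OF Nil_J] .

lemma mm_Nil: "mm [] = 1 / lam"
proof -
  have "hn [] = {}" using hn_iff[OF Nil_J] by (auto simp: J.simps)
  moreover have "mm [] = (\<Sum>z\<in>nb []. c [] z * 1)" by (simp add: mm_def)
  ultimately show ?thesis
    unfolding sum_nb[OF Nil_J] using sum_ch[OF Nil_J]
    by (simp add: ww_Nil sum_divide_distrib[symmetric])
qed

text \<open>The future Green function with pole at the root. All edges of the root lead to level 1,
  so there the transition operator multiplies \<open>lam ^ lv x\<close> by lam; dividing by 1 - lam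
  makes the defect exactly 1.\<close>

definition "\<phi>0 x = lam ^ lv x / (1 - lam)"

lemma opP_phi0: "x \<in> X \<Longrightarrow> (\<Sum>z\<in>nb x. p x z * \<phi>0 z) = \<phi>0 x - PP 0 x []"
proof -
  assume x: "x \<in> X"
  have l0: "lv x = 0 \<longleftrightarrow> x = []" using X_J[OF x] lev_eq[OF Nil_J] by (auto simp: J.simps)
  have k: "(1 - 1 / lam) * 1 * (1 / (1 - lam)) = - 1 / lam" using lam_pos a01 by (simp add: divide_simps)
  have "\<phi>0 = (\<lambda>y. lam ^ lv y * (1 / (1 - lam)))" by (auto simp: \<phi>0_def)
  then have "Lap \<phi>0 x = Lap (\<lambda>y. lam ^ lv y * (1 / (1 - lam))) x" by (rule arg_cong)
  also have "\<dots> = (if x = [] then (1 - 1 / lam) * ww x * (1 / (1 - lam)) else 0)"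
    unfolding Lap_conj[OF X_J[OF x]] l0 by (simp add: Lop_def)
  also have "\<dots> = (if x = [] then - 1 / lam else 0)"
    using k by (cases "x = []") (simp_all only: ww_Nil if_True if_False simp_thms)
  finally have L: "mm x * ((\<Sum>z\<in>nb x. p x z * \<phi>0 z) - \<phi>0 x) = (if x = [] then - 1 / lam else 0)"
    unfolding Lap_p[OF x] .
  show ?thesis
  proof (cases "x = []")
    case True
    then have "(1 / lam) * ((\<Sum>z\<in>nb x. p x z * \<phi>0 z) - \<phi>0 x) = (1 / lam) * (- 1)" using L by (simp add: mm_Nil)
    then show ?thesis using lam_pos True by (simp only: mult_cancel_left) simp
  next
    case False
    then show ?thesis using L mm_pos[OF x] by simp
  qed
qed

text \<open>The remainder \<open>q n\<close> is \<phi>0 after n steps of the walk, hence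
  nonnegative, which bounds the partial sums. Its limit is harmonic and dominated by a multiple of
  \<open>lam ^ lv x\<close>, so it vanishes by the maximum principle.\<close>

lemma green_root:
  assumes x: "x \<in> X" shows "summable (\<lambda>k. PP k x [])" "GG x [] = \<phi>0 x"
proof -
  define q where "q n x = \<phi>0 x - (\<Sum>k<n. PP k x [])" for n x
  have q_rec: "q (Suc n) x = (\<Sum>z\<in>nb x. p x z * q n z)" if x: "x \<in> X" for n x
  proof -
    have "(\<Sum>k<n. PP (Suc k) x []) = (\<Sum>z\<in>nb x. p x z * (\<Sum>k<n. PP k z []))"
      by (simp add: sum_distrib_left sum.swap[of _ "{..<n}"])
    then show ?thesis using opP_phi0[OF x]
      unfolding q_def sum.lessThan_Suc_shift by (simp add: right_diff_distrib sum_subtractf)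
  qed
  have q_nn: "q n x \<ge> 0" if "x \<in> X" for n x
    using that
  proof (induction n arbitrary: x)
    case 0
    then show ?case using lam_pos a01 by (simp add: q_def \<phi>0_def)
  next
    case (Suc n)
    then show ?case unfolding q_rec[OF Suc(2)] using nb_X by (intro sum_nonneg mult_nonneg_nonneg p_nonneg) blast
  qed
  have sm: "summable (\<lambda>k. PP k x [])" if "x \<in> X" for x
    by (rule bounded_imp_summable[of _ "\<phi>0 x"])
       (use PP_nonneg q_nn[OF that] in \<open>auto simp: q_def lessThan_Suc_atMost[symmetric] simp del: sum.lessThan_Suc\<close>)
  define \<psi> where "\<psi> x = \<phi>0 x - GG x []" for x
  have lim: "(\<lambda>n. q n x) \<longlonglongrightarrow> \<psi> x" if "x \<in> X" for x
    unfolding q_def \<psi>_def green_def using summable_LIMSEQ[OF sm[OF that]] by (intro tendsto_intros)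
  have "\<psi> x = 0"
  proof (rule max_principle_decay[OF _ _ _ x])
    fix x assume x: "x \<in> X"
    show "0 \<le> \<psi> x" using lim[OF x] q_nn[OF x] by (intro LIMSEQ_le_const[OF lim[OF x]]) auto
    have "GG x [] \<ge> 0" unfolding green_def using sm[OF x] PP_nonneg by (intro suminf_nonneg) auto
    then show "\<psi> x \<le> (1 / (1 - lam)) * lam ^ lv x" by (simp add: \<psi>_def \<phi>0_def)
    have "(\<lambda>n. q (Suc n) x) \<longlonglongrightarrow> (\<Sum>z\<in>nb x. p x z * \<psi> z)"
      unfolding q_rec[OF x] using lim nb_X[OF x] by (intro tendsto_intros) blast
    then have "(\<Sum>z\<in>nb x. p x z * \<psi> z) = \<psi> x"
      using LIMSEQ_Suc[OF lim[OF x]] LIMSEQ_unique by blast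
    then show "Lap \<psi> x = 0" by (simp add: Lap_p[OF x])
  qed
  then show "summable (\<lambda>k. PP k x [])" "GG x [] = \<phi>0 x" using sm[OF x] by (auto simp: \<psi>_def)
qed

section \<open>Green functions with general poles\<close>

lemma PP_to_root: "x \<in> Jn n \<Longrightarrow> PP n x [] > 0"
proof (induction n arbitrary: x)
  case 0
  then show ?case by (simp add: J.simps)
next
  case (Suc n)
  have xX: "x \<in> X" using J_X[OF Suc(2)] .
  have pn: "par x \<in> nb x" using nb_eq[OF Suc(2)] by simp
  have "0 < p x (par x) * PP n (par x) []"
    using p_pos[OF xX pn] Suc.IH par_J[OF Suc(2)] by simp
  also have "\<dots> \<le> (\<Sum>z\<in>nb x. p x z * PP n z [])"
    by (rule member_le_sum[OF pn _ finite_nb]) (auto intro: mult_nonneg_nonneg p_nonneg PP_nonneg)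
  finally show ?case by simp
qed

text \<open>A visit to y can be continued to the root in \<open>lv y\<close> further steps with
  fixed positive probability, so the series is dominated by a shifted series for the root.\<close>

lemma green_summable:
  assumes "x \<in> X" "y \<in> X" shows "summable (\<lambda>k. PP k x y)" and "GG x y * PP (lv y) y [] \<le> \<phi>0 x"
proof -
  let ?j = "lv y"
  have pos: "PP ?j y [] > 0" using PP_to_root[OF X_J[OF assms(2)]] .
  have le: "PP k x y * PP ?j y [] \<le> PP (k + ?j) x []" for k by (rule PP_mult_le)
  have sh: "summable (\<lambda>k. PP (k + ?j) x [])" using green_root(1)[OF assms(1)] by (subst summable_iff_shift)
  have sm: "summable (\<lambda>k. PP k x y * PP ?j y [])"
    by (rule summable_comparison_test'[OF sh, of 0]) (use le PP_nonneg pos in auto)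
  then show s: "summable (\<lambda>k. PP k x y)"
    using summable_mult2[OF sm, of "1 / PP ?j y []"] pos by simp
  have "GG x y * PP ?j y [] = (\<Sum>k. PP k x y * PP ?j y [])" unfolding green_def using suminf_mult2[OF s] by simp
  also have "\<dots> \<le> (\<Sum>k. PP (k + ?j) x [])" by (rule suminf_le[OF le sm sh])
  also have "\<dots> \<le> (\<Sum>k. PP k x [])"
    using suminf_split_initial_segment[OF green_root(1)[OF assms(1)], of ?j] PP_nonneg
    by (simp add: sum_nonneg)
  also have "\<dots> = \<phi>0 x" using green_root(2)[OF assms(1)] by (simp add: green_def)
  finally show "GG x y * PP ?j y [] \<le> \<phi>0 x" .
qed

lemma green_nonneg: "x \<in> X \<Longrightarrow> y \<in> X \<Longrightarrow> GG x y \<ge> 0"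
  unfolding green_def using green_summable(1) PP_nonneg by (intro suminf_nonneg) auto

lemma green_rec:
  assumes "x \<in> X" "y \<in> X" shows "GG x y = (if x = y then 1 else 0) + (\<Sum>z\<in>nb x. p x z * GG z y)"
proof -
  have "GG x y = PP 0 x y + (\<Sum>k. PP (Suc k) x y)"
    unfolding green_def using suminf_split_head[OF green_summable(1)[OF assms]] by simp
  also have "(\<Sum>k. PP (Suc k) x y) = (\<Sum>z\<in>nb x. \<Sum>k. p x z * PP k z y)"
    unfolding Pn.simps(2) using nb_X[OF assms(1)] green_summable(1) assms(2)
    by (intro suminf_sum summable_mult) auto
  also have "\<dots> = (\<Sum>z\<in>nb x. p x z * GG z y)"
    unfolding green_def using nb_X[OF assms(1)] green_summable(1) assms(2)
    by (intro sum.cong refl suminf_mult) auto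
  finally show ?thesis by simp
qed

lemma Lap_green: "x \<in> X \<Longrightarrow> y \<in> X \<Longrightarrow> Lap (\<lambda>x. GG x y) x = (if x = y then - mm x else 0)"
  using green_rec[of x y] Lap_p[of x "\<lambda>x. GG x y"] by (auto simp: algebra_simps)

lemma green_sym: "x \<in> X \<Longrightarrow> y \<in> X \<Longrightarrow> mm x * GG x y = mm y * GG y x"
proof -
  assume xy: "x \<in> X" "y \<in> X"
  have "mm x * GG x y = (\<Sum>k. mm x * PP k x y)"
    unfolding green_def using suminf_mult[OF green_summable(1)[OF xy]] by simp
  also have "\<dots> = (\<Sum>k. mm y * PP k y x)" using PP_reversible[OF xy] by simp
  also have "\<dots> = mm y * GG y x"
    unfolding green_def using suminf_mult[OF green_summable(1)[OF xy(2,1)]] by simp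
  finally show ?thesis .
qed

text \<open>By reversibility the ratio defining the Martin kernel equals
  \<open>kap x * hh x y\<close>. Division by \<open>lam ^ lv y\<close> is the Doob transform; it
  turns the decaying Green function into a bounded function of y that is harmonic for
  \<open>Lop (1 / lam) 1\<close> away from x and the root.\<close>

definition "hh x y = GG y x / lam ^ lv y"
definition "kap x = (1 - lam) / (lam * mm x)"

lemma kap_pos: "x \<in> X \<Longrightarrow> kap x > 0"
  using mm_pos[of x] lam_pos a01 by (simp add: kap_def)

lemma green_ratio:
  assumes "x \<in> X" "y \<in> X" shows "GG x y / GG [] y = kap x * hh x y"
proof -
  have 1: "GG x y = mm y * GG y x / mm x" using green_sym[OF assms] mm_pos[OF assms(1)] by (simp add: field_simps)
  have "mm [] * GG [] y = mm y * \<phi>0 y"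
    using green_sym[OF Nil_X assms(2)] green_root(2)[OF assms(2)] by simp
  then have 2: "GG [] y = lam * mm y * lam ^ lv y / (1 - lam)"
    using lam_pos by (simp add: mm_Nil \<phi>0_def field_simps)
  show ?thesis unfolding 1 2 kap_def hh_def
    using mm_pos[OF assms(1)] mm_pos[OF assms(2)] lam_pos a01 by (simp add: field_simps)
qed

lemma hh_nonneg: "x \<in> X \<Longrightarrow> y \<in> X \<Longrightarrow> 0 \<le> hh x y"
  unfolding hh_def using green_nonneg lam_pos by simp

lemma hh_bound: "x \<in> X \<Longrightarrow> \<exists>H>0. \<forall>y\<in>X. hh x y \<le> H"
proof -
  assume x: "x \<in> X"
  have pos: "PP (lv x) x [] > 0" using PP_to_root[OF X_J[OF x]] .
  have "hh x y \<le> 1 / ((1 - lam) * PP (lv x) x [])" if "y \<in> X" for y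
    using green_summable(2)[OF that x] pos lam_pos a01 by (simp add: hh_def \<phi>0_def field_simps)
  moreover have "1 / ((1 - lam) * PP (lv x) x []) > 0" using pos a01 by simp
  ultimately show ?thesis by blast
qed

lemma green_hh: "GG y x = lam ^ lv y * hh x y"
  using lam_pos by (simp add: hh_def)

lemma hh_harmonic:
  assumes "x \<in> X" "y \<in> Jn n" "0 < n" "y \<noteq> x"
  shows "Lop (1 / lam) 1 (hh x) y = 0"
  using Lap_green[OF J_X[OF assms(2)] assms(1)] Lap_conj[OF assms(2), of "hh x"] assms(3,4)
  by (simp add: green_hh)

end

section \<open>Oscillation decay and the Martin kernel\<close>

context nrw
begin

section \<open>Drift estimates and minimum principle\<close>

lemma Lop_lin: "Lop b1 b2 (\<lambda>y. f y + t * g y) x = Lop b1 b2 f x + t * Lop b1 b2 g x"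
proof -
  have 1: "(\<Sum>z\<in>ch x. ww z * (f z + t * g z - (f x + t * g x)))
      = (\<Sum>z\<in>ch x. ww z * (f z - f x)) + t * (\<Sum>z\<in>ch x. ww z * (g z - g x))"
    unfolding sum_distrib_left sum.distrib[symmetric] by (intro sum.cong refl) (simp add: algebra_simps)
  have 2: "(\<Sum>z\<in>hn x. f z + t * g z - (f x + t * g x)) = (\<Sum>z\<in>hn x. f z - f x) + t * (\<Sum>z\<in>hn x. g z - g x)"
    unfolding sum_distrib_left sum.distrib[symmetric] by (intro sum.cong refl) (simp add: algebra_simps)
  show ?thesis unfolding Lop_def 1 2 by (simp add: algebra_simps)
qed

lemma Lop_const: "Lop b1 b2 (\<lambda>y. k) x = 0" by (simp add: Lop_def)

lemma Lop_shift: "Lop b1 b2 (\<lambda>y. k + f y) x = Lop b1 b2 f x"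
  using Lop_lin[of b1 b2 "\<lambda>_. k" 1 f x] by (simp add: Lop_const)

lemma Lop_scale: "Lop b1 b2 (\<lambda>y. k * f y) x = k * Lop b1 b2 f x"
  using Lop_lin[of b1 b2 "\<lambda>_. 0" k f x] by (simp add: Lop_const)

lemma Lop_nonneg:
  assumes x: "x \<in> Jn n" and b: "b1 \<ge> 0" "b2 \<ge> 0" and f: "\<And>z. z \<in> nb x \<Longrightarrow> f x \<le> f z"
  shows "0 \<le> Lop b1 b2 f x"
proof -
  have ch: "f x \<le> f z" if "z \<in> ch x" for z using f[of z] nb_eq[OF x] that by simp
  have hn: "f x \<le> f z" if "z \<in> hn x" for z using f[of z] nb_eq[OF x] that by simp
  have par: "f x \<le> f (par x)" if "n \<noteq> 0" using f[of "par x"] nb_eq[OF x] that by simp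
  have wch: "ww z \<ge> 0" for z by (simp add: ww_def)
  show ?thesis unfolding Lop_def lev_eq[OF x] using b a01 ch hn par wch
    by (auto intro!: add_nonneg_nonneg mult_nonneg_nonneg sum_nonneg)
qed

text \<open>Drift of the distance function on level n in units of \<open>a ^ n * r ^ n\<close>: the
  step to the parent has size \<open>dK * r ^ (n - 1)\<close>, hence the division by r; the other
  terms are the children and at most \<open>Mh\<close> horizontal steps.\<close>

definition "CD b1 b2 = b1 * dK / r + b2 * dK + Mh * C1" for b1 b2 :: real

lemma Lop_dist:
  assumes y: "y \<in> Jn n" and b: "b1 \<ge> 0" "b2 \<ge> 0"
  shows "Lop b1 b2 (\<lambda>y. dist (pt y) q) y \<le> CD b1 b2 * (a ^ n * r ^ n)"
proof -
  have D: "dist (pt z) q - dist (pt y) q \<le> dist (pt z) (pt y)" for z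
    using dist_triangle[of "pt z" q "pt y"] by simp
  have w: "0 \<le> ww z" for z by (simp add: ww_def)
  have 1: "(if n = 0 then 0 else b1 * ww y * (dist (pt (par y)) q - dist (pt y) q)) \<le> b1 * dK / r * (a ^ n * r ^ n)"
  proof (cases n)
    case 0
    then show ?thesis using b dK_ge r01 a01 by simp
  next
    case (Suc m)
    have "ww y * (dist (pt (par y)) q - dist (pt y) q) \<le> ww y * (dK * r ^ m)"
      using order_trans[OF D par_pt_dist[of y m]] y Suc w by (intro mult_left_mono) auto
    also have "\<dots> \<le> a ^ n * (dK * r ^ m)" using ww_le[OF y] dK_ge r01 by (intro mult_right_mono) auto
    finally have "b1 * (ww y * (dist (pt (par y)) q - dist (pt y) q)) \<le> b1 * (a ^ n * (dK * r ^ m))"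
      using b by (intro mult_left_mono)
    then show ?thesis using Suc r01 by (simp add: field_simps)
  qed
  have 2: "(\<Sum>z\<in>ch y. ww z * (dist (pt z) q - dist (pt y) q)) \<le> dK * (a ^ n * r ^ n)"
  proof -
    have "(\<Sum>z\<in>ch y. ww z * (dist (pt z) q - dist (pt y) q)) \<le> (\<Sum>z\<in>ch y. ww z * (dK * r ^ n))"
    proof (intro sum_mono mult_left_mono w)
      fix z assume "z \<in> ch y"
      then have "z \<in> Jn (Suc n)" "par z = y" using ch_iff[OF y] by auto
      then show "dist (pt z) q - dist (pt y) q \<le> dK * r ^ n"
        using D[of z] par_pt_dist[of z n] by (simp add: dist_commute)
    qed
    also have "\<dots> = ww y * (dK * r ^ n)" using sum_ch[OF y] by (simp flip: sum_distrib_right)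
    also have "\<dots> \<le> a ^ n * (dK * r ^ n)" using ww_le[OF y] dK_ge r01 by (intro mult_right_mono) auto
    finally show ?thesis by (simp add: mult.left_commute)
  qed
  have 3: "(\<Sum>z\<in>hn y. dist (pt z) q - dist (pt y) q) \<le> Mh * (C1 * r ^ n)"
  proof -
    have "(\<Sum>z\<in>hn y. dist (pt z) q - dist (pt y) q) \<le> (\<Sum>z\<in>hn y. C1 * r ^ n)"
      using order_trans[OF D hn_pt_dist[OF y]] by (intro sum_mono)
    also have "\<dots> = real (card (hn y)) * (C1 * r ^ n)" by simp
    also have "\<dots> \<le> Mh * (C1 * r ^ n)" using Mh(2)[OF y] C1 r01 by (intro mult_right_mono) auto
    finally show ?thesis .
  qed
  have "Lop b1 b2 (\<lambda>y. dist (pt y) q) y \<le> b1 * dK / r * (a ^ n * r ^ n) + b2 * (dK * (a ^ n * r ^ n)) + a ^ n * (Mh * (C1 * r ^ n))"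
    unfolding Lop_def lev_eq[OF y] using b a01 1 2 3
    by (intro add_mono mult_left_mono) auto
  then show ?thesis by (simp add: CD_def algebra_simps)
qed

text \<open>Horizontal neighbours have the same level and contribute nothing, so the sign is
  explicit. For coefficients \<open>1 / lam\<close> and 1 it is that of (t - 1) (1 - 1 / (lam t)),
  negative for 1 < t < 1 / lam and positive for t = r; for 1 and \<open>1 / lam\<close> it is
  negative when lam < t < 1, and at the root for every t < 1.\<close>

lemma Lop_pow:
  assumes y: "y \<in> Jn n" and "t > 0"
  shows "Lop b1 b2 (\<lambda>y. t ^ lv y) y = ww y * t ^ n * ((if n = 0 then 0 else b1 * (1 / t - 1)) + b2 * (t - 1))"
proof -
  have "(\<Sum>z\<in>ch y. ww z * (t ^ lv z - t ^ n)) = (\<Sum>z\<in>ch y. ww z * (t ^ n * (t - 1)))"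
  proof (intro sum.cong refl)
    fix z assume "z \<in> ch y"
    then have "lv z = Suc n" using ch_iff[OF y] lev_eq by blast
    then show "ww z * (t ^ lv z - t ^ n) = ww z * (t ^ n * (t - 1))" by (simp add: algebra_simps)
  qed
  then have 1: "(\<Sum>z\<in>ch y. ww z * (t ^ lv z - t ^ n)) = ww y * (t ^ n * (t - 1))"
    using sum_ch[OF y] by (simp flip: sum_distrib_right)
  have 2: "(\<Sum>z\<in>hn y. t ^ lv z - t ^ n) = 0"
    using hn_iff[OF y] lev_eq by (intro sum.neutral) auto
  have 3: "t ^ lv (par y) - t ^ n = t ^ n * (1 / t - 1)" if n0: "n \<noteq> 0"
  proof -
    obtain m where m: "n = Suc m" using n0 by (cases n) auto
    then have "lv (par y) = m" using par_J[of y m] y lev_eq[of "par y" m] by simp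
    then show ?thesis using m \<open>t > 0\<close> by (simp add: field_simps)
  qed
  show ?thesis unfolding Lop_def lev_eq[OF y] 1 2 using 3 by (simp add: algebra_simps)
qed

text \<open>The growing supersolution \<open>t ^ lv y\<close> with \<open>1 < t < 1 / lam\<close> makes infinity harmless.\<close>

lemma Lop_min_principle:
  assumes U: "\<And>y. y \<in> U \<Longrightarrow> \<exists>n>0. y \<in> Jn n"
    and sup: "\<And>y. y \<in> U \<Longrightarrow> Lop (1 / lam) 1 v y \<le> 0"
    and bd: "\<And>y. y \<in> U \<Longrightarrow> - B \<le> v y"
    and bdry: "\<And>y z. y \<in> U \<Longrightarrow> z \<in> nb y \<Longrightarrow> z \<notin> U \<Longrightarrow> 0 \<le> v z"
    and y0: "y0 \<in> U"
  shows "0 \<le> v y0"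
proof (rule ccontr)
  assume "\<not> 0 \<le> v y0"
  then have neg: "v y0 < 0" by simp
  define t where "t = (1 + 1 / lam) / 2"
  have l1: "1 < 1 / lam" using lam_pos a01 by simp
  have t: "1 < t" "t < 1 / lam" using l1 by (auto simp: t_def)
  \<comment> \<open>With this e the perturbed value at \<open>y0\<close> is half the original one,
    hence still negative.\<close>
  define e where "e = - v y0 / (2 * t ^ lv y0)"
  have e: "e > 0" using neg t by (simp add: e_def divide_neg_pos)
  define v' where "v' y = v y + e * t ^ lv y" for y
  have ey0: "v' y0 < 0" using neg t by (simp add: v'_def e_def)
  define A where "A = {y\<in>U. v' y \<le> v' y0}"
  obtain n0 where n0: "B / e < t ^ n0" using real_arch_pow[OF t(1)] by blast
  have "A \<subseteq> (\<Union>n\<le>n0. Jn n)"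
  proof
    fix y assume y: "y \<in> A"
    then obtain n where n: "y \<in> Jn n" using U by (auto simp: A_def)
    have "n \<le> n0"
    proof (rule ccontr)
      assume "\<not> n \<le> n0"
      then have "t ^ n0 \<le> t ^ n" using t by (intro power_increasing) auto
      then have "B < e * t ^ n" using n0 e by (simp add: field_simps) (smt (verit) mult_left_mono)
      moreover have "v' y < 0" using y ey0 by (simp add: A_def)
      moreover have "- B \<le> v y" using bd y by (simp add: A_def)
      ultimately show False using lev_eq[OF n] by (simp add: v'_def)
    qed
    then show "y \<in> (\<Union>n\<le>n0. Jn n)" using n by blast
  qed
  then have finA: "finite A" using finite_J finite_subset by blast
  have y0A: "y0 \<in> A" using y0 by (simp add: A_def)
  obtain y where y: "y \<in> A" "\<And>z. z \<in> A \<Longrightarrow> v' y \<le> v' z"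
  proof -
    have "Min (v' ` A) \<in> v' ` A" using finA y0A by (intro Min_in) auto
    then obtain x1 where "x1 \<in> A" "v' x1 = Min (v' ` A)" by auto
    then show thesis using finA by (intro that[of x1]) simp_all
  qed
  have yU: "y \<in> U" and yneg: "v' y \<le> v' y0" using y by (auto simp: A_def)
  obtain n where n: "n > 0" "y \<in> Jn n" using U[OF yU] by blast
  have "0 \<le> Lop (1 / lam) 1 v' y"
  proof (rule Lop_nonneg[OF n(2)])
    fix z assume z: "z \<in> nb y"
    show "v' y \<le> v' z"
    proof (cases "z \<in> U")
      case True
      then show ?thesis using y(2)[of z] yneg by (cases "z \<in> A") (auto simp: A_def)
    next
      case False
      then have "0 \<le> v' z" using bdry[OF yU z] e t by (simp add: v'_def)
      then show ?thesis using yneg ey0 by simp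
    qed
  qed (use lam_pos in auto)
  moreover have "Lop (1 / lam) 1 v' y = Lop (1 / lam) 1 v y + e * Lop (1 / lam) 1 (\<lambda>y. t ^ lv y) y"
    unfolding v'_def by (rule Lop_lin)
  moreover have "Lop (1 / lam) 1 (\<lambda>y. t ^ lv y) y < 0"
  proof -
    have "lam * t < 1" using t(2) lam_pos by (simp add: field_simps)
    moreover have "(1 / lam) * (1 / t - 1) + (t - 1) = (t - 1) * (1 - 1 / (lam * t))"
      using t lam_pos by (simp add: field_simps)
    moreover have "1 < 1 / (lam * t)" using \<open>lam * t < 1\<close> t lam_pos by simp
    then have "(t - 1) * (1 - 1 / (lam * t)) < 0" using t by (intro mult_pos_neg) auto
    ultimately have "(1 / lam) * (1 / t - 1) + (t - 1) < 0" by simp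
    then show ?thesis using Lop_pow[OF n(2), of t "1 / lam" 1] n(1) ww_pos[OF n(2)] t
      by (simp add: mult_pos_neg)
  qed
  then have "e * Lop (1 / lam) 1 (\<lambda>y. t ^ lv y) y < 0" using e by (simp add: mult_pos_neg)
  ultimately show False using sup[OF yU] by linarith
qed

definition "hc = a / (1 / lam + 1 + Mh)"

lemma hc: "0 < hc" "hc \<le> 1"
proof -
  have "1 < 1 / lam + 1 + Mh" using lam_pos Mh by (simp add: add_pos_pos)
  then show "0 < hc" "hc \<le> 1" using a01 by (auto simp: hc_def field_simps)
qed

text \<open>In the mean value equation at y, the edge to the parent or to a horizontal neighbour has
  weight at least \<open>a ^ Suc n\<close>, while the total weight is at most
  \<open>a ^ n * (1 / lam + 1 + Mh)\<close>. The quotient is \<open>hc\<close>; all other terms are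
  nonnegative and are dropped.\<close>

lemma harnack:
  assumes y: "y \<in> Jn n" and harm: "Lop (1 / lam) 1 v y = 0" and n: "n > 0"
    and nn: "\<And>z. z \<in> nb y \<Longrightarrow> 0 \<le> v z" and y0: "0 \<le> v y" and z: "z = par y \<or> z \<in> hn y"
  shows "hc * v z \<le> v y"
proof -
  let ?D = "1 / lam + 1 + Mh"
  have w: "0 \<le> ww z" for z by (simp add: ww_def)
  have vch: "0 \<le> v z" if "z \<in> ch y" for z using nn[of z] nb_eq[OF y] that by simp
  have vhn: "0 \<le> v z" if "z \<in> hn y" for z using nn[of z] nb_eq[OF y] that by simp
  have vpar: "0 \<le> v (par y)" using nn[of "par y"] nb_eq[OF y] n by simp
  have D: "?D > 0" using lam_pos Mh by (simp add: add_pos_pos)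
  have eq: "v y * (ww y / lam + ww y + a ^ n * real (card (hn y)))
      = ww y / lam * v (par y) + (\<Sum>z\<in>ch y. ww z * v z) + a ^ n * (\<Sum>z\<in>hn y. v z)"
  proof -
    have s1: "(\<Sum>z\<in>ch y. ww z * (v z - v y)) = (\<Sum>z\<in>ch y. ww z * v z) - ww y * v y"
      using sum_ch[OF y] by (simp add: right_diff_distrib sum_subtractf flip: sum_distrib_right)
    have s2: "(\<Sum>z\<in>hn y. v z - v y) = (\<Sum>z\<in>hn y. v z) - card (hn y) * v y"
      by (simp add: sum_subtractf)
    show ?thesis using harm n unfolding Lop_def lev_eq[OF y] s1 s2 by (simp add: algebra_simps)
  qed
  have "v y * (ww y / lam + ww y + a ^ n * real (card (hn y))) \<le> v y * (a ^ n * ?D)"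
  proof (intro mult_left_mono y0)
    have "ww y / lam \<le> a ^ n / lam" using ww_le[OF y] lam_pos by (simp add: divide_right_mono)
    moreover have "a ^ n * real (card (hn y)) \<le> a ^ n * Mh" using Mh(2)[OF y] a01 by (intro mult_left_mono) auto
    ultimately show "ww y / lam + ww y + a ^ n * real (card (hn y)) \<le> a ^ n * ?D"
      using ww_le[OF y] by (simp add: algebra_simps)
  qed
  moreover have "a ^ n * (a * v z) \<le> ww y / lam * v (par y) + (\<Sum>z\<in>ch y. ww z * v z) + a ^ n * (\<Sum>z\<in>hn y. v z)"
    using z
  proof
    assume "z = par y"
    have "ww y \<le> ww y / lam" using lam_pos a01 w[of y] by (simp add: pos_le_divide_eq mult_left_le)
    then have "a ^ Suc n \<le> ww y / lam" using ww_ge[OF y] by linarith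
    from mult_right_mono[OF this vpar] have "a ^ Suc n * v z \<le> ww y / lam * v (par y)"
      unfolding \<open>z = par y\<close> .
    moreover have "0 \<le> (\<Sum>z\<in>ch y. ww z * v z)" "0 \<le> a ^ n * (\<Sum>z\<in>hn y. v z)"
      using vch vhn w a01 by (auto intro!: sum_nonneg mult_nonneg_nonneg)
    ultimately show ?thesis by (simp add: mult.assoc mult.left_commute)
  next
    assume zh: "z \<in> hn y"
    have "a * v z \<le> v z" using a01 vhn[OF zh] by (simp add: mult_left_le_one_le)
    also have "v z \<le> (\<Sum>z\<in>hn y. v z)" using zh vhn finite_hn by (intro member_le_sum) auto
    finally have "a ^ n * (a * v z) \<le> a ^ n * (\<Sum>z\<in>hn y. v z)" using a01 by (intro mult_left_mono) auto
    moreover have "0 \<le> (\<Sum>z\<in>ch y. ww z * v z)" "0 \<le> ww y / lam * v (par y)"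
      using vch vpar w lam_pos by (auto intro!: sum_nonneg mult_nonneg_nonneg divide_nonneg_pos)
    ultimately show ?thesis by linarith
  qed
  ultimately have "a ^ n * (a * v z) \<le> v y * (a ^ n * ?D)" using eq by linarith
  then have "a * v z \<le> v y * ?D" using a01 by (simp add: mult.left_commute)
  then show ?thesis using D by (simp add: hc_def field_simps)
qed

section \<open>Neighbourhoods of boundary points\<close>

lemma nb_dist:
  assumes y: "y \<in> Jn (Suc n)" and z: "z \<in> nb y"
  shows "\<exists>k\<ge>n. z \<in> Jn k \<and> dist (pt z) (pt y) \<le> C1 * r ^ n"
proof -
  have rn: "r ^ Suc n \<le> r ^ n" using r_power_less(2)[of n "Suc n"] by simp
  consider "z = par y" | "z \<in> ch y" | "z \<in> hn y" using z nb_eq[OF y] by auto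
  then show ?thesis
  proof cases
    case 1
    have "dK * r ^ n \<le> C1 * r ^ n" using C1 r01 by (intro mult_right_mono) auto
    then have "dist (pt z) (pt y) \<le> C1 * r ^ n" using par_pt_dist[OF y] 1 by simp
    then show ?thesis using par_J[OF y] 1 by blast
  next
    case 2
    then have z: "z \<in> Jn (Suc (Suc n))" "par z = y" using ch_iff[OF y] by auto
    have "dK * r ^ Suc n \<le> C1 * r ^ n" using C1 r01 rn dK_ge by (intro mult_mono) auto
    then have "dist (pt z) (pt y) \<le> C1 * r ^ n" using par_pt_dist[OF z(1)] z(2) by (simp add: dist_commute)
    then show ?thesis using z by (intro exI[of _ "Suc (Suc n)"]) simp
  next
    case 3
    have "C1 * r ^ Suc n \<le> C1 * r ^ n" using C1 rn by (intro mult_left_mono) auto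
    then have "dist (pt z) (pt y) \<le> C1 * r ^ n" using hn_pt_dist[OF y 3] by simp
    then show ?thesis using 3 hn_iff[OF y] by (intro exI[of _ "Suc n"]) simp
  qed
qed

text \<open>One edge from a vertex below level m moves the base point by at most
  \<open>C1 * r ^ m\<close>, so a step out of the ball of radius \<open>(dK + 1) * r ^ m\<close>
  stays within radius \<open>R0 * r ^ m\<close>.\<close>

definition "R0 = C1 + dK + 1"
definition "Om m q = {y. \<exists>n\<ge>m. y \<in> Jn n \<and> dist (pt y) q \<le> R0 * r ^ m}"
text \<open>Chosen so that the positive drift of \<open>Bc * r ^ lv y\<close> equals at least the
  bound \<open>CD (1 / lam) 1 * (a ^ n * r ^ n)\<close> for the drift of the distance; one factor a
  is lost because weights are only known to be at least \<open>a ^ Suc n\<close>.\<close>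

definition "Bc = CD (1 / lam) 1 / (a * ((1 - r) * (1 / (lam * r) - 1)))"
text \<open>Window radius, large enough that on the smaller neighbourhood, where the distance is at
  most \<open>R0 * r ^ (m + l0)\<close>, the barrier has used up at most half of its height.\<close>

definition "Rr = 2 * (R0 + Bc) + 1"

lemma R0: "R0 > 0" using C1 dK_ge by (simp add: R0_def add_pos_nonneg)

lemma kappa_pos: "0 < (1 - r) * (1 / (lam * r) - 1)"
proof -
  have "lam * r < 1" using lam_pos a01 r01 by (smt (verit) mult_less_cancel_left2)
  then have "1 < 1 / (lam * r)" using lam_pos r01 by simp
  then show ?thesis using r01 by simp
qed

lemma Bc: "Bc \<ge> 0"
proof -
  have "0 \<le> CD (1 / lam) 1" unfolding CD_def using lam_pos dK_ge r01 Mh(1) C1 by simp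
  then show ?thesis unfolding Bc_def by (rule divide_nonneg_pos[OF _ mult_pos_pos[OF a01(1) kappa_pos]])
qed

text \<open>\<open>r ^ lv y\<close> is a strict subsolution of the same order as the error of the
  distance, so subtracting a multiple of it yields a supersolution.\<close>

lemma Lop_barrier:
  assumes y: "y \<in> Jn n" and n: "n > 0"
  shows "Lop (1 / lam) 1 (\<lambda>y. dist (pt y) q + (- Bc) * r ^ lv y) y \<le> 0"
proof -
  let ?k = "(1 - r) * (1 / (lam * r) - 1)"
  have k: "(1 / lam) * (1 / r - 1) + (r - 1) = ?k" using r01 lam_pos by (simp add: field_simps)
  have "Lop (1 / lam) 1 (\<lambda>y. r ^ lv y) y = ww y * r ^ n * ?k"
    using Lop_pow[OF y r01(1), of "1 / lam" 1] n k by simp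
  moreover have "a ^ Suc n * (r ^ n * ?k) \<le> ww y * (r ^ n * ?k)"
    using ww_ge[OF y] kappa_pos r01 by (intro mult_right_mono) auto
  ultimately have "Bc * (a ^ Suc n * (r ^ n * ?k)) \<le> Bc * Lop (1 / lam) 1 (\<lambda>y. r ^ lv y) y"
    using Bc by (intro mult_left_mono) (auto simp: mult.assoc)
  moreover have "Bc * (a ^ Suc n * (r ^ n * ?k)) = CD (1 / lam) 1 * (a ^ n * r ^ n)"
  proof -
    have "s / t * t = s" if "t > 0" for s t :: real using that by simp
    from this[OF mult_pos_pos[OF a01(1) kappa_pos]] have "Bc * (a * ?k) = CD (1 / lam) 1"
      unfolding Bc_def .
    moreover have "Bc * (a ^ Suc n * (r ^ n * ?k)) = Bc * (a * ?k) * (a ^ n * r ^ n)"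
      by (simp only: power_Suc mult_ac)
    ultimately show ?thesis by simp
  qed
  moreover have "Lop (1 / lam) 1 (\<lambda>y. dist (pt y) q) y \<le> CD (1 / lam) 1 * (a ^ n * r ^ n)"
    using lam_pos by (intro Lop_dist[OF y]) auto
  ultimately have "Lop (1 / lam) 1 (\<lambda>y. dist (pt y) q) y \<le> Bc * Lop (1 / lam) 1 (\<lambda>y. r ^ lv y) y"
    by linarith
  then show ?thesis unfolding Lop_lin by simp
qed

text \<open>Levels to descend until the window of radius \<open>Rr * r ^ (m + l0)\<close> is below
  \<open>\<gamma> * r ^ Suc m\<close>, so that every cell of level m + 1 meeting it is
  \<open>ys\<close> or a horizontal neighbour of \<open>ys\<close>, and below \<open>r ^ m\<close>,
  so that the cells involved stay in \<open>Om m q\<close>.\<close>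

definition "l0 = (SOME l. l > 0 \<and> Rr * r ^ l \<le> \<gamma> * r \<and> Rr * r ^ l \<le> 1)"

lemma Rr: "Rr > 0" using R0 Bc by (simp add: Rr_def)

lemma l0: "l0 > 0" "Rr * r ^ l0 \<le> \<gamma> * r" "Rr * r ^ l0 \<le> 1"
proof -
  have "0 < min (\<gamma> * r) 1 / Rr" using gamma_pos r01 Rr by simp
  then obtain l where "r ^ l < min (\<gamma> * r) 1 / Rr" using real_arch_pow_inv[of _ r] r01 by blast
  moreover have "r ^ Suc l \<le> r ^ l" using r_power_less(2)[of l "Suc l"] by simp
  ultimately have "r ^ Suc l < min (\<gamma> * r) 1 / Rr" by linarith
  then have "Rr * r ^ Suc l < min (\<gamma> * r) 1" using Rr by (simp only: pos_less_divide_eq mult.commute)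
  then have "\<exists>l. l > 0 \<and> Rr * r ^ l \<le> \<gamma> * r \<and> Rr * r ^ l \<le> 1"
    by (intro exI[of _ "Suc l"]) (simp only: min_less_iff_conj less_imp_le zero_less_Suc simp_thms)
  then have "l0 > 0 \<and> Rr * r ^ l0 \<le> \<gamma> * r \<and> Rr * r ^ l0 \<le> 1" unfolding l0_def by (rule someI_ex)
  then show "l0 > 0" "Rr * r ^ l0 \<le> \<gamma> * r" "Rr * r ^ l0 \<le> 1" by auto
qed

lemma Om_nb:
  assumes y: "y \<in> Jn n" "m < n" and d: "dist (pt y) q \<le> (dK + 1) * r ^ m" and z: "z \<in> nb y"
  shows "z \<in> Om m q"
proof -
  obtain k where k: "n = Suc k" using y by (metis gr0_conv_Suc not_less0 not_gr_zero)
  then obtain j where j: "j \<ge> k" "z \<in> Jn j" "dist (pt z) (pt y) \<le> C1 * r ^ k" using nb_dist y z by blast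
  have "C1 * r ^ k \<le> C1 * r ^ m" using C1 r_power_less(2)[of m k] y k by (intro mult_left_mono) auto
  then have "dist (pt z) q \<le> R0 * r ^ m"
    using dist_triangle[of "pt z" q "pt y"] j d by (simp add: R0_def algebra_simps)
  moreover have "m \<le> j" using y k j by simp
  ultimately show ?thesis using j(2) by (auto simp: Om_def)
qed

text \<open>A Harnack chain from \<open>ys\<close> down to level \<open>m + l0\<close> gives a lower bound there; below that level the
  distance barrier propagates half of it into the smaller neighbourhood.\<close>

lemma Om_lower:
  assumes nn: "\<And>y. y \<in> Om m q \<Longrightarrow> 0 \<le> v y"
    and harm: "\<And>n y. y \<in> Jn n \<Longrightarrow> m < n \<Longrightarrow> Lop (1 / lam) 1 v y = 0"
    and ys: "ys \<in> Jn (Suc m)" "q \<in> Kw ys" and y: "y \<in> Om (Suc (m + l0)) q"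
  shows "hc ^ l0 * v ys / 2 \<le> v y"
proof -
  define \<delta> where "\<delta> = Rr * r ^ (m + l0)"
  have rm: "r ^ m > 0" using r01 by simp
  have rm1: "r ^ Suc m \<le> r ^ m" using r_power_less(2)[of m "Suc m"] by simp
  have d1: "\<delta> \<le> r ^ m" using l0(3) rm by (simp add: \<delta>_def power_add mult.assoc mult.left_commute)
  have d2: "\<delta> \<le> \<gamma> * r ^ Suc m"
    using mult_left_mono[OF l0(2), of "r ^ m"] rm by (simp add: \<delta>_def power_add mult.assoc mult.left_commute)
  have dp: "\<delta> > 0" using Rr r01 by (simp add: \<delta>_def)
  have near: "dist (pt z) q \<le> (dK + 1) * r ^ m" if "z \<in> Jn n" "m < n" "\<eta> \<in> Kw z" "dist \<eta> q \<le> \<delta>" for z n \<eta>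
  proof -
    have "dist (pt z) \<eta> \<le> dK * r ^ n" using pt_dist that by blast
    also have "\<dots> \<le> dK * r ^ m" using dK_ge r_power_less(2)[of m n] that by (intro mult_left_mono) auto
    finally show ?thesis using dist_triangle[of "pt z" q \<eta>] that(4) d1 by (simp add: algebra_simps)
  qed
  have R0ge: "(dK + 1) * r ^ m \<le> R0 * r ^ m" using C1 rm by (intro mult_right_mono) (auto simp: R0_def)
  have nearOm: "z \<in> Om m q" if "z \<in> Jn n" "m < n" "\<eta> \<in> Kw z" "dist \<eta> q \<le> \<delta>" for z n \<eta>
    using near[OF that] R0ge that(1,2) unfolding Om_def by (auto intro!: exI[of _ n])
  have ysOm: "ys \<in> Om m q" using nearOm[OF ys(1) _ ys(2)] dp by simp
  have vs: "0 \<le> v ys" using nn[OF ysOm] .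
  \<comment> \<open>One horizontal step on level m + 1, then one step per level from parent to
    child, each costing a factor \<open>hc\<close>. The exponent is therefore \<open>l0\<close> on
    level m + l0.\<close>
  have chain: "hc ^ Suc i * v ys \<le> v z"
    if "z \<in> Jn (Suc m + i)" "\<eta> \<in> Kw z" "dist \<eta> q \<le> \<delta>" for i z \<eta>
    using that
  proof (induction i arbitrary: z)
    case 0
    then have z: "z \<in> Jn (Suc m)" by simp
    show ?case
    proof (cases "z = ys")
      case True
      then show ?thesis using vs hc by (simp add: mult_left_le_one_le)
    next
      case False
      have "gap S K z ys \<le> \<gamma> * r ^ Suc m" using gap_le[OF 0(2) ys(2)] 0(3) d2 by linarith
      then have "ys \<in> hn z" using hn_iff[OF z] ys(1) False by auto
      moreover have "0 \<le> v u" if "u \<in> nb z" for u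
        using nn Om_nb[OF z _ near[OF z _ 0(2,3)] that] by simp
      moreover have "0 \<le> v z" using nn nearOm[OF z _ 0(2,3)] by simp
      ultimately show ?thesis using harnack[OF z harm[OF z]] by simp
    qed
  next
    case (Suc i)
    then have z: "z \<in> Jn (Suc (Suc m + i))" by simp
    have pz: "par z \<in> Jn (Suc m + i)" "prefix (par z) z" using par_J[OF z] by auto
    have \<eta>p: "\<eta> \<in> Kw (par z)" using Kw_prefix[OF J_W[OF z] pz(2)] Suc(3) by blast
    have 1: "hc ^ Suc i * v ys \<le> v (par z)" using Suc.IH[OF pz(1) \<eta>p Suc(4)] .
    have "0 \<le> v u" if "u \<in> nb z" for u
      using nn Om_nb[OF z _ near[OF z _ Suc(3,4)] that] by simp
    moreover have "0 \<le> v z" using nn nearOm[OF z _ Suc(3,4)] by simp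
    ultimately have "hc * v (par z) \<le> v z" using harnack[OF z harm[OF z]] by simp
    moreover have "hc * (hc ^ Suc i * v ys) \<le> hc * v (par z)" using 1 hc by (intro mult_left_mono) auto
    ultimately show ?case by (simp add: mult.assoc)
  qed
  obtain l' where l': "l0 = Suc l'" using l0(1) gr0_conv_Suc by blast
  define c1 where "c1 = hc ^ l0 * v ys"
  have c1: "c1 \<ge> 0" using vs hc by (simp add: c1_def)
  have V: "c1 \<le> v z" if "z \<in> Jn (m + l0)" "dist (pt z) q \<le> \<delta>" for z
    using chain[of z l' "pt z"] that pt_Kw l' by (simp add: c1_def)
  define U where "U = {y. \<exists>n>m + l0. y \<in> Jn n \<and> dist (pt y) q < \<delta>}"
  \<comment> \<open>The barrier is scaled to reach c1 at distance \<delta>, and the offset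
    \<open>Bc * r ^ (m + l0)\<close> keeps it above the distance term from level m + l0 on. Thus f
    is nonnegative on the sides of U by the barrier and on level m + l0 by the chain.\<close>
  define f where "f y = (- c1 + v y) + (c1 / \<delta>) * (Bc * r ^ (m + l0) + (dist (pt y) q + (- Bc) * r ^ lv y))" for y
  have fge: "v z - c1 + (c1 / \<delta>) * dist (pt z) q \<le> f z" if "z \<in> Jn k" "k \<ge> m + l0" for z k
  proof -
    have "Bc * r ^ k \<le> Bc * r ^ (m + l0)" using Bc r_power_less(2)[OF that(2)] by (intro mult_left_mono)
    then have "dist (pt z) q \<le> Bc * r ^ (m + l0) + (dist (pt z) q + (- Bc) * r ^ k)" by simp
    then have "(c1 / \<delta>) * dist (pt z) q \<le> (c1 / \<delta>) * (Bc * r ^ (m + l0) + (dist (pt z) q + (- Bc) * r ^ k))"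
      using c1 dp by (intro mult_left_mono) auto
    then show ?thesis unfolding f_def lev_eq[OF that(1)] by simp
  qed
  have UOm: "u \<in> Om m q" if "u \<in> U" for u
    using that nearOm[OF _ _ pt_Kw[of u]] l0(1) unfolding U_def by fastforce
  have f0: "0 \<le> f u" if "u \<in> U" for u
  proof (rule Lop_min_principle[where U = U and v = f and B = c1])
    show "u \<in> U" by fact
    show "\<exists>n>0. z \<in> Jn n" if z: "z \<in> U" for z
    proof -
      obtain n where "n > m + l0" "z \<in> Jn n" using z unfolding U_def by blast
      then show ?thesis by (intro exI[of _ n]) simp
    qed
    fix z assume z: "z \<in> U"
    then obtain n where n: "n > m + l0" "z \<in> Jn n" "dist (pt z) q < \<delta>" by (auto simp: U_def)
    have np: "n > 0" using n by simp
    have "Lop (1 / lam) 1 f z = Lop (1 / lam) 1 v z + (c1 / \<delta>) * Lop (1 / lam) 1 (\<lambda>y. dist (pt y) q + (- Bc) * r ^ lv y) z"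
      using Lop_lin[of "1 / lam" 1 "\<lambda>y. - c1 + v y" "c1 / \<delta>"
          "\<lambda>y. Bc * r ^ (m + l0) + (dist (pt y) q + (- Bc) * r ^ lv y)" z]
      unfolding f_def Lop_shift .
    moreover have "Lop (1 / lam) 1 v z = 0" using harm[OF n(2)] n(1) by simp
    moreover have "(c1 / \<delta>) * Lop (1 / lam) 1 (\<lambda>y. dist (pt y) q + (- Bc) * r ^ lv y) z \<le> 0"
      using c1 dp Lop_barrier[OF n(2) np] by (intro mult_nonneg_nonpos) auto
    ultimately show "Lop (1 / lam) 1 f z \<le> 0" by simp
    have "0 \<le> v z" using nn UOm z by blast
    moreover have "0 \<le> (c1 / \<delta>) * dist (pt z) q" using c1 dp by simp
    ultimately show "- c1 \<le> f z" using fge[OF n(2)] n(1) by simp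
    fix t assume t: "t \<in> nb z" "t \<notin> U"
    have "dist (pt z) q \<le> (dK + 1) * r ^ m"
      using near[OF n(2) _ pt_Kw[of z]] n by simp
    then have "t \<in> Om m q" using Om_nb[OF n(2) _ _ t(1)] n(1) by simp
    then have vt: "0 \<le> v t" by (rule nn)
    obtain n' where n': "n = Suc n'" using np gr0_conv_Suc by blast
    then obtain k where k: "k \<ge> n'" "t \<in> Jn k" using nb_dist t n(2) by blast
    then have km: "k \<ge> m + l0" using n(1) n' by simp
    show "0 \<le> f t"
    proof (cases "dist (pt t) q \<ge> \<delta>")
      case True
      then have "c1 \<le> (c1 / \<delta>) * dist (pt t) q"
        using c1 dp mult_left_mono[OF True, of "c1 / \<delta>"] by simp
      then show ?thesis using fge[OF k(2) km] vt by linarith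
    next
      case False
      then have "\<not> k > m + l0" using t(2) k unfolding U_def by auto
      then have "k = m + l0" using km by simp
      then have "c1 \<le> v t" using V k False by simp
      moreover have "0 \<le> (c1 / \<delta>) * dist (pt t) q" using c1 dp by simp
      ultimately show ?thesis using fge[OF k(2) km] by linarith
    qed
  qed
  obtain n where n: "n \<ge> Suc (m + l0)" "y \<in> Jn n" "dist (pt y) q \<le> R0 * r ^ Suc (m + l0)"
    using y by (auto simp: Om_def)
  have "R0 * r ^ Suc (m + l0) \<le> R0 * r ^ (m + l0)" using R0 r_power_less(2)[of "m + l0" "Suc (m + l0)"] by (intro mult_left_mono) auto
  then have dR0: "dist (pt y) q \<le> R0 * r ^ (m + l0)" using n by simp
  moreover have "R0 < Rr" using R0 Bc by (simp add: Rr_def)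
  then have "R0 * r ^ (m + l0) < \<delta>" using r01 by (simp add: \<delta>_def)
  ultimately have "dist (pt y) q < \<delta>" by linarith
  then have "y \<in> U" using n(1,2) unfolding U_def by (auto intro!: exI[of _ n])
  then have fy: "0 \<le> f y" by (rule f0)
  have "Bc * r ^ (m + l0) + (dist (pt y) q + (- Bc) * r ^ lv y) \<le> (R0 + Bc) * r ^ (m + l0)"
    using dR0 mult_nonneg_nonneg[OF Bc, of "r ^ lv y"] r01 by (simp add: algebra_simps)
  also have "\<dots> \<le> \<delta> / 2" using r01 by (simp add: Rr_def \<delta>_def)
  finally have "(c1 / \<delta>) * (Bc * r ^ (m + l0) + (dist (pt y) q + (- Bc) * r ^ lv y)) \<le> (c1 / \<delta>) * (\<delta> / 2)"
    using c1 dp by (intro mult_left_mono) auto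
  also have "\<dots> = c1 / 2" using dp by simp
  finally have "c1 / 2 \<le> v y" using fy unfolding f_def by linarith
  then show ?thesis by (simp only: c1_def)
qed

section \<open>Rays and contraction of oscillation\<close>

lemma geo_ray_ex: "\<xi> \<in> K \<Longrightarrow> \<exists>ys. geo_ray N S \<rho> K \<xi> ys"
proof -
  assume \<xi>: "\<xi> \<in> K"
  have "\<exists>ys. \<forall>n. (ys n \<in> Jn n \<and> \<xi> \<in> Kw (ys n)) \<and> prefix (ys n) (ys (Suc n))"
  proof (rule dependent_nat_choice)
    show "\<exists>x. x \<in> Jn 0 \<and> \<xi> \<in> Kw x" using \<xi> Nil_J by (intro exI[of _ "[]"]) simp
    fix x n assume x: "x \<in> Jn n \<and> \<xi> \<in> Kw x"
    then have "\<exists>z\<in>ext (Suc n) x. \<xi> \<in> Kw z"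
      using Kw_ext[of x "Suc n" \<xi>] J_W[of x n] J_cut[of x n "Suc n"] by simp
    then show "\<exists>y. (y \<in> Jn (Suc n) \<and> \<xi> \<in> Kw y) \<and> prefix x y" by (auto simp: ext_def)
  qed
  then obtain ys where "\<forall>n. (ys n \<in> Jn n \<and> \<xi> \<in> Kw (ys n)) \<and> prefix (ys n) (ys (Suc n))" ..
  then show ?thesis unfolding geo_ray_def by (intro exI[of _ ys]) simp
qed

lemma in_Om: "y \<in> Jn k \<Longrightarrow> n \<le> k \<Longrightarrow> \<xi> \<in> Kw y \<Longrightarrow> dist \<xi> q \<le> r ^ n \<Longrightarrow> y \<in> Om n q"
proof -
  assume y: "y \<in> Jn k" "n \<le> k" "\<xi> \<in> Kw y" "dist \<xi> q \<le> r ^ n"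
  have "dK * r ^ k \<le> dK * r ^ n" using dK_ge r_power_less(2)[OF y(2)] by (intro mult_left_mono)
  then have "dist (pt y) q \<le> dK * r ^ n + r ^ n"
    using pt_dist[OF y(1,3)] dist_triangle[of "pt y" q \<xi>] y(4) by linarith
  also have "\<dots> \<le> R0 * r ^ n" using C1 r01 by (simp add: R0_def algebra_simps)
  finally show ?thesis using y by (auto simp: Om_def)
qed

lemma Om_X: "y \<in> Om m q \<Longrightarrow> y \<in> X" using J_X by (auto simp: Om_def)

text \<open>One factor 1/2 comes from \<open>ys\<close> lying in the upper or lower half of the
  range, the other from the barrier in \<open>Om_lower\<close>.\<close>

definition "eps = hc ^ l0 / 4"

lemma eps: "0 < eps" "eps < 1"
proof -
  have "hc ^ l0 \<le> 1" using hc by (intro power_le_one) auto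
  then show "0 < eps" "eps < 1" using hc by (auto simp: eps_def)
qed

text \<open>At \<open>ys\<close> either h - A or A + D - h is at least D / 2.
  \<open>Om_lower\<close> applied to that function lifts the lower or lowers the upper end of the
  range by \<open>eps * D\<close>.\<close>

lemma osc_step:
  assumes h: "\<And>y. y \<in> Om m q \<Longrightarrow> A \<le> h y \<and> h y \<le> A + D"
    and harm: "\<And>n y. y \<in> Jn n \<Longrightarrow> m < n \<Longrightarrow> Lop (1 / lam) 1 h y = 0" and q: "q \<in> K" and D: "D \<ge> 0"
  shows "\<exists>A'. \<forall>y\<in>Om (Suc (m + l0)) q. A' \<le> h y \<and> h y \<le> A' + (1 - eps) * D"
proof -
  obtain ys where ys: "ys \<in> Jn (Suc m)" "q \<in> Kw ys" using K_cover[of "Suc m"] q by blast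
  have sub: "y \<in> Om m q" if yO: "y \<in> Om (Suc (m + l0)) q" for y
  proof -
    obtain n where n: "n \<ge> Suc (m + l0)" "y \<in> Jn n" "dist (pt y) q \<le> R0 * r ^ Suc (m + l0)"
      using yO by (auto simp: Om_def)
    have "R0 * r ^ Suc (m + l0) \<le> R0 * r ^ m" using R0 r_power_less(2)[of m "Suc (m + l0)"] by (intro mult_left_mono) auto
    then have "dist (pt y) q \<le> R0 * r ^ m" using n by simp
    then show ?thesis using n unfolding Om_def by (auto intro!: exI[of _ n])
  qed
  have half: "eps * D \<le> hc ^ l0 * t / 2" if "D / 2 \<le> t" for t
  proof -
    have "hc ^ l0 * (D / 2) \<le> hc ^ l0 * t" using that hc by (intro mult_left_mono) auto
    then show ?thesis by (simp add: eps_def mult.commute)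
  qed
  show ?thesis
  proof (cases "D / 2 \<le> h ys - A")
    case True
    have "A + eps * D \<le> h y" if y: "y \<in> Om (Suc (m + l0)) q" for y
    proof -
      have "hc ^ l0 * (- A + h ys) / 2 \<le> - A + h y"
      proof (rule Om_lower[of m q "\<lambda>y. - A + h y", OF _ _ ys y])
        show "0 \<le> - A + h z" if "z \<in> Om m q" for z using h[OF that] by simp
        show "Lop (1 / lam) 1 (\<lambda>y. - A + h y) z = 0" if "z \<in> Jn n" "m < n" for n z
          unfolding Lop_shift by (rule harm[OF that])
      qed
      then show ?thesis using half[OF True] by simp
    qed
    then show ?thesis using h sub by (intro exI[of _ "A + eps * D"]) (fastforce simp: algebra_simps)
  next
    case False
    then have F: "D / 2 \<le> A + D - h ys" by simp
    have "h y \<le> A + D - eps * D" if y: "y \<in> Om (Suc (m + l0)) q" for y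
    proof -
      have "hc ^ l0 * ((A + D) + (- 1) * h ys) / 2 \<le> (A + D) + (- 1) * h y"
      proof (rule Om_lower[of m q "\<lambda>y. (A + D) + (- 1) * h y", OF _ _ ys y])
        show "0 \<le> (A + D) + (- 1) * h z" if "z \<in> Om m q" for z using h[OF that] by simp
        show "Lop (1 / lam) 1 (\<lambda>y. (A + D) + (- 1) * h y) z = 0" if "z \<in> Jn n" "m < n" for n z
          unfolding Lop_shift Lop_scale harm[OF that] by simp
      qed
      then show ?thesis using half[OF F] by simp
    qed
    then show ?thesis using h sub by (intro exI[of _ A]) (auto simp: algebra_simps)
  qed
qed

lemma osc_iter:
  assumes h: "\<And>y. y \<in> X \<Longrightarrow> 0 \<le> h y \<and> h y \<le> H"
    and harm: "\<And>n y. y \<in> Jn n \<Longrightarrow> m < n \<Longrightarrow> Lop (1 / lam) 1 h y = 0" and q: "q \<in> K" and H: "H \<ge> 0"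
  shows "\<exists>A. \<forall>y\<in>Om (m + j * Suc l0) q. A \<le> h y \<and> h y \<le> A + (1 - eps) ^ j * H"
proof (induction j)
  case 0
  then show ?case using h Om_X by (intro exI[of _ 0]) auto
next
  case (Suc j)
  then obtain A where A: "\<forall>y\<in>Om (m + j * Suc l0) q. A \<le> h y \<and> h y \<le> A + (1 - eps) ^ j * H" ..
  have "\<exists>A'. \<forall>y\<in>Om (Suc (m + j * Suc l0 + l0)) q. A' \<le> h y \<and> h y \<le> A' + (1 - eps) * ((1 - eps) ^ j * H)"
    by (rule osc_step[where A = A]) (use A harm q H eps in auto)
  then show ?case by (simp add: algebra_simps)
qed

lemma hh_osc:
  assumes x: "x \<in> X" and e: "e > 0"
  shows "\<exists>n. \<forall>q\<in>K. \<forall>y\<in>Om n q. \<forall>y'\<in>Om n q. \<bar>hh x y - hh x y'\<bar> \<le> e"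
proof -
  obtain H where H: "H > 0" "\<forall>y\<in>X. hh x y \<le> H" using hh_bound[OF x] by blast
  obtain j where j: "(1 - eps) ^ j < e / H" using real_arch_pow_inv[of "e / H" "1 - eps"] e H eps by auto
  have jH: "(1 - eps) ^ j * H \<le> e" using j H by (simp add: field_simps)
  have harm: "Lop (1 / lam) 1 (hh x) y = 0" if y: "y \<in> Jn n" "lv x < n" for n y
  proof (rule hh_harmonic[OF x y(1)])
    show "0 < n" using y by simp
    show "y \<noteq> x" using y lev_eq[OF y(1)] by auto
  qed
  have "\<bar>hh x y - hh x y'\<bar> \<le> e" if q: "q \<in> K" and y: "y \<in> Om (lv x + j * Suc l0) q" "y' \<in> Om (lv x + j * Suc l0) q" for q y y'
  proof -
    have "\<exists>A. \<forall>y\<in>Om (lv x + j * Suc l0) q. A \<le> hh x y \<and> hh x y \<le> A + (1 - eps) ^ j * H"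
      by (rule osc_iter[OF _ harm q]) (use H hh_nonneg[OF x] in auto)
    then obtain A where "\<forall>y\<in>Om (lv x + j * Suc l0) q. A \<le> hh x y \<and> hh x y \<le> A + (1 - eps) ^ j * H" ..
    from this[rule_format, OF y(1)] this[rule_format, OF y(2)] show ?thesis using jH by linarith
  qed
  then show ?thesis by (intro exI[of _ "lv x + j * Suc l0"] ballI)
qed

section \<open>The Martin kernel\<close>

abbreviation "mt x \<xi> \<equiv> martin N S \<rho> K \<gamma> lam x \<xi>"

text \<open>Beyond existence of the limit this gives a rate uniform in \<xi>, over all vertices of
  \<open>Om n \<xi>\<close> instead of the chosen ray only. Continuity of the kernel and the passage
  from sums to integrals depend on that uniformity.\<close>

lemma martin_approx:
  assumes x: "x \<in> X" and e: "e > 0"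
  shows "\<exists>n. \<forall>\<xi>\<in>K. \<forall>y\<in>Om n \<xi>. \<bar>kap x * hh x y - mt x \<xi>\<bar> \<le> e"
proof -
  have kp: "kap x > 0" using kap_pos[OF x] .
  have scale: "\<bar>kap x * s - kap x * t\<bar> \<le> d" if "\<bar>s - t\<bar> \<le> d / kap x" for s t d
  proof -
    have "\<bar>kap x * s - kap x * t\<bar> = kap x * \<bar>s - t\<bar>" using kp by (simp add: abs_mult right_diff_distrib[symmetric])
    then show ?thesis using that kp by (simp add: field_simps)
  qed
  obtain n where n: "\<forall>q\<in>K. \<forall>y\<in>Om n q. \<forall>y'\<in>Om n q. \<bar>hh x y - hh x y'\<bar> \<le> e / kap x"
    using hh_osc[OF x, of "e / kap x"] e kp by auto
  have "\<bar>kap x * hh x y - mt x \<xi>\<bar> \<le> e" if \<xi>: "\<xi> \<in> K" and y: "y \<in> Om n \<xi>" for \<xi> y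
  proof -
    define ys where "ys = (SOME ys. geo_ray N S \<rho> K \<xi> ys)"
    have ray: "geo_ray N S \<rho> K \<xi> ys" unfolding ys_def using geo_ray_ex[OF \<xi>] by (rule someI_ex)
    then have ysJ: "ys k \<in> Jn k" "\<xi> \<in> Kw (ys k)" for k by (auto simp: geo_ray_def)
    have ysOm: "ys k \<in> Om m \<xi>" if "m \<le> k" for k m
      using in_Om[OF ysJ(1) that ysJ(2)] r01 by simp
    define s where "s k = kap x * hh x (ys k)" for k
    have s: "GG x (ys k) / GG [] (ys k) = s k" for k
      unfolding s_def by (rule green_ratio[OF x J_X[OF ysJ(1)]])
    have "Cauchy s"
    proof (rule metric_CauchyI)
      fix d :: real assume d: "d > 0"
      obtain m where m: "\<forall>q\<in>K. \<forall>y\<in>Om m q. \<forall>y'\<in>Om m q. \<bar>hh x y - hh x y'\<bar> \<le> d / 2 / kap x"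
        using hh_osc[OF x, of "d / 2 / kap x"] d kp by auto
      have "dist (s k) (s l) < d" if "k \<ge> m" "l \<ge> m" for k l
        using scale[of "hh x (ys k)" "hh x (ys l)" "d / 2"] m[rule_format, OF \<xi> ysOm[OF that(1)] ysOm[OF that(2)]] d
        unfolding s_def dist_real_def by linarith
      then show "\<exists>M. \<forall>m\<ge>M. \<forall>n\<ge>M. dist (s m) (s n) < d" by blast
    qed
    then have conv: "s \<longlonglongrightarrow> lim s" using Cauchy_convergent convergent_LIMSEQ_iff by blast
    have mt: "mt x \<xi> = lim s" unfolding martin_def Let_def ys_def[symmetric] s ..
    have "(\<lambda>k. \<bar>kap x * hh x y - s k\<bar>) \<longlonglongrightarrow> \<bar>kap x * hh x y - mt x \<xi>\<bar>"
      unfolding mt by (intro tendsto_intros conv)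
    moreover have "\<bar>kap x * hh x y - s k\<bar> \<le> e" if "k \<ge> n" for k
      unfolding s_def by (rule scale) (use n[rule_format, OF \<xi> y ysOm[OF that]] in auto)
    ultimately show ?thesis by (intro LIMSEQ_le_const2) auto
  qed
  then show ?thesis by (intro exI[of _ n] ballI)
qed

lemma martin_cont: "x \<in> X \<Longrightarrow> continuous_on K (mt x)"
proof -
  assume x: "x \<in> X"
  show ?thesis unfolding continuous_on_iff
  proof (intro ballI allI impI)
    fix \<xi> e assume \<xi>: "\<xi> \<in> K" and e: "(e::real) > 0"
    obtain n where n: "\<forall>\<xi>\<in>K. \<forall>y\<in>Om n \<xi>. \<bar>kap x * hh x y - mt x \<xi>\<bar> \<le> e / 3"
      using martin_approx[OF x, of "e / 3"] e by auto
    have "dist (mt x \<eta>) (mt x \<xi>) < e" if \<eta>: "\<eta> \<in> K" "dist \<eta> \<xi> < r ^ n" for \<eta>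
    proof -
      \<comment> \<open>A cell containing \<eta> belongs to the neighbourhoods of both points, so a
        single value of \<open>hh\<close> approximates both kernels.\<close>
      obtain y where y: "y \<in> Jn n" "\<eta> \<in> Kw y" using K_cover[of n] \<eta> by blast
      have 1: "y \<in> Om n \<eta>" using in_Om[OF y(1) order_refl y(2), of \<eta>] r01 by simp
      have 2: "y \<in> Om n \<xi>" using in_Om[OF y(1) order_refl y(2), of \<xi>] \<eta> by simp
      from n[rule_format, OF \<eta>(1) 1] n[rule_format, OF \<xi> 2] show ?thesis
        using e unfolding dist_real_def by linarith
    qed
    then show "\<exists>d>0. \<forall>x'\<in>K. dist x' \<xi> < d \<longrightarrow> dist (mt x x') (mt x \<xi>) < e"
      using r01 by (intro exI[of _ "r ^ n"]) auto
  qed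
qed

lemma measurable_extend_K:
  fixes f :: "'a \<Rightarrow> real"
  assumes "continuous_on K f" "\<And>x. x \<notin> K \<Longrightarrow> f x = k"
  shows "f \<in> borel_measurable borel"
proof -
  have [measurable]: "(\<lambda>x. indicator K x *\<^sub>R f x) \<in> borel_measurable borel"
    by (rule borel_measurable_continuous_on_indicator) (use assms in auto)
  have "f = (\<lambda>x. if x \<in> K then indicator K x *\<^sub>R f x else k)" using assms by (auto simp: indicator_def)
  also have "\<dots> \<in> borel_measurable borel" by measurable
  finally show ?thesis .
qed

text \<open>Off K there are no rays at all, so the choice operator returns one and the same default
  there and the kernel is constant off K.\<close>

lemma martin_measurable: "x \<in> X \<Longrightarrow> mt x \<in> borel_measurable borel"
proof -
  assume x: "x \<in> X"
  have "\<xi> \<in> K" if "geo_ray N S \<rho> K \<xi> ys" for \<xi> ys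
    using that[unfolded geo_ray_def, rule_format, of 0] by (auto simp: J.simps)
  then have "geo_ray N S \<rho> K \<xi> = (\<lambda>ys. False)" if "\<xi> \<notin> K" for \<xi> using that by blast
  then have "mt x \<xi> = (let ys = (SOME ys. False) in lim (\<lambda>n. GG x (ys n) / GG [] (ys n)))" if "\<xi> \<notin> K" for \<xi>
    unfolding martin_def using that by simp
  then show ?thesis using martin_cont[OF x] by (intro measurable_extend_K)
qed

lemma martin_nonneg: "x \<in> X \<Longrightarrow> \<xi> \<in> K \<Longrightarrow> 0 \<le> mt x \<xi>"
proof (rule ccontr)
  assume x: "x \<in> X" and \<xi>: "\<xi> \<in> K" and "\<not> 0 \<le> mt x \<xi>"
  define e where "e = - mt x \<xi> / 2"
  have "e > 0" using \<open>\<not> 0 \<le> mt x \<xi>\<close> by (simp add: e_def)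
  then obtain n where n: "\<forall>\<xi>\<in>K. \<forall>y\<in>Om n \<xi>. \<bar>kap x * hh x y - mt x \<xi>\<bar> \<le> e"
    using martin_approx[OF x] by blast
  obtain y where y: "y \<in> Jn n" "\<xi> \<in> Kw y" using K_cover[of n] \<xi> by blast
  have "y \<in> Om n \<xi>" using in_Om[OF y(1) order_refl y(2), of \<xi>] r01 by simp
  then have "\<bar>kap x * hh x y - mt x \<xi>\<bar> \<le> - mt x \<xi> / 2" using n \<xi> unfolding e_def by blast
  moreover have "0 \<le> kap x * hh x y" using kap_pos[OF x] hh_nonneg[OF x J_X[OF y(1)]] by simp
  ultimately show False using \<open>\<not> 0 \<le> mt x \<xi>\<close> by linarith
qed

lemma bounded_on_K: "continuous_on K f \<Longrightarrow> \<exists>B>0. \<forall>\<xi>\<in>K. \<bar>f \<xi> :: real\<bar> \<le> B"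
proof -
  assume "continuous_on K f"
  then have "bounded (f ` K)" using K_compact by (intro compact_imp_bounded compact_continuous_image)
  then obtain B where "B > 0" "\<forall>x\<in>f ` K. norm x \<le> B" unfolding bounded_pos by blast
  then show ?thesis by (intro exI[of _ B]) simp
qed

lemma integrable_K:
  assumes "f \<in> borel_measurable borel" "continuous_on K f" shows "integrable (nu K) (f :: 'a \<Rightarrow> real)"
proof -
  obtain B where "\<forall>\<xi>\<in>K. \<bar>f \<xi>\<bar> \<le> B" using bounded_on_K[OF assms(2)] by blast
  then have "AE x in nu K. norm (f x) \<le> B" using AE_nu_K by (auto elim!: eventually_mono)
  then show ?thesis using assms(1) by (intro nu.integrable_const_bound[of _ B]) auto
qed

end

section \<open>Poisson representation\<close>

context nrw
begin

text \<open>The antisymmetric Green current through the edges between levels n - 1 and n; there are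
  none for n = 0.\<close>

definition "flux f g n = (if n = 0 then 0 else
  (\<Sum>z\<in>Jn n. ww z * (1 / lam) ^ n * (f (par z) * g z - g (par z) * f z)))"

lemma level_identity:
  "(\<Sum>y\<in>Jn n. f y * Lap g y - g y * Lap f y) = flux f g (Suc n) - flux f g n"
proof -
  let ?F = "\<lambda>y z. f y * g z - g y * f z"
  let ?A = "\<lambda>y. if n = 0 then 0 else ww y * (1 / lam) ^ n * ?F y (par y)"
  let ?B = "\<lambda>y. \<Sum>z\<in>ch y. ww z * (1 / lam) ^ Suc n * ?F y z"
  let ?C = "\<lambda>y. \<Sum>z\<in>hn y. a ^ n * (1 / lam) ^ n * ?F y z"
  have "f y * Lap g y - g y * Lap f y = ?A y + ?B y + ?C y" if y: "y \<in> Jn n" for y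
  proof -
    have "f y * Lap g y - g y * Lap f y = (\<Sum>z\<in>nb y. c y z * ?F y z)"
      unfolding Lap_def sum_distrib_left sum_subtractf[symmetric]
      by (intro sum.cong refl) (simp add: algebra_simps)
    then show ?thesis unfolding sum_nb[OF y] .
  qed
  then have "(\<Sum>y\<in>Jn n. f y * Lap g y - g y * Lap f y) = (\<Sum>y\<in>Jn n. ?A y) + (\<Sum>y\<in>Jn n. ?B y) + (\<Sum>y\<in>Jn n. ?C y)"
    by (simp add: sum.distrib cong: sum.cong)
  moreover have "(\<Sum>y\<in>Jn n. ?A y) = - flux f g n"
    unfolding flux_def by (simp add: sum_negf[symmetric] algebra_simps)
  moreover have "(\<Sum>y\<in>Jn n. ?B y) = flux f g (Suc n)"
    unfolding flux_def sum_par using ch_iff by (auto intro!: sum.cong)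
  \<comment> \<open>Horizontal edges have both ends on the level and their terms are antisymmetric,
    so they cancel in pairs.\<close>
  moreover have "(\<Sum>y\<in>Jn n. ?C y) = 0"
  proof -
    let ?G = "\<lambda>y z. if z \<in> hn y then a ^ n * (1 / lam) ^ n * ?F y z else 0"
    have 1: "(\<Sum>y\<in>Jn n. ?C y) = (\<Sum>y\<in>Jn n. \<Sum>z\<in>Jn n. ?G y z)"
    proof (rule sum.cong[OF refl])
      fix y assume y: "y \<in> Jn n"
      have "hn y = {z\<in>Jn n. z \<in> hn y}" using hn_iff[OF y] by auto
      then show "?C y = (\<Sum>z\<in>Jn n. ?G y z)" using sum.inter_filter[OF finite_J, of "\<lambda>z. a ^ n * (1 / lam) ^ n * ?F y z" n "\<lambda>z. z \<in> hn y"] by simp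
    qed
    also have "\<dots> = (\<Sum>z\<in>Jn n. \<Sum>y\<in>Jn n. ?G y z)" by (rule sum.swap)
    also have "\<dots> = (\<Sum>z\<in>Jn n. \<Sum>y\<in>Jn n. - ?G z y)"
    proof (intro sum.cong refl)
      fix y z assume yz: "z \<in> Jn n" "y \<in> Jn n"
      have "z \<in> hn y \<longleftrightarrow> y \<in> hn z" using hn_sym yz by blast
      then show "?G y z = - ?G z y" by (simp add: algebra_simps)
    qed
    also have "\<dots> = - (\<Sum>y\<in>Jn n. ?C y)" unfolding 1 by (simp only: sum_negf)
    finally show ?thesis by simp
  qed
  ultimately show ?thesis by simp
qed

lemma green_identity: "(\<Sum>k\<le>n. \<Sum>y\<in>Jn k. f y * Lap g y - g y * Lap f y) = flux f g (Suc n)"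
proof (induction n)
  case 0
  then show ?case unfolding atMost_0 by (simp add: level_identity flux_def[of f g 0])
next
  case (Suc n)
  then show ?case by (simp add: level_identity)
qed

text \<open>The Laplacian of the Green function is \<open>- mm x\<close> at its pole and 0
  elsewhere, and superharmonicity fixes the sign of the remaining terms.\<close>

lemma green_identity_le:
  assumes x: "x \<in> Jn m" "m \<le> n" and sup: "\<And>y. y \<in> X \<Longrightarrow> Lap f y \<le> 0"
  shows "flux (\<lambda>y. GG y x) f (Suc n) \<le> mm x * f x"
proof -
  have xX: "x \<in> X" using J_X[OF x(1)] .
  have "flux (\<lambda>y. GG y x) f (Suc n) = (\<Sum>k\<le>n. \<Sum>y\<in>Jn k. GG y x * Lap f y - f y * Lap (\<lambda>y. GG y x) y)"
    by (rule green_identity[symmetric])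
  also have "\<dots> \<le> (\<Sum>k\<le>n. \<Sum>y\<in>Jn k. if y = x then mm x * f x else 0)"
  proof (intro sum_mono)
    fix k y assume "y \<in> Jn k"
    then have yX: "y \<in> X" by (rule J_X)
    have "GG y x * Lap f y \<le> 0" using green_nonneg[OF yX xX] sup[OF yX] by (rule mult_nonneg_nonpos)
    then show "GG y x * Lap f y - f y * Lap (\<lambda>y. GG y x) y \<le> (if y = x then mm x * f x else 0)"
      using Lap_green[OF yX xX] by (auto simp: mult.commute)
  qed
  also have "\<dots> = (\<Sum>k\<le>n. if k = m then mm x * f x else 0)"
  proof (intro sum.cong refl)
    fix k
    show "(\<Sum>y\<in>Jn k. if y = x then mm x * f x else 0) = (if k = m then mm x * f x else 0)"
    proof (cases "k = m")
      case True
      then show ?thesis using x(1) finite_J[of m] by (simp add: sum.delta)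
    next
      case False
      then have "x \<notin> Jn k" using J_disj[OF x(1)] by blast
      then show ?thesis using False by (simp add: sum.neutral)
    qed
  qed
  also have "\<dots> = mm x * f x" using x(2) by simp
  finally show ?thesis .
qed

abbreviation "HH u x \<equiv> Hext N S \<rho> K \<gamma> lam u x"

text \<open>Quantified over every cell containing \<xi>, so that parents, horizontal neighbours and
  arbitrary rays all see the same boundary value.\<close>

definition bval :: "(nat list \<Rightarrow> real) \<Rightarrow> ('a \<Rightarrow> real) \<Rightarrow> bool" where
  "bval f u \<longleftrightarrow> (\<forall>e>0. \<exists>n0. \<forall>n\<ge>n0. \<forall>y\<in>Jn n. \<forall>\<xi>\<in>Kw y. \<bar>f y - u \<xi>\<bar> \<le> e)"

text \<open>After multiplication by \<open>kap x\<close> the flux is a Riemann sum. The Green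
  function at the parent carries one factor lam less than at the child, so the two products do not
  cancel but tend to \<open>(1 / lam - 1) * (mt x \<xi> * u \<xi>)\<close>.\<close>

lemma flux_limit:
  assumes x: "x \<in> X" and u: "u \<in> borel_measurable borel" "continuous_on K u" and f: "bval f u"
  shows "(\<lambda>n. flux (\<lambda>y. GG y x) f (Suc n)) \<longlonglongrightarrow> mm x * HH u x"
proof -
  have kp: "kap x > 0" using kap_pos[OF x] .
  have l1: "0 < 1 / lam" "1 < 1 / lam" using lam_pos a01 by auto
  obtain U where U: "U > 0" "\<forall>\<xi>\<in>K. \<bar>u \<xi>\<bar> \<le> U" using bounded_on_K[OF u(2)] by blast
  obtain Mb where Mb: "Mb > 0" "\<forall>\<xi>\<in>K. \<bar>mt x \<xi>\<bar> \<le> Mb" using bounded_on_K[OF martin_cont[OF x]] by blast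
  define \<phi> where "\<phi> z = (1 / lam) * (kap x * hh x (par z)) * f z - f (par z) * (kap x * hh x z)" for z
  define \<psi> where "\<psi> \<xi> = (1 / lam - 1) * (mt x \<xi> * u \<xi>)" for \<xi>
  have mtm[measurable]: "mt x \<in> borel_measurable borel" using martin_measurable[OF x] .
  have intmu: "integrable (nu K) (\<lambda>\<xi>. mt x \<xi> * u \<xi>)"
    using u martin_cont[OF x] by (intro integrable_K) (auto intro!: continuous_intros)
  have int: "integrable (nu K) \<psi>" unfolding \<psi>_def using intmu by simp
  have flux: "kap x * flux (\<lambda>y. GG y x) f (Suc n) = (\<Sum>z\<in>Jn (Suc n). ww z * \<phi> z)" for n
  proof -
    have "kap x * flux (\<lambda>y. GG y x) f (Suc n)
        = (\<Sum>z\<in>Jn (Suc n). kap x * (ww z * (1 / lam) ^ Suc n * (GG (par z) x * f z - f (par z) * GG z x)))"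
      by (simp add: flux_def sum_distrib_left)
    also have "\<dots> = (\<Sum>z\<in>Jn (Suc n). ww z * \<phi> z)"
    proof (intro sum.cong refl)
      fix z assume z: "z \<in> Jn (Suc n)"
      have "lv z = Suc n" "lv (par z) = n" using lev_eq z par_J[OF z] by auto
      then show "kap x * (ww z * (1 / lam) ^ Suc n * (GG (par z) x * f z - f (par z) * GG z x)) = ww z * \<phi> z"
        using lam_pos by (simp add: green_hh \<phi>_def field_simps)
    qed
    finally show ?thesis .
  qed
  have "(\<lambda>n. \<Sum>z\<in>Jn (Suc n). ww z * \<phi> z) \<longlonglongrightarrow> (\<integral>\<xi>. \<psi> \<xi> \<partial>nu K)"
  proof (rule metric_LIMSEQ_I)
    fix e :: real assume e: "e > 0"
    \<comment> \<open>Collects the bounds of the four error products below; d at most 1 keeps the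
      perturbed values within U + 1 and Mb + 1.\<close>
    define Q where "Q = (1 / lam) * (U + 1) + (1 / lam) * Mb + (Mb + 1) + U"
    have Q: "Q > 0" using U Mb l1 by (simp add: Q_def add_pos_pos)
    define d where "d = min 1 (e / (2 * Q))"
    have d: "d > 0" "d \<le> 1" "d * Q \<le> e / 2" using e Q by (auto simp: d_def min_def field_simps)
    obtain n1 where n1: "\<forall>\<xi>\<in>K. \<forall>y\<in>Om n1 \<xi>. \<bar>kap x * hh x y - mt x \<xi>\<bar> \<le> d"
      using martin_approx[OF x d(1)] by blast
    obtain n2 where n2: "\<forall>n\<ge>n2. \<forall>y\<in>Jn n. \<forall>\<xi>\<in>Kw y. \<bar>f y - u \<xi>\<bar> \<le> d"
      using f d(1) unfolding bval_def by blast
    have "\<bar>(\<Sum>z\<in>Jn (Suc n). ww z * \<phi> z) - (\<integral>\<xi>. \<psi> \<xi> \<partial>nu K)\<bar> \<le> e / 2" if n: "n \<ge> max n1 n2" for n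
    proof (rule riemann_sum_bound[OF int])
      fix z \<xi> assume z: "z \<in> Jn (Suc n)" and \<xi>: "\<xi> \<in> Kw z"
      have pz: "par z \<in> Jn n" "prefix (par z) z" using par_J[OF z] by auto
      have \<xi>p: "\<xi> \<in> Kw (par z)" using Kw_prefix[OF J_W[OF z] pz(2)] \<xi> by blast
      have \<xi>K: "\<xi> \<in> K" using Kw_subset[OF J_W[OF z]] \<xi> by blast
      have o1: "z \<in> Om n1 \<xi>" by (rule in_Om[OF z _ \<xi>]) (use n r01 in auto)
      have o2: "par z \<in> Om n1 \<xi>" by (rule in_Om[OF pz(1) _ \<xi>p]) (use n r01 in auto)
      define A B C D M V where "A = kap x * hh x (par z)" and "B = f z" and "C = f (par z)"
        and "D = kap x * hh x z" and "M = mt x \<xi>" and "V = u \<xi>"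
      have 1: "\<bar>A - M\<bar> \<le> d" "\<bar>D - M\<bar> \<le> d" using n1 \<xi>K o1 o2 by (auto simp: A_def D_def M_def)
      have 2: "\<bar>B - V\<bar> \<le> d" "\<bar>C - V\<bar> \<le> d" 
        using n2[rule_format, OF _ z \<xi>] n2[rule_format, OF _ pz(1) \<xi>p] n by (auto simp: B_def C_def V_def)
      have 3: "\<bar>M\<bar> \<le> Mb" "\<bar>V\<bar> \<le> U" using Mb U \<xi>K by (auto simp: M_def V_def)
      have 4: "\<bar>B\<bar> \<le> U + 1" "\<bar>D\<bar> \<le> Mb + 1" using 1 2 3 d by linarith+
      have 5: "\<bar>(A - M) * B\<bar> \<le> d * (U + 1)" "\<bar>M * (B - V)\<bar> \<le> Mb * d" "\<bar>(C - V) * D\<bar> \<le> d * (Mb + 1)" "\<bar>V * (D - M)\<bar> \<le> U * d"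
        unfolding abs_mult
        using mult_mono[OF 1(1) 4(1) less_imp_le[OF d(1)] abs_ge_zero]
          mult_mono[OF 3(1) 2(1) less_imp_le[OF Mb(1)] abs_ge_zero]
          mult_mono[OF 2(2) 4(2) less_imp_le[OF d(1)] abs_ge_zero]
          mult_mono[OF 3(2) 1(2) less_imp_le[OF U(1)] abs_ge_zero] .
      have "\<phi> z - \<psi> \<xi> = (1 / lam) * ((A - M) * B + M * (B - V)) - ((C - V) * D + V * (D - M))"
      proof -
        have *: "(1 / t) * A * B - C * D - (1 / t - 1) * (M * V)
            = (1 / t) * ((A - M) * B + M * (B - V)) - ((C - V) * D + V * (D - M))" for t
          by (simp add: algebra_simps)
        show ?thesis using *[of lam]
          unfolding \<phi>_def \<psi>_def A_def B_def C_def D_def M_def V_def .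
      qed
      also have "\<bar>\<dots>\<bar> \<le> (1 / lam) * (d * (U + 1) + Mb * d) + (d * (Mb + 1) + U * d)"
      proof -
        have "\<bar>(1 / lam) * ((A - M) * B + M * (B - V))\<bar> \<le> (1 / lam) * (d * (U + 1) + Mb * d)"
          unfolding abs_mult using 5 l1 by (intro mult_mono) auto
        moreover have "\<bar>(C - V) * D + V * (D - M)\<bar> \<le> d * (Mb + 1) + U * d" using 5 by linarith
        ultimately show ?thesis by linarith
      qed
      also have "\<dots> = d * Q" by (simp add: Q_def algebra_simps add_divide_distrib)
      finally show "\<bar>\<phi> z - \<psi> \<xi>\<bar> \<le> e / 2" using d by linarith
    qed
    then show "\<exists>no. \<forall>n\<ge>no. dist (\<Sum>z\<in>Jn (Suc n). ww z * \<phi> z) (\<integral>\<xi>. \<psi> \<xi> \<partial>nu K) < e"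
      using e by (intro exI[of _ "max n1 n2"]) (fastforce simp: dist_real_def)
  qed
  then have "(\<lambda>n. (1 / kap x) * (kap x * flux (\<lambda>y. GG y x) f (Suc n))) \<longlonglongrightarrow> (1 / kap x) * (\<integral>\<xi>. \<psi> \<xi> \<partial>nu K)"
    unfolding flux by (intro tendsto_intros)
  moreover have "(1 / kap x) * (\<integral>\<xi>. \<psi> \<xi> \<partial>nu K) = mm x * HH u x"
  proof -
    have "(\<integral>\<xi>. \<psi> \<xi> \<partial>nu K) = (1 / lam - 1) * HH u x"
      unfolding \<psi>_def Hext_def by (rule integral_mult_right_zero)
    moreover have "(1 / kap x) * (1 / lam - 1) = mm x"
      unfolding kap_def using lam_pos a01 mm_pos[OF x] by (simp add: field_simps)
    ultimately show ?thesis by (simp only: mult.assoc[symmetric])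
  qed
  ultimately show ?thesis using kp by simp
qed

text \<open>Limit of the Green identity. A one-sided statement is what the barrier argument needs;
  applied to f and - f it yields the harmonic case.\<close>

lemma HH_superharmonic:
  assumes "x \<in> X" "u \<in> borel_measurable borel" "continuous_on K u" "bval f u" and sup: "\<And>y. y \<in> X \<Longrightarrow> Lap f y \<le> 0"
  shows "HH u x \<le> f x"
proof -
  have "mm x * HH u x \<le> mm x * f x"
    using green_identity_le[OF X_J[OF assms(1)] _ sup]
    by (intro LIMSEQ_le_const2[OF flux_limit[OF assms(1-4)]]) blast
  then show ?thesis using mm_pos[OF assms(1)] by simp
qed

lemma Lap_uminus: "Lap (\<lambda>y. - f y) x = - Lap f x"
  unfolding Lap_def sum_negf[symmetric] by (intro sum.cong refl) (simp add: algebra_simps)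

lemma HH_harmonic:
  assumes "x \<in> X" "u \<in> borel_measurable borel" "continuous_on K u" "bval f u" and h: "\<And>y. y \<in> X \<Longrightarrow> Lap f y = 0"
  shows "HH u x = f x"
proof -
  have "bval (\<lambda>y. - f y) (\<lambda>\<xi>. - u \<xi>)"
    using assms(4) unfolding bval_def by (simp add: abs_minus_commute)
  then have "HH (\<lambda>\<xi>. - u \<xi>) x \<le> - f x"
    using assms by (intro HH_superharmonic[OF assms(1)]) (auto simp: Lap_uminus intro!: continuous_intros)
  moreover have "HH (\<lambda>\<xi>. - u \<xi>) x = - HH u x" by (simp add: Hext_def)
  moreover have "HH u x \<le> f x" using assms by (intro HH_superharmonic) auto
  ultimately show ?thesis by simp
qed

text \<open>Any value strictly between \<open>max r lam\<close> and 1 would do: lam < t0 < 1 makes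
  \<open>t0 ^ lv y\<close> a strict supersolution for the walk, and r < t0 makes its drift dominate
  the error of the distance.\<close>

definition "t0 = (1 + max r lam) / 2"
definition "Bf = CD 1 (1 / lam) / (a * ((1 - t0) * (1 / lam - 1 / t0)))"

lemma t0: "r < t0" "lam < t0" "t0 < 1" "0 < t0"
  using r01 a01 lam_pos by (auto simp: t0_def max_def)

lemma kap0: "0 < (1 - t0) * (1 / lam - 1 / t0)"
  using t0 lam_pos by (intro mult_pos_pos) (auto simp: frac_less2)

lemma Bf: "0 \<le> Bf"
proof -
  have "0 \<le> CD 1 (1 / lam)" unfolding CD_def using lam_pos dK_ge r01 Mh(1) C1 by simp
  then show ?thesis unfolding Bf_def by (rule divide_nonneg_pos[OF _ mult_pos_pos[OF a01(1) kap0]])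
qed

lemma Lap_barrier:
  assumes y: "y \<in> X" shows "Lap (\<lambda>y. dist (pt y) q + Bf * t0 ^ lv y) y \<le> 0"
proof -
  let ?k = "(1 - t0) * (1 / lam - 1 / t0)"
  define n where "n = lv y"
  have yJ: "y \<in> Jn n" using X_J[OF y] by (simp add: n_def)
  \<comment> \<open>At the root the positive parent term is missing, which only lowers the left
    side.\<close>
  have k: "(if n = 0 then 0 else 1 * (1 / t0 - 1)) + (1 / lam) * (t0 - 1) \<le> - ?k"
  proof -
    have "(1 / t0 - 1) + (1 / lam) * (t0 - 1) = - ?k" using t0 lam_pos by (simp add: field_simps)
    moreover have "0 < 1 / t0 - 1" using t0 by simp
    ultimately show ?thesis by auto
  qed
  have "Lop 1 (1 / lam) (\<lambda>y. t0 ^ lv y) y \<le> ww y * t0 ^ n * (- ?k)"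
    unfolding Lop_pow[OF yJ t0(4)] using k ww_pos[OF yJ] t0 by (intro mult_left_mono) auto
  also have "\<dots> \<le> - (a ^ Suc n * (t0 ^ n * ?k))"
  proof -
    have "0 \<le> t0 ^ n * ?k" by (rule mult_nonneg_nonneg[OF _ less_imp_le[OF kap0]]) (use t0 in simp)
    then have "a ^ Suc n * (t0 ^ n * ?k) \<le> ww y * (t0 ^ n * ?k)"
      by (rule mult_right_mono[OF ww_ge[OF yJ]])
    then show ?thesis by (simp only: mult.assoc mult_minus_right neg_le_iff_le)
  qed
  finally have "Bf * Lop 1 (1 / lam) (\<lambda>y. t0 ^ lv y) y \<le> Bf * - (a ^ Suc n * (t0 ^ n * ?k))"
    using Bf by (rule mult_left_mono)
  moreover have "Bf * (a ^ Suc n * (t0 ^ n * ?k)) = CD 1 (1 / lam) * (a ^ n * t0 ^ n)"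
  proof -
    have "s / t * t = s" if "t > 0" for s t :: real using that by simp
    from this[OF mult_pos_pos[OF a01(1) kap0]] have "Bf * (a * ?k) = CD 1 (1 / lam)"
      unfolding Bf_def .
    moreover have "Bf * (a ^ Suc n * (t0 ^ n * ?k)) = Bf * (a * ?k) * (a ^ n * t0 ^ n)"
      by (simp only: power_Suc mult_ac)
    ultimately show ?thesis by simp
  qed
  moreover have "CD 1 (1 / lam) * (a ^ n * r ^ n) \<le> CD 1 (1 / lam) * (a ^ n * t0 ^ n)"
  proof (intro mult_left_mono)
    show "r ^ n \<le> t0 ^ n" using t0 r01 by (intro power_mono) auto
    show "0 \<le> CD 1 (1 / lam)" unfolding CD_def using lam_pos dK_ge r01 Mh(1) C1 by simp
  qed (use a01 in auto)
  moreover have "Lop 1 (1 / lam) (\<lambda>y. dist (pt y) q) y \<le> CD 1 (1 / lam) * (a ^ n * r ^ n)"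
    using lam_pos by (intro Lop_dist[OF yJ]) auto
  ultimately have "Lop 1 (1 / lam) (\<lambda>y. dist (pt y) q) y + Bf * Lop 1 (1 / lam) (\<lambda>y. t0 ^ lv y) y \<le> 0"
    by (simp only: mult_minus_right)
  then have "Lop 1 (1 / lam) (\<lambda>y. dist (pt y) q + Bf * t0 ^ lv y) y \<le> 0" unfolding Lop_lin .
  then show ?thesis unfolding Lap_Lop[OF yJ] using lam_pos by (intro mult_nonneg_nonpos) auto
qed

lemma err_tendsto: "(\<lambda>n. dK * r ^ n + Bf * t0 ^ n) \<longlonglongrightarrow> 0"
proof -
  have "(\<lambda>n. dK * r ^ n + Bf * t0 ^ n) \<longlonglongrightarrow> dK * 0 + Bf * 0"
    using r01 t0 by (intro tendsto_intros LIMSEQ_power_zero) auto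
  then show ?thesis by simp
qed

lemma HH_one: "x \<in> X \<Longrightarrow> HH (\<lambda>_. 1) x = 1"
  by (rule HH_harmonic[where f = "\<lambda>_. 1"]) (auto simp: bval_def Lap_def)

text \<open>The correction \<open>t0 ^ lv y\<close> dies out at the boundary, so the barrier is
  superharmonic with boundary values the distance to \<xi>. Hence the hitting distribution from y
  concentrates near the cell of y.\<close>

lemma HH_dist:
  assumes y: "y \<in> Jn n" "\<xi> \<in> Kw y"
  shows "HH (\<lambda>\<eta>. dist \<eta> \<xi>) y \<le> dK * r ^ n + Bf * t0 ^ n"
proof -
  let ?f = "\<lambda>y. dist (pt y) \<xi> + Bf * t0 ^ lv y"
  have "HH (\<lambda>\<eta>. dist \<eta> \<xi>) y \<le> ?f y"
  proof (rule HH_superharmonic[OF J_X[OF y(1)]])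
    show "bval ?f (\<lambda>\<eta>. dist \<eta> \<xi>)"
      unfolding bval_def
    proof (intro allI impI)
      fix e :: real assume "e > 0"
      then obtain n0 where n0: "\<And>n. n \<ge> n0 \<Longrightarrow> \<bar>dK * r ^ n + Bf * t0 ^ n\<bar> < e"
        using metric_LIMSEQ_D[OF err_tendsto] by (auto simp: dist_real_def)
      have "\<bar>?f y - dist \<eta> \<xi>\<bar> \<le> e" if z: "n \<ge> n0" "y \<in> Jn n" "\<eta> \<in> Kw y" for n y \<eta>
      proof -
        have "\<bar>dist (pt y) \<xi> - dist \<eta> \<xi>\<bar> \<le> dK * r ^ n"
          using pt_dist[OF z(2,3)] dist_triangle[of "pt y" \<xi> \<eta>] dist_triangle[of \<eta> \<xi> "pt y"] by (simp add: dist_commute)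
        moreover have "0 \<le> Bf * t0 ^ n" using Bf t0 by simp
        ultimately show ?thesis using n0[OF z(1)] unfolding lev_eq[OF z(2)] by linarith
      qed
      then show "\<exists>n0. \<forall>n\<ge>n0. \<forall>y\<in>Jn n. \<forall>\<eta>\<in>Kw y. \<bar>?f y - dist \<eta> \<xi>\<bar> \<le> e" by (intro exI[of _ n0] allI impI ballI)
    qed
  qed (auto intro!: continuous_intros Lap_barrier)
  also have "\<dots> \<le> dK * r ^ n + Bf * t0 ^ n" using pt_dist[OF y] lev_eq[OF y(1)] by simp
  finally show ?thesis .
qed

text \<open>Chebyshev-type estimate: \<bar>u \<eta> - u \<xi>\<bar> is at most e / 2 near \<xi> by
  uniform continuity, and at most \<open>dist \<eta> \<xi> * (2 * U / d)\<close> farther away. Both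
  are integrated against the kernel, which has integral 1.\<close>

lemma HH_bval:
  assumes u: "u \<in> borel_measurable borel" "continuous_on K u"
  shows "bval (HH u) u"
  unfolding bval_def
proof (intro allI impI)
  fix e :: real assume e: "e > 0"
  obtain U where U: "U > 0" "\<forall>\<xi>\<in>K. \<bar>u \<xi>\<bar> \<le> U" using bounded_on_K[OF u(2)] by blast
  have "uniformly_continuous_on K u" using compact_uniformly_continuous[OF u(2) K_compact] .
  then obtain d where d: "d > 0" "\<forall>\<xi>\<in>K. \<forall>\<eta>\<in>K. dist \<eta> \<xi> < d \<longrightarrow> dist (u \<eta>) (u \<xi>) < e / 2"
    using e unfolding uniformly_continuous_on_def by (meson half_gt_zero)
  \<comment> \<open>Makes \<open>s * (2 * U / d)\<close> equal to e / 2.\<close>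
  define s where "s = e * d / (4 * U)"
  have s: "s > 0" using e d U by (simp add: s_def)
  obtain n0 where n0: "\<And>n. n \<ge> n0 \<Longrightarrow> \<bar>dK * r ^ n + Bf * t0 ^ n\<bar> < s"
    using metric_LIMSEQ_D[OF err_tendsto s] by (auto simp: dist_real_def)
  have "\<bar>HH u y - u \<xi>\<bar> \<le> e" if y: "n \<ge> n0" "y \<in> Jn n" "\<xi> \<in> Kw y" for n y \<xi>
  proof -
    have yX: "y \<in> X" using J_X[OF y(2)] .
    have \<xi>K: "\<xi> \<in> K" using Kw_subset[OF J_W[OF y(2)]] y(3) by blast
    have mtm[measurable]: "mt y \<in> borel_measurable borel" using martin_measurable[OF yX] .
    have mc: "continuous_on K (mt y)" using martin_cont[OF yX] .
    have i1: "integrable (nu K) (\<lambda>\<eta>. mt y \<eta> * u \<eta>)" using u mc by (intro integrable_K) (auto intro!: continuous_intros)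
    have i2: "integrable (nu K) (\<lambda>\<eta>. mt y \<eta>)" using mc by (intro integrable_K) auto
    have i3: "integrable (nu K) (\<lambda>\<eta>. mt y \<eta> * dist \<eta> \<xi>)" using mc by (intro integrable_K) (auto intro!: continuous_intros)
    have one: "(\<integral>\<eta>. mt y \<eta> \<partial>nu K) = 1" using HH_one[OF yX] by (simp add: Hext_def)
    have "HH u y - u \<xi> = (\<integral>\<eta>. mt y \<eta> * u \<eta> - mt y \<eta> * u \<xi> \<partial>nu K)"
      using i1 i2 one by (simp add: Hext_def)
    also have "\<bar>\<dots>\<bar> \<le> (\<integral>\<eta>. \<bar>mt y \<eta> * u \<eta> - mt y \<eta> * u \<xi>\<bar> \<partial>nu K)"
      using integral_norm_bound[of "nu K" "\<lambda>\<eta>. mt y \<eta> * u \<eta> - mt y \<eta> * u \<xi>"] by simp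
    also have "\<dots> \<le> (\<integral>\<eta>. mt y \<eta> * (e / 2) + (mt y \<eta> * dist \<eta> \<xi>) * (2 * U / d) \<partial>nu K)"
    proof (rule integral_mono_AE)
      show "AE \<eta> in nu K. \<bar>mt y \<eta> * u \<eta> - mt y \<eta> * u \<xi>\<bar> \<le> mt y \<eta> * (e / 2) + (mt y \<eta> * dist \<eta> \<xi>) * (2 * U / d)"
        using AE_nu_K
      proof eventually_elim
        case (elim \<eta>)
        have m0: "0 \<le> mt y \<eta>" using martin_nonneg[OF yX elim] .
        have "\<bar>u \<eta> - u \<xi>\<bar> \<le> e / 2 + dist \<eta> \<xi> * (2 * U / d)"
        proof (cases "dist \<eta> \<xi> < d")
          case True
          then have "\<bar>u \<eta> - u \<xi>\<bar> < e / 2" using d(2) \<xi>K elim by (auto simp: dist_real_def)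
          moreover have "0 \<le> dist \<eta> \<xi> * (2 * U / d)" using U d by simp
          ultimately show ?thesis by linarith
        next
          case False
          have "\<bar>u \<eta>\<bar> \<le> U" "\<bar>u \<xi>\<bar> \<le> U" using U(2) \<xi>K elim by auto
          then have "\<bar>u \<eta> - u \<xi>\<bar> \<le> 2 * U" by linarith
          also have "2 * U = d * (2 * U / d)" using d by simp
          also have "\<dots> \<le> dist \<eta> \<xi> * (2 * U / d)" using False U d by (intro mult_right_mono) auto
          finally show ?thesis using e by linarith
        qed
        then have "mt y \<eta> * \<bar>u \<eta> - u \<xi>\<bar> \<le> mt y \<eta> * (e / 2 + dist \<eta> \<xi> * (2 * U / d))" using m0 by (rule mult_left_mono)
        then show ?case using m0 by (simp add: abs_mult right_diff_distrib[symmetric] distrib_left mult.assoc)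
      qed
    qed (use i1 i2 i3 in auto)
    also have "\<dots> = e / 2 + HH (\<lambda>\<eta>. dist \<eta> \<xi>) y * (2 * U / d)"
      using i2 i3 one by (subst Bochner_Integration.integral_add) (auto simp: Hext_def)
    also have "\<dots> \<le> e / 2 + s * (2 * U / d)"
    proof -
      have "HH (\<lambda>\<eta>. dist \<eta> \<xi>) y \<le> s" using HH_dist[OF y(2,3)] n0[OF y(1)] by linarith
      then show ?thesis using U d by (intro add_left_mono mult_right_mono) auto
    qed
    also have "\<dots> = e" using U d by (simp add: s_def)
    finally show ?thesis .
  qed
  then show "\<exists>n0. \<forall>n\<ge>n0. \<forall>y\<in>Jn n. \<forall>\<xi>\<in>Kw y. \<bar>HH u y - u \<xi>\<bar> \<le> e" by (intro exI[of _ n0] allI impI ballI)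
qed

end

section \<open>Energy, traces and limiting resistance\<close>

context nrw
begin

section \<open>Energies of finite parts of the tree\<close>

abbreviation "XX n \<equiv> Xn N \<rho> n"
abbreviation "En n f \<equiv> energyXn N S \<rho> K \<gamma> lam n f"
abbreviation "EE f \<equiv> energyX N S \<rho> K \<gamma> lam f"

lemma XX_iff: "x \<in> XX n \<longleftrightarrow> (\<exists>k\<le>n. x \<in> Jn k)" by (auto simp: Xn_def)

lemma finite_XX: "finite (XX n)" using finite_J by (simp add: Xn_def)

lemma XX_mono: "m \<le> n \<Longrightarrow> XX m \<subseteq> XX n" by (force simp: Xn_def)

lemma J_XX: "x \<in> Jn k \<Longrightarrow> k \<le> n \<Longrightarrow> x \<in> XX n" by (auto simp: XX_iff)

definition "qd f x y = c x y * (f x - f y)\<^sup>2"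

lemma qd_nonneg: "0 \<le> qd f x y" by (simp add: qd_def c_nonneg)

lemma En_prod: "En n f = (\<Sum>(x, y)\<in>XX n \<times> XX n. qd f x y) / 2"
  unfolding energyXn_def qd_def by (simp add: sum.cartesian_product)

lemma En_nonneg: "0 \<le> En n f"
  unfolding En_prod using qd_nonneg by (auto intro!: sum_nonneg divide_nonneg_nonneg)

lemma En_mono: "m \<le> n \<Longrightarrow> En m f \<le> En n f"
  unfolding En_prod using XX_mono[of m n] finite_XX qd_nonneg
  by (intro divide_right_mono sum_mono2) auto

lemma En_edge:
  assumes "x \<in> XX n" "y \<in> XX n" "x \<noteq> y" shows "c x y * (f x - f y)\<^sup>2 \<le> En n f"
proof -
  have "(\<Sum>(x, y)\<in>{(x, y), (y, x)}. qd f x y) \<le> (\<Sum>(x, y)\<in>XX n \<times> XX n. qd f x y)"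
    using assms finite_XX qd_nonneg by (intro sum_mono2) auto
  moreover have "(\<Sum>(x, y)\<in>{(x, y), (y, x)}. qd f x y) = 2 * (c x y * (f x - f y)\<^sup>2)"
    using assms(3) c_sym[of x y] by (simp add: qd_def power2_commute)
  ultimately show ?thesis by (simp add: En_prod)
qed

lemma En_le:
  assumes "\<And>x y. \<bar>g x - g y\<bar> \<le> t * \<bar>f x - f y\<bar>" "t \<ge> 0" shows "En n g \<le> t\<^sup>2 * En n f"
proof -
  have "(\<Sum>(x, y)\<in>XX n \<times> XX n. qd g x y) \<le> (\<Sum>(x, y)\<in>XX n \<times> XX n. t\<^sup>2 * qd f x y)"
  proof (intro sum_mono)
    fix p assume "p \<in> XX n \<times> XX n"
    obtain x y where p: "p = (x, y)" by (cases p)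
    have "(g x - g y)\<^sup>2 = \<bar>g x - g y\<bar>\<^sup>2" by simp
    also have "\<dots> \<le> (t * \<bar>f x - f y\<bar>)\<^sup>2" using assms(1)[of x y] by (intro power_mono) auto
    finally have "c x y * (g x - g y)\<^sup>2 \<le> c x y * (t\<^sup>2 * (f x - f y)\<^sup>2)"
      using c_nonneg by (intro mult_left_mono) (auto simp: power_mult_distrib)
    then show "(case p of (x, y) \<Rightarrow> qd g x y) \<le> (case p of (x, y) \<Rightarrow> t\<^sup>2 * qd f x y)"
      by (simp add: p qd_def mult.left_commute)
  qed
  then show ?thesis unfolding En_prod by (simp add: split_def sum_distrib_left)
qed

text \<open>Monotone convergence: pairs with nonzero conductance lie in X, so the sets
  \<open>XX n\<close> exhaust them. From here on the extended-real energy is handled through real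
  ones.\<close>

lemma EE_SUP: "EE f = (SUP n. ennreal (En n f))"
proof -
  define g where "g p = ennreal (qd f (fst p) (snd p))" for p
  have inc: "incseq (\<lambda>n p. g p * indicator (XX n \<times> XX n) p)"
    using XX_mono by (intro incseq_SucI le_funI) (auto simp: indicator_def, (meson le_SucI order_refl subsetD)+)
  have gs: "g p = (SUP n. g p * indicator (XX n \<times> XX n) p)" for p
  proof (cases "g p = 0")
    case True
    then show ?thesis by simp
  next
    case False
    then have "c (fst p) (snd p) \<noteq> 0" by (auto simp: g_def qd_def)
    then have "fst p \<in> X" "snd p \<in> X" using c_nonzero[of "fst p" "snd p"] c_nonzero[of "snd p" "fst p"] c_sym[of "fst p" "snd p"] J_X
      by auto
    then have "fst p \<in> XX (max (lv (fst p)) (lv (snd p)))" "snd p \<in> XX (max (lv (fst p)) (lv (snd p)))"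
      using J_XX[OF X_J] by auto
    then have i: "p \<in> XX (max (lv (fst p)) (lv (snd p))) \<times> XX (max (lv (fst p)) (lv (snd p)))" by (simp add: mem_Times_iff)
    show ?thesis
    proof (rule antisym)
      show "g p \<le> (SUP n. g p * indicator (XX n \<times> XX n) p)"
        by (rule SUP_upper2[of "max (lv (fst p)) (lv (snd p))"]) (use i in \<open>auto simp: indicator_def\<close>)
      show "(SUP n. g p * indicator (XX n \<times> XX n) p) \<le> g p"
        by (intro SUP_least) (auto simp: indicator_def)
    qed
  qed
  have fs: "(\<integral>\<^sup>+ p. g p * indicator (XX n \<times> XX n) p \<partial>count_space UNIV) = ennreal (2 * En n f)" for n
  proof -
    have "(\<integral>\<^sup>+ p. g p * indicator (XX n \<times> XX n) p \<partial>count_space UNIV) = (\<integral>\<^sup>+ p. g p \<partial>count_space (XX n \<times> XX n))"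
      by (rule nn_integral_count_space_indicator[symmetric]) simp
    also have "\<dots> = (\<Sum>p\<in>XX n \<times> XX n. g p)" using finite_XX by (intro nn_integral_count_space_finite) simp
    also have "\<dots> = ennreal (\<Sum>p\<in>XX n \<times> XX n. qd f (fst p) (snd p))"
      unfolding g_def using qd_nonneg by (intro sum_ennreal) auto
    also have "(\<Sum>p\<in>XX n \<times> XX n. qd f (fst p) (snd p)) = 2 * En n f" by (simp add: En_prod split_def)
    finally show ?thesis .
  qed
  have "EE f = (\<integral>\<^sup>+ p. g p \<partial>count_space UNIV) / 2" by (simp add: energyX_def g_def qd_def)
  also have "(\<integral>\<^sup>+ p. g p \<partial>count_space UNIV) = (\<integral>\<^sup>+ p. (SUP n. g p * indicator (XX n \<times> XX n) p) \<partial>count_space UNIV)"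
    using gs by simp
  also have "\<dots> = (SUP n. ennreal (2 * En n f))"
    unfolding fs[symmetric] by (rule nn_integral_monotone_convergence_SUP[OF inc]) simp
  also have "(SUP n. ennreal (2 * En n f)) / 2 = (SUP n. ennreal (2 * En n f) / 2)" by (rule SUP_divide_ennreal)
  also have "\<dots> = (SUP n. ennreal (En n f))"
  proof -
    have "ennreal (2 * En n f) / 2 = ennreal (En n f)" for n
      using divide_ennreal[of "2 * En n f" 2] En_nonneg by simp
    then show ?thesis by simp
  qed
  finally show ?thesis .
qed

definition "fin M f \<longleftrightarrow> (\<forall>n. En n f \<le> M)"

lemma fin_EE: "M \<ge> 0 \<Longrightarrow> fin M f \<longleftrightarrow> EE f \<le> ennreal M"
  unfolding fin_def EE_SUP SUP_le_iff using ennreal_le_iff[of M] by auto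

lemma fin_nonneg: "fin M f \<Longrightarrow> M \<ge> 0" using En_nonneg[of 0 f] unfolding fin_def by (meson order_trans)

lemma EE_cong: "(\<And>x. x \<in> X \<Longrightarrow> f x = g x) \<Longrightarrow> EE f = EE g"
proof -
  assume *: "\<And>x. x \<in> X \<Longrightarrow> f x = g x"
  have "En n f = En n g" for n
    unfolding En_prod qd_def using * J_X by (intro arg_cong2[of _ _ _ _ "(/)"] sum.cong refl) (auto simp: XX_iff)
  then show ?thesis by (simp add: EE_SUP)
qed

text \<open>Here \<open>lam < a\<close> takes effect: an edge of level k has conductance at least
  \<open>a * (a / lam) ^ k\<close>, so energy at most M bounds the difference across it by
  \<open>sqrt (M / a) * qq ^ k\<close>. \<open>CM\<close> is the sum of the resulting geometric
  series.\<close>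

definition "qq = sqrt (lam / a)"

lemma qq: "0 < qq" "qq < 1" using lam_pos a01 by (auto simp: qq_def)

definition "CM M = sqrt (M / a) / (1 - qq)"

lemma CM: "M \<ge> 0 \<Longrightarrow> 0 \<le> CM M" "M \<ge> 0 \<Longrightarrow> sqrt (M / a) \<le> CM M"
proof -
  assume "M \<ge> 0"
  then have s: "0 \<le> sqrt (M / a)" using a01 by simp
  then show "0 \<le> CM M" using qq by (simp add: CM_def)
  have "sqrt (M / a) * (1 - qq) \<le> sqrt (M / a)" using s qq by (intro mult_left_le) auto
  then show "sqrt (M / a) \<le> CM M" using qq by (simp add: CM_def pos_le_divide_eq)
qed

lemma edge_decay:
  assumes "w * d\<^sup>2 \<le> M" "a * (a / lam) ^ k \<le> w" shows "\<bar>d\<bar> \<le> sqrt (M / a) * qq ^ k"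
proof -
  have "a * (a / lam) ^ k * d\<^sup>2 \<le> M" using mult_right_mono[OF assms(2), of "d\<^sup>2"] assms(1) by simp
  then have "d\<^sup>2 \<le> (M / a) * (lam / a) ^ k"
    using a01 lam_pos by (simp add: power_divide field_simps)
  from real_sqrt_le_mono[OF this] have "\<bar>d\<bar> \<le> sqrt ((M / a) * (lam / a) ^ k)" by (simp only: real_sqrt_abs)
  then show ?thesis unfolding real_sqrt_mult real_sqrt_power qq_def .
qed

lemma par_decay:
  assumes M: "En n f \<le> M" and z: "z \<in> Jn (Suc k)" "Suc k \<le> n"
  shows "\<bar>f (par z) - f z\<bar> \<le> sqrt (M / a) * qq ^ Suc k"
proof (rule edge_decay)
  have pz: "par z \<in> Jn k" using par_J[OF z(1)] by simp
  have ne: "z \<noteq> par z" using J_disj[OF z(1), of k] pz by auto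
  have "c z (par z) * (f z - f (par z))\<^sup>2 \<le> En n f"
    using En_edge[OF J_XX[OF z(1,2)] J_XX[OF pz _] ne] z(2) by simp
  then show "c z (par z) * (f (par z) - f z)\<^sup>2 \<le> M" using M by (simp add: power2_commute)
  have "a * (a / lam) ^ Suc k = a ^ Suc (Suc k) * (1 / lam) ^ Suc k" by (simp add: power_divide)
  also have "\<dots> \<le> ww z * (1 / lam) ^ Suc k" using ww_ge[OF z(1)] lam_pos by (intro mult_right_mono) auto
  finally show "a * (a / lam) ^ Suc k \<le> c z (par z)" unfolding c_up[OF z(1)] .
qed

lemma hor_decay:
  assumes M: "En n f \<le> M" and x: "x \<in> Jn k" "k \<le> n" "y \<in> hn x"
  shows "\<bar>f x - f y\<bar> \<le> sqrt (M / a) * qq ^ k"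
proof (rule edge_decay)
  have y: "y \<in> Jn k" "y \<noteq> x" using hn_iff[OF x(1)] x(3) by auto
  show "c x y * (f x - f y)\<^sup>2 \<le> M"
    using En_edge[of x n y f] J_XX[OF x(1,2)] J_XX[OF y(1) x(2)] y(2) M by simp
  have "a * (a / lam) ^ k \<le> 1 * (a / lam) ^ k" using a01 lam_pos by (intro mult_right_mono) auto
  then show "a * (a / lam) ^ k \<le> c x y" unfolding c_hor[OF x(1,3)] by (simp add: power_divide)
qed

lemma prefix_decay:
  assumes "En m f \<le> M" "z \<in> Jn n" "n \<le> m" "y \<in> Jn k" "prefix y z" "k \<le> n"
  shows "\<bar>f y - f z\<bar> \<le> CM M * qq ^ k"
proof -
  have M0: "0 \<le> M" using En_nonneg[of m f] assms(1) by linarith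
  let ?s = "sqrt (M / a)"
  have s0: "0 \<le> ?s" using M0 a01 by simp
  \<comment> \<open>The sharper telescoping bound is what the induction can carry.\<close>
  have "\<bar>f y - f z\<bar> \<le> CM M * (qq ^ k - qq ^ n)"
    using assms(6,2,3,5)
  proof (induction n arbitrary: z rule: dec_induct)
    case base
    then have "y = z" using J_prefix_eq assms(4) by blast
    then show ?case by simp
  next
    case (step n)
    have pz: "par z \<in> Jn n" "prefix (par z) z" using par_J[OF step(4)] by auto
    have "rw \<rho> (par z) \<le> r ^ k" using J_le[OF pz(1)] r_power_less(2)[OF step(1)] by linarith
    then obtain y' where y': "y' \<in> Jn k" "prefix y' (par z)" using J_prefix_exists[OF J_W[OF pz(1)]] by blast
    then have "y' = y" using J_prefix_unique[OF y'(1) assms(4) prefix_order.trans[OF y'(2) pz(2)] step(6)] by simp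
    then have 1: "\<bar>f y - f (par z)\<bar> \<le> CM M * (qq ^ k - qq ^ n)"
      using step.IH[OF pz(1)] y'(2) step(5) by simp
    have 2: "\<bar>f (par z) - f z\<bar> \<le> ?s * qq ^ Suc n" using par_decay[OF assms(1) step(4,5)] .
    have "?s * qq ^ Suc n \<le> ?s * qq ^ n" using s0 qq by (intro mult_left_mono) (auto simp: mult_left_le_one_le)
    also have "\<dots> = CM M * (qq ^ n - qq ^ Suc n)"
      using qq by (simp add: CM_def field_simps)
    finally show ?case using 1 2 by (simp add: algebra_simps)
  qed
  also have "\<dots> \<le> CM M * qq ^ k" using CM(1)[OF M0] qq by (intro mult_left_mono) auto
  finally show ?thesis .
qed

section \<open>Traces on K\<close>

definition "ray \<xi> = (SOME ys. geo_ray N S \<rho> K \<xi> ys)"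
definition "tr f \<xi> = (if \<xi> \<in> K then lim (\<lambda>n. f (ray \<xi> n)) else 0)" for f :: "nat list \<Rightarrow> real"

lemma geo_ray_prefix:
  assumes "geo_ray N S \<rho> K \<xi> ys" "m \<le> n" shows "prefix (ys m) (ys n)"
  using assms(2)
proof (induction n rule: dec_induct)
  case (step n)
  then show ?case using assms(1) unfolding geo_ray_def by (meson prefix_order.trans)
qed simp

lemma ray: "\<xi> \<in> K \<Longrightarrow> geo_ray N S \<rho> K \<xi> (ray \<xi>)"
  unfolding ray_def by (rule someI_ex[OF geo_ray_ex])

lemma ray_J: "\<xi> \<in> K \<Longrightarrow> ray \<xi> n \<in> Jn n" "\<xi> \<in> K \<Longrightarrow> \<xi> \<in> Kw (ray \<xi> n)"
  using ray[of \<xi>] by (auto simp: geo_ray_def)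

lemma touching:
  assumes "y \<in> Jn n" "y' \<in> Jn n" "\<xi> \<in> Kw y" "\<eta> \<in> Kw y'" "dist \<xi> \<eta> \<le> \<gamma> * r ^ n" "En n f \<le> M"
  shows "\<bar>f y - f y'\<bar> \<le> CM M * qq ^ n"
proof -
  have M0: "0 \<le> M" using En_nonneg[of n f] assms(6) by linarith
  show ?thesis
  proof (cases "y = y'")
    case True
    then show ?thesis using CM(1)[OF M0] qq by simp
  next
    case False
    have "gap S K y y' \<le> \<gamma> * r ^ n" using gap_le[OF assms(3,4)] assms(5) by linarith
    then have "y' \<in> hn y" using hn_iff[OF assms(1)] assms(2) False by auto
    then have "\<bar>f y - f y'\<bar> \<le> sqrt (M / a) * qq ^ n" using hor_decay[OF assms(6,1)] by simp
    also have "\<dots> \<le> CM M * qq ^ n" using CM(2)[OF M0] qq by (intro mult_right_mono) auto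
    finally show ?thesis .
  qed
qed

lemma small_qq: "e > 0 \<Longrightarrow> \<exists>n0. \<forall>n\<ge>n0. C * qq ^ n < e"
proof -
  assume e: "e > 0"
  have "(\<lambda>n. C * qq ^ n) \<longlonglongrightarrow> C * 0" using qq by (intro tendsto_intros LIMSEQ_power_zero) auto
  then have "eventually (\<lambda>n. C * qq ^ n < e) sequentially" using e by (intro order_tendstoD) auto
  then show ?thesis by (simp add: eventually_sequentially)
qed

text \<open>One \<open>CM M\<close> accounts for the rest of the ray below level n, the other for
  the step from y to the vertex of the ray on level n, whose cell also contains \<xi>. So the trace
  does not depend on the ray.\<close>

lemma tr_bound:
  assumes f: "fin M f" and y: "y \<in> Jn n" "\<xi> \<in> Kw y"
  shows "\<bar>f y - tr f \<xi>\<bar> \<le> 2 * CM M * qq ^ n"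
proof -
  have M0: "0 \<le> M" using fin_nonneg[OF f] .
  have \<xi>: "\<xi> \<in> K" using Kw_subset[OF J_W[OF y(1)]] y(2) by blast
  have step: "\<bar>f (ray \<xi> k) - f (ray \<xi> l)\<bar> \<le> CM M * qq ^ k" if "k \<le> l" for k l
    by (rule prefix_decay[of l]) (use f[unfolded fin_def] ray_J[OF \<xi>] that geo_ray_prefix[OF ray[OF \<xi>] that] in auto)
  have "Cauchy (\<lambda>k. f (ray \<xi> k))"
  proof (rule metric_CauchyI)
    fix e :: real assume "e > 0"
    then obtain n0 where n0: "\<forall>n\<ge>n0. CM M * qq ^ n < e / 2" using small_qq[of "e / 2"] by auto
    have "dist (f (ray \<xi> k)) (f (ray \<xi> l)) < e" if "k \<ge> n0" "l \<ge> n0" for k l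
      using step[OF that(1)] step[OF that(2)] n0[rule_format, of n0] unfolding dist_real_def by linarith
    then show "\<exists>m0. \<forall>m\<ge>m0. \<forall>n\<ge>m0. dist (f (ray \<xi> m)) (f (ray \<xi> n)) < e" by blast
  qed
  then have lim: "(\<lambda>k. f (ray \<xi> k)) \<longlonglongrightarrow> tr f \<xi>"
    using Cauchy_convergent convergent_LIMSEQ_iff \<xi> by (simp add: tr_def) blast
  have "\<bar>f (ray \<xi> n) - tr f \<xi>\<bar> \<le> CM M * qq ^ n"
    by (rule LIMSEQ_le_const2[OF tendsto_rabs[OF tendsto_diff[OF tendsto_const lim]]]) (use step in auto)
  moreover have "\<bar>f y - f (ray \<xi> n)\<bar> \<le> CM M * qq ^ n"
    by (rule touching[OF y(1) ray_J(1)[OF \<xi>] y(2) ray_J(2)[OF \<xi>]])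
       (use f gamma_pos r01 in \<open>auto simp: fin_def\<close>)
  ultimately show ?thesis by linarith
qed

lemma tr_bval: assumes f: "fin M f" shows "bval f (tr f)"
  unfolding bval_def
proof (intro allI impI)
  fix e :: real assume "e > 0"
  then obtain n0 where n0: "\<forall>n\<ge>n0. 2 * CM M * qq ^ n < e" using small_qq by blast
  show "\<exists>n0. \<forall>n\<ge>n0. \<forall>y\<in>Jn n. \<forall>\<xi>\<in>Kw y. \<bar>f y - tr f \<xi>\<bar> \<le> e"
  proof (intro exI[of _ n0] allI impI ballI)
    fix n y \<xi> assume "n \<ge> n0" "y \<in> Jn n" "\<xi> \<in> Kw y"
    then show "\<bar>f y - tr f \<xi>\<bar> \<le> e" using tr_bound[OF f, of y n \<xi>] n0[rule_format, of n] by linarith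
  qed
qed

lemma tr_cont: assumes f: "fin M f" shows "continuous_on K (tr f)"
  unfolding continuous_on_iff
proof (intro ballI allI impI)
  fix \<xi> e assume \<xi>: "\<xi> \<in> K" and e: "(e::real) > 0"
  \<comment> \<open>Two units for each trace and one for the horizontal step between the two
    rays.\<close>
  obtain n where n: "5 * CM M * qq ^ n < e" using small_qq[OF e, of "5 * CM M"] by blast
  have "dist (tr f \<eta>) (tr f \<xi>) < e" if \<eta>: "\<eta> \<in> K" "dist \<eta> \<xi> < \<gamma> * r ^ n" for \<eta>
  proof -
    have "\<bar>f (ray \<eta> n) - f (ray \<xi> n)\<bar> \<le> CM M * qq ^ n"
      using f by (intro touching[OF ray_J(1)[OF \<eta>(1)] ray_J(1)[OF \<xi>] ray_J(2)[OF \<eta>(1)] ray_J(2)[OF \<xi>] less_imp_le[OF \<eta>(2)]])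
        (simp add: fin_def)
    then show ?thesis using tr_bound[OF f ray_J(1)[OF \<eta>(1)] ray_J(2)[OF \<eta>(1)], of n]
      tr_bound[OF f ray_J(1)[OF \<xi>] ray_J(2)[OF \<xi>], of n] n unfolding dist_real_def by linarith
  qed
  then show "\<exists>d>0. \<forall>x'\<in>K. dist x' \<xi> < d \<longrightarrow> dist (tr f x') (tr f \<xi>) < e"
    using gamma_pos r01 by (intro exI[of _ "\<gamma> * r ^ n"]) auto
qed

lemma tr_measurable: "fin M f \<Longrightarrow> tr f \<in> borel_measurable borel"
  by (rule measurable_extend_K[OF tr_cont, of M f 0]) (auto simp: tr_def)

text \<open>With k = 0 this is uniqueness of boundary values; general k serves functions of equal
  gradient, as obtained from vanishing energy.\<close>

lemma bval_unique:
  assumes "bval f u" "bval g v" and fg: "\<And>x. x \<in> X \<Longrightarrow> f x = g x + k" and \<xi>: "\<xi> \<in> K"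
  shows "u \<xi> = v \<xi> + k"
proof (rule ccontr)
  assume "u \<xi> \<noteq> v \<xi> + k"
  define e where "e = \<bar>u \<xi> - (v \<xi> + k)\<bar> / 3"
  have e: "e > 0" using \<open>u \<xi> \<noteq> v \<xi> + k\<close> by (simp add: e_def)
  obtain n1 where n1: "\<forall>n\<ge>n1. \<forall>y\<in>Jn n. \<forall>\<xi>\<in>Kw y. \<bar>f y - u \<xi>\<bar> \<le> e" using assms(1) e unfolding bval_def by blast
  obtain n2 where n2: "\<forall>n\<ge>n2. \<forall>y\<in>Jn n. \<forall>\<xi>\<in>Kw y. \<bar>g y - v \<xi>\<bar> \<le> e" using assms(2) e unfolding bval_def by blast
  let ?n = "max n1 n2"
  have "\<bar>f (ray \<xi> ?n) - u \<xi>\<bar> \<le> e" using n1[rule_format, OF _ ray_J(1)[OF \<xi>] ray_J(2)[OF \<xi>]] by simp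
  moreover have "\<bar>g (ray \<xi> ?n) - v \<xi>\<bar> \<le> e" using n2[rule_format, OF _ ray_J(1)[OF \<xi>] ray_J(2)[OF \<xi>]] by simp
  moreover have "f (ray \<xi> ?n) = g (ray \<xi> ?n) + k" using fg J_X[OF ray_J(1)[OF \<xi>]] .
  moreover have "\<bar>u \<xi> - (v \<xi> + k)\<bar> = 3 * e" by (simp add: e_def)
  ultimately show False using e by linarith
qed

lemma energy_zero_const:
  assumes "\<And>n. En n f \<le> 0" "x \<in> X" shows "f x = f []"
proof (rule connected_to_root[OF _ _ assms(2)])
  show "f x = f []" if "x \<in> Jn 0" for x using that by (simp add: J.simps)
  fix n x assume x: "x \<in> Jn (Suc n)" and IH: "f (par x) = f []"
  have "\<bar>f (par x) - f x\<bar> \<le> sqrt (0 / a) * qq ^ Suc n" by (rule par_decay[OF assms(1) x order_refl])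
  then show "f x = f []" using IH by simp
qed

text \<open>The bilinear form, summed by parts so that g is paired with the Laplacian of f on
  \<open>XX n\<close>. For g supported at one vertex only a single term remains.\<close>

definition "En2 n f g = (\<Sum>y\<in>XX n. g y * (\<Sum>z\<in>XX n. c y z * (f y - f z)))"

lemma En2_eq: "En2 n f g = (\<Sum>y\<in>XX n. \<Sum>z\<in>XX n. c y z * (f y - f z) * (g y - g z)) / 2"
proof -
  have "(\<Sum>y\<in>XX n. \<Sum>z\<in>XX n. c y z * (f y - f z) * g z) = (\<Sum>y\<in>XX n. \<Sum>z\<in>XX n. c z y * (f z - f y) * g y)"
    by (rule sum.swap)
  also have "\<dots> = - En2 n f g"
    unfolding En2_def sum_distrib_left sum_negf[symmetric]
  proof (intro sum.cong refl)
    fix y z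
    show "c z y * (f z - f y) * g y = - (g y * (c y z * (f y - f z)))"
      using c_sym[of z y] by (simp add: algebra_simps)
  qed
  finally have 1: "(\<Sum>y\<in>XX n. \<Sum>z\<in>XX n. c y z * (f y - f z) * g z) = - En2 n f g" .
  have 2: "(\<Sum>y\<in>XX n. \<Sum>z\<in>XX n. c y z * (f y - f z) * g y) = En2 n f g"
    unfolding En2_def sum_distrib_left by (intro sum.cong refl) simp
  have "(\<Sum>y\<in>XX n. \<Sum>z\<in>XX n. c y z * (f y - f z) * (g y - g z))
      = (\<Sum>y\<in>XX n. \<Sum>z\<in>XX n. c y z * (f y - f z) * g y) - (\<Sum>y\<in>XX n. \<Sum>z\<in>XX n. c y z * (f y - f z) * g z)"
    unfolding sum_subtractf[symmetric] right_diff_distrib ..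
  then show ?thesis unfolding 1 2 by simp
qed

lemma En_add: "En n (\<lambda>x. f x + g x) = En n f + En n g + 2 * En2 n f g"
proof -
  have "(\<Sum>y\<in>XX n. \<Sum>z\<in>XX n. c y z * (f y + g y - (f z + g z))\<^sup>2) =
    (\<Sum>y\<in>XX n. \<Sum>z\<in>XX n. c y z * (f y - f z)\<^sup>2) + (\<Sum>y\<in>XX n. \<Sum>z\<in>XX n. c y z * (g y - g z)\<^sup>2)
      + 2 * (\<Sum>y\<in>XX n. \<Sum>z\<in>XX n. c y z * (f y - f z) * (g y - g z))"
    unfolding sum_distrib_left sum.distrib[symmetric]
    by (intro sum.cong refl) (simp add: power2_eq_square algebra_simps)
  then show ?thesis unfolding energyXn_def En2_eq by simp
qed

lemma En_scale: "En n (\<lambda>x. t * f x) = t\<^sup>2 * En n f"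
  unfolding energyXn_def by (simp add: right_diff_distrib[symmetric] power_mult_distrib sum_distrib_left mult.left_commute)

lemma parallelogram: "2 * En n (\<lambda>x. (f x + g x) / 2) + 2 * En n (\<lambda>x. (f x - g x) / 2) = En n f + En n g"
proof -
  have 1: "En n (\<lambda>x. (f x + g x) / 2) = (1 / 2)\<^sup>2 * En n (\<lambda>x. f x + g x)"
    unfolding En_scale[symmetric] by simp
  have 2: "En n (\<lambda>x. (f x - g x) / 2) = (1 / 2)\<^sup>2 * En n (\<lambda>x. f x + (- 1) * g x)"
    unfolding En_scale[symmetric] by simp
  have 3: "En2 n f (\<lambda>x. (- 1) * g x) = - En2 n f g"
    by (simp add: En2_def sum_negf)
  show ?thesis unfolding 1 2 En_add 3 En_scale by (simp add: power2_eq_square field_simps)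
qed

text \<open>One level below x is enough for \<open>XX n\<close> to contain all neighbours of x, so
  the truncated Laplacian at x is already the full one.\<close>

lemma En_perturb:
  assumes x: "x \<in> Jn k" and n: "Suc k \<le> n"
  shows "En n (\<lambda>y. f y + (if y = x then t else 0)) = En n f - 2 * t * Lap f x + t\<^sup>2 * mm x"
proof -
  let ?d = "\<lambda>y. if y = x then t else 0"
  have nbX: "nb x \<subseteq> XX n"
  proof
    fix z assume "z \<in> nb x"
    then consider "\<exists>m. k = Suc m \<and> z \<in> Jn m" | "z \<in> Jn (Suc k)" | "z \<in> Jn k"
      using nb_eq[OF x] ch_iff[OF x] hn_iff[OF x] par_J[of x] x by (cases k) auto
    then show "z \<in> XX n" using n by cases (auto intro: J_XX)
  qed
  have xX: "x \<in> XX n" using J_XX[OF x] n by simp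
  have xn: "x \<notin> nb x"
  proof
    assume "x \<in> nb x"
    then consider "\<exists>m. k = Suc m \<and> x \<in> Jn m" | "x \<in> Jn (Suc k)"
      using nb_eq[OF x] ch_iff[OF x] hn_iff[OF x] par_J[of x] x by (cases k) auto
    then show False using J_disj[OF x] by cases fastforce+
  qed
  have sum_nbX: "(\<Sum>z\<in>XX n. c x z * h z) = (\<Sum>z\<in>nb x. c x z * h z)" for h :: "nat list \<Rightarrow> real"
    using finite_XX nbX by (intro sum.mono_neutral_right) (auto simp: nbrs_def)
  have En2d: "En2 n g ?d = t * (\<Sum>z\<in>nb x. c x z * (g x - g z))" for g
  proof -
    have "En2 n g ?d = (\<Sum>y\<in>XX n. if y = x then t * (\<Sum>z\<in>XX n. c y z * (g y - g z)) else 0)"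
      unfolding En2_def by (intro sum.cong) auto
    also have "\<dots> = t * (\<Sum>z\<in>XX n. c x z * (g x - g z))" using xX finite_XX by (simp add: sum.delta)
    finally show ?thesis unfolding sum_nbX .
  qed
  have "En2 n f ?d = - t * Lap f x"
    unfolding En2d Lap_def by (simp add: sum_negf[symmetric] right_diff_distrib sum_subtractf)
  moreover have "En n ?d = En2 n ?d ?d"
    unfolding energyXn_def En2_eq by (simp add: power2_eq_square mult.assoc)
  moreover have "En2 n ?d ?d = t * (\<Sum>z\<in>nb x. c x z * t)"
    unfolding En2d using xn by (intro arg_cong2[of _ _ _ _ "(*)"] refl sum.cong) auto
  then have "En2 n ?d ?d = t\<^sup>2 * mm x" by (simp add: mm_def sum_distrib_right[symmetric] power2_eq_square)
  ultimately show ?thesis unfolding En_add by simp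
qed

section \<open>Capacities on finite levels\<close>

lemma clamp_diff: "\<bar>max 0 (min 1 x) - max 0 (min 1 y)\<bar> \<le> \<bar>x - y :: real\<bar>"
  by (auto simp: max_def min_def)

definition "bdry \<kappa> \<Phi> \<Psi> n f \<longleftrightarrow> (\<forall>x\<in>\<kappa> n ` \<Phi>. f x = 1) \<and> (\<forall>x\<in>\<kappa> n ` \<Psi>. f x = (0::real))"
  for \<kappa> :: "nat \<Rightarrow> 'a \<Rightarrow> nat list"

definition "capn \<kappa> \<Phi> \<Psi> n = (INF f \<in> {f. bdry \<kappa> \<Phi> \<Psi> n f}. En n f)"

text \<open>The limiting counterpart of \<open>bdry\<close>: values 1 and 0 are prescribed for the
  boundary values only, not at vertices of any level.\<close>

definition "inA \<Phi> \<Psi> f \<longleftrightarrow> (\<exists>u. bval f u \<and> (\<forall>\<xi>\<in>\<Phi>. u \<xi> = 1) \<and> (\<forall>\<xi>\<in>\<Psi>. u \<xi> = 0))"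

lemma capn_le: "bdry \<kappa> \<Phi> \<Psi> n f \<Longrightarrow> capn \<kappa> \<Phi> \<Psi> n \<le> En n f"
  unfolding capn_def by (rule cINF_lower) (auto intro!: bdd_belowI[of _ 0] En_nonneg)

lemma En_const: "En n (\<lambda>_. k) = 0" by (simp add: energyXn_def)

lemma effres_capn: "effres N S \<rho> K \<gamma> lam n (\<kappa> n ` \<Phi>) (\<kappa> n ` \<Psi>)
  = (if \<kappa> n ` \<Phi> \<inter> \<kappa> n ` \<Psi> \<noteq> {} then 0 else 1 / capn \<kappa> \<Phi> \<Psi> n)"
  unfolding effres_def capn_def bdry_def ..

text \<open>With an empty set the capacity is 0, hence the resistance is 1 / 0 = 0 by convention. A
  positive limiting resistance therefore excludes empty sets.\<close>

lemma capn_trivial: "\<Phi> = {} \<or> \<Psi> = {} \<Longrightarrow> capn \<kappa> \<Phi> \<Psi> n = 0"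
proof -
  assume "\<Phi> = {} \<or> \<Psi> = {}"
  then have "bdry \<kappa> \<Phi> \<Psi> n (\<lambda>_. 0) \<or> bdry \<kappa> \<Phi> \<Psi> n (\<lambda>_. 1)" by (auto simp: bdry_def)
  then have ex: "\<exists>k. bdry \<kappa> \<Phi> \<Psi> n (\<lambda>_. k)" by blast
  then have "capn \<kappa> \<Phi> \<Psi> n \<le> 0" using capn_le[of \<kappa> \<Phi> \<Psi> n] En_const by metis
  moreover have "0 \<le> capn \<kappa> \<Phi> \<Psi> n" unfolding capn_def using ex
    by (intro cINF_greatest) (auto intro: En_nonneg)
  ultimately show ?thesis by simp
qed

end

section \<open>Disjoint nonempty sets: convergence of capacities and minimizers\<close>

locale two_sets = nrw N S \<rho> K \<gamma> lam
  for N :: nat and S :: "nat \<Rightarrow> 'a::euclidean_space \<Rightarrow> 'a" and \<rho> :: "nat \<Rightarrow> real" and K :: "'a set" and \<gamma> lam :: real +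
  fixes \<Phi> \<Psi> :: "'a set" and \<kappa> :: "nat \<Rightarrow> 'a \<Rightarrow> nat list"
  assumes Phi: "closed \<Phi>" "\<Phi> \<subseteq> K" "\<Phi> \<noteq> {}" and Psi: "closed \<Psi>" "\<Psi> \<subseteq> K" "\<Psi> \<noteq> {}"
    and disj: "\<Phi> \<inter> \<Psi> = {}" and kappa: "kappa_seq N S \<rho> K \<kappa>"
begin

abbreviation "Cn \<equiv> capn \<kappa> \<Phi> \<Psi>"
abbreviation "bd \<equiv> bdry \<kappa> \<Phi> \<Psi>"

lemma kappa_J: "\<xi> \<in> K \<Longrightarrow> \<kappa> n \<xi> \<in> Jn n" "\<xi> \<in> K \<Longrightarrow> \<xi> \<in> Kw (\<kappa> n \<xi>)"
  using kappa by (auto simp: kappa_seq_def geo_ray_def)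

lemma kappa_prefix: "\<xi> \<in> K \<Longrightarrow> m \<le> n \<Longrightarrow> prefix (\<kappa> m \<xi>) (\<kappa> n \<xi>)"
  using geo_ray_prefix[of \<xi> "\<lambda>n. \<kappa> n \<xi>"] kappa by (simp add: kappa_seq_def)

lemma eventually_disj: "\<exists>n0. \<forall>n\<ge>n0. \<kappa> n ` \<Phi> \<inter> \<kappa> n ` \<Psi> = {}"
proof -
  have "compact \<Phi>" using compact_Int_closed[OF K_compact Phi(1)] Phi(2) by (simp add: Int_absorb1)
  then obtain d where d: "d > 0" "\<forall>\<xi>\<in>\<Phi>. \<forall>\<eta>\<in>\<Psi>. d \<le> dist \<xi> \<eta>"
    using separate_compact_closed[OF _ Psi(1) disj] by blast
  obtain n0 where n0: "r ^ n0 * dK \<le> d / 2" using ex_small_power[of "d / 2"] d by auto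
  have "\<kappa> n ` \<Phi> \<inter> \<kappa> n ` \<Psi> = {}" if n: "n \<ge> n0" for n
  proof (rule ccontr)
    assume "\<kappa> n ` \<Phi> \<inter> \<kappa> n ` \<Psi> \<noteq> {}"
    then obtain \<xi> \<eta> where e: "\<xi> \<in> \<Phi>" "\<eta> \<in> \<Psi>" "\<kappa> n \<xi> = \<kappa> n \<eta>" by auto
    have "\<xi> \<in> K" "\<eta> \<in> K" using e Phi Psi by auto
    then have "dist \<xi> \<eta> \<le> r ^ n * dK"
      using Kw_dist_J[OF kappa_J(1)[of \<xi> n] kappa_J(2)[of \<xi> n], of \<eta>] kappa_J(2)[of \<eta> n] e(3) by simp
    also have "\<dots> \<le> r ^ n0 * dK" using r_power_less(2)[OF n] dK_ge by (intro mult_right_mono)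
    finally have "dist \<xi> \<eta> < d" using n0 d(1) by linarith
    then show False using d(2) e by force
  qed
  then show ?thesis by blast
qed

definition "n0 = (SOME n0. \<forall>n\<ge>n0. \<kappa> n ` \<Phi> \<inter> \<kappa> n ` \<Psi> = {})"

lemma n0: "n \<ge> n0 \<Longrightarrow> \<kappa> n ` \<Phi> \<inter> \<kappa> n ` \<Psi> = {}"
  using someI_ex[OF eventually_disj] unfolding n0_def by blast

lemma bd_ex: "n \<ge> n0 \<Longrightarrow> \<exists>f. bd n f"
proof -
  assume "n \<ge> n0"
  then have "bd n (\<lambda>x. if x \<in> \<kappa> n ` \<Phi> then 1 else 0)" using n0[of n] unfolding bdry_def by (auto simp: disjoint_iff)
  then show ?thesis by blast
qed

lemma Cn_nonneg: "n \<ge> n0 \<Longrightarrow> 0 \<le> Cn n"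
  unfolding capn_def using bd_ex by (intro cINF_greatest) (auto intro: En_nonneg)

text \<open>Clamping to [0,1] does not increase energy and supplies the compactness for extracting
  pointwise limits.\<close>

lemma capn_near_minimizer:
  assumes "n \<ge> n0" "e > 0"
  shows "\<exists>f. bd n f \<and> En n f < Cn n + e \<and> (\<forall>x. 0 \<le> f x \<and> f x \<le> 1)"
proof -
  have "\<exists>f\<in>{f. bd n f}. En n f < Cn n + e"
  proof (subst cINF_less_iff[symmetric])
    show "{f. bd n f} \<noteq> {}" using bd_ex[OF assms(1)] by simp
    show "bdd_below (En n ` {f. bd n f})" by (auto intro!: bdd_belowI[of _ 0] En_nonneg)
    show "(INF f\<in>{f. bd n f}. En n f) < Cn n + e" using assms(2) unfolding capn_def by simp
  qed
  then obtain f where f: "bd n f" "En n f < Cn n + e" by auto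
  let ?g = "\<lambda>x. max 0 (min 1 (f x))"
  have "En n ?g \<le> 1\<^sup>2 * En n f" using clamp_diff by (intro En_le) auto
  then have "En n ?g < Cn n + e" using f by simp
  moreover have "bd n ?g" using f(1) by (auto simp: bdry_def)
  ultimately show ?thesis by (intro exI[of _ ?g]) auto
qed

text \<open>On level n the function g is only within d of its boundary values. Stretching [d, 1 - d]
  to [0,1] and clamping makes them exact and multiplies the energy by at most (1 / (1 -
  2d))^2.\<close>

lemma capn_eventually_less:
  assumes g: "inA \<Phi> \<Psi> g" "fin M g" and e: "e > 0"
  shows "\<exists>m. \<forall>n\<ge>m. Cn n < M + e"
proof -
  have M0: "0 \<le> M" using fin_nonneg[OF g(2)] .
  obtain u where u: "bval g u" "\<forall>\<xi>\<in>\<Phi>. u \<xi> = 1" "\<forall>\<xi>\<in>\<Psi>. u \<xi> = 0" using g(1) by (auto simp: inA_def)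
  have "((\<lambda>d. (1 / (1 - 2 * d))\<^sup>2 * M) \<longlongrightarrow> (1 / (1 - 2 * 0))\<^sup>2 * M) (at_right 0)"
    by (intro tendsto_intros) auto
  then have "eventually (\<lambda>d. (1 / (1 - 2 * d))\<^sup>2 * M < M + e) (at_right 0)"
    using e by (intro order_tendstoD) auto
  moreover have "eventually (\<lambda>x::real. 0 < x \<and> x < 1/2) (at_right 0)"
    by (auto simp: eventually_at_right_field intro!: exI[of _ "1/2"])
  ultimately have "eventually (\<lambda>d. (1 / (1 - 2 * d))\<^sup>2 * M < M + e \<and> 0 < d \<and> d < 1/2) (at_right 0)"
    by eventually_elim auto
  then obtain d where d: "(1 / (1 - 2 * d))\<^sup>2 * M < M + e" "0 < d" "d < 1/2"
    using eventually_happens[of _ "at_right (0::real)"] by (auto simp: trivial_limit_at_right_real)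
  obtain m where m: "\<forall>n\<ge>m. \<forall>y\<in>Jn n. \<forall>\<xi>\<in>Kw y. \<bar>g y - u \<xi>\<bar> \<le> d" using u(1) d(2) unfolding bval_def by blast
  let ?t = "1 / (1 - 2 * d)"
  let ?h = "\<lambda>x. max 0 (min 1 (?t * (g x - d)))"
  have t: "?t > 0" using d by simp
  have "Cn n < M + e" if n: "n \<ge> m" for n
  proof -
    have near: "\<bar>g (\<kappa> n \<xi>) - u \<xi>\<bar> \<le> d" if "\<xi> \<in> K" for \<xi>
      using m[rule_format, OF n kappa_J(1)[OF that] kappa_J(2)[OF that]] .
    have "?h (\<kappa> n \<xi>) = 1" if "\<xi> \<in> \<Phi>" for \<xi>
    proof -
      have "1 - d \<le> g (\<kappa> n \<xi>)" using near[of \<xi>] u(2) that Phi(2) by fastforce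
      then have "1 \<le> ?t * (g (\<kappa> n \<xi>) - d)" using d by (simp add: field_simps)
      then show ?thesis by simp
    qed
    moreover have "?h (\<kappa> n \<xi>) = 0" if "\<xi> \<in> \<Psi>" for \<xi>
    proof -
      have "g (\<kappa> n \<xi>) \<le> d" using near[of \<xi>] u(3) that Psi(2) by fastforce
      then have "?t * (g (\<kappa> n \<xi>) - d) \<le> 0" using t by (intro mult_nonneg_nonpos) auto
      then show ?thesis by simp
    qed
    ultimately have "bd n ?h" by (auto simp: bdry_def)
    then have "Cn n \<le> En n ?h" by (rule capn_le)
    also have "\<dots> \<le> ?t\<^sup>2 * En n g"
    proof (rule En_le)
      fix x y
      have "\<bar>?h x - ?h y\<bar> \<le> \<bar>?t * (g x - d) - ?t * (g y - d)\<bar>" by (rule clamp_diff)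
      also have "\<dots> = ?t * \<bar>g x - g y\<bar>" using t by (simp add: abs_mult flip: right_diff_distrib diff_divide_distrib)
      finally show "\<bar>?h x - ?h y\<bar> \<le> ?t * \<bar>g x - g y\<bar>" .
    qed (use t in simp)
    also have "\<dots> \<le> ?t\<^sup>2 * M" using g(2) by (intro mult_left_mono) (auto simp: fin_def)
    finally show ?thesis using d(1) by linarith
  qed
  then show ?thesis by blast
qed

lemma pointwise_subseq:
  fixes F :: "nat \<Rightarrow> nat list \<Rightarrow> real"
  assumes F: "\<And>k x. 0 \<le> F k x \<and> F k x \<le> 1"
  shows "\<exists>t f. strict_mono (t :: nat \<Rightarrow> nat) \<and> (\<forall>x. (\<lambda>k. F (t k) x) \<longlonglongrightarrow> f x)"
proof -
  define e where "e = (from_nat :: nat \<Rightarrow> nat list)"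
  interpret subseqs "\<lambda>n s. convergent (\<lambda>k. F (s k) (e n))"
  proof
    fix n and s :: "nat \<Rightarrow> nat" assume "strict_mono s"
    have "\<forall>k. F (s k) (e n) \<in> {0..1}" using F by simp
    then obtain l r' where "strict_mono r'" "((\<lambda>k. F (s k) (e n)) \<circ> r') \<longlonglongrightarrow> l"
      using compact_Icc[of "0::real" 1, unfolded compact_def, rule_format] by metis
    then show "\<exists>r'. strict_mono r' \<and> convergent (\<lambda>k. F ((s \<circ> r') k) (e n))"
      by (auto simp: o_def convergent_def)
  qed
  have conv: "convergent (\<lambda>k. F (diagseq k) (e n))" for n
  proof -
    have "convergent (\<lambda>k. F ((diagseq \<circ> ((+) (Suc n))) k) (e n))"
    proof (rule diagseq_holds)
      fix x s and r' :: "nat \<Rightarrow> nat" assume "convergent (\<lambda>k. F (s k) (e x))" "strict_mono r'"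
      then show "convergent (\<lambda>k. F ((s \<circ> r') k) (e x))"
        using convergent_subseq_convergent[of "\<lambda>k. F (s k) (e x)" r'] by (simp add: o_def)
    qed
    then show ?thesis
      using convergent_ignore_initial_segment[of "\<lambda>k. F (diagseq k) (e n)" "Suc n"]
      by (simp add: o_def add.commute)
  qed
  have "convergent (\<lambda>k. F (diagseq k) x)" for x
    using conv[of "to_nat x"] by (simp add: e_def)
  then have "\<forall>x. (\<lambda>k. F (diagseq k) x) \<longlonglongrightarrow> lim (\<lambda>k. F (diagseq k) x)"
    by (simp add: convergent_LIMSEQ_iff)
  then show ?thesis using subseq_diagseq
    by (intro exI[of _ diagseq] exI[of _ "\<lambda>x. lim (\<lambda>k. F (diagseq k) x)"] conjI)
qed

text \<open>The energy on a fixed \<open>XX n\<close> is a finite sum and passes to pointwise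
  limits. The boundary condition survives because \<open>prefix_decay\<close> links level m to the
  level where F takes the value 1 or 0, with an error of order \<open>qq ^ m\<close> that does not
  depend on k.\<close>

lemma capn_limit_attained:
  assumes s: "strict_mono (s :: nat \<Rightarrow> nat)" and L: "(\<lambda>k. Cn (s k)) \<longlonglongrightarrow> L"
  shows "\<exists>f. fin L f \<and> inA \<Phi> \<Psi> f"
proof -
  \<comment> \<open>The shift keeps all levels at or above \<open>n0\<close>, where the images of
    the two sets are disjoint and competitors exist.\<close>
  define s' where "s' k = s (k + n0)" for k
  have s'ge: "s' k \<ge> n0" "s' k \<ge> k" for k
    using seq_suble[OF s, of "k + n0"] by (auto simp: s'_def)
  have L': "(\<lambda>k. Cn (s' k)) \<longlonglongrightarrow> L" unfolding s'_def using LIMSEQ_ignore_initial_segment[OF L] .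
  have "\<forall>k. \<exists>f. bd (s' k) f \<and> En (s' k) f < Cn (s' k) + 1 / (real k + 1) \<and> (\<forall>x. 0 \<le> f x \<and> f x \<le> 1)"
    using capn_near_minimizer s'ge(1) by simp
  then obtain F where F: "\<And>k. bd (s' k) (F k)" "\<And>k. En (s' k) (F k) < Cn (s' k) + 1 / (real k + 1)"
    "\<And>k x. 0 \<le> F k x \<and> F k x \<le> 1" by metis
  obtain t f where t: "strict_mono t" and lim: "\<And>x. (\<lambda>k. F (t k) x) \<longlonglongrightarrow> f x"
    using pointwise_subseq[of F] F(3) by blast
  have tge: "t k \<ge> k" for k using seq_suble[OF t] .
  have Elim: "(\<lambda>k. En n (F (t k))) \<longlonglongrightarrow> En n f" for n
    unfolding energyXn_def by (intro tendsto_intros lim) auto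
  have "(\<lambda>k. Cn (s' k) + 1 / (real k + 1)) \<longlonglongrightarrow> L + 0"
    using LIMSEQ_inverse_real_of_nat by (intro tendsto_add L') (simp add: field_simps add.commute)
  then have B: "(\<lambda>k. Cn (s' (t k)) + 1 / (real (t k) + 1)) \<longlonglongrightarrow> L"
    using LIMSEQ_subseq_LIMSEQ[OF _ t] by (fastforce simp: o_def)
  have le: "En n (F (t k)) \<le> Cn (s' (t k)) + 1 / (real (t k) + 1)" if "k \<ge> n" for n k
  proof -
    have "n \<le> s' (t k)" using that tge[of k] s'ge(2)[of "t k"] by linarith
    then have "En n (F (t k)) \<le> En (s' (t k)) (F (t k))" by (rule En_mono)
    then show ?thesis using F(2)[of "t k"] by linarith
  qed
  have fin: "fin L f"
    unfolding fin_def
  proof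
    fix n
    show "En n f \<le> L" by (rule LIMSEQ_le[OF Elim B]) (use le in blast)
  qed
  \<comment> \<open>An energy bound for all k; the bound L holds only in the limit.\<close>
  obtain Mb where Mb: "\<And>k. Cn (s' (t k)) + 1 / (real (t k) + 1) \<le> Mb"
    using Bseq_eq_bounded[of "\<lambda>k. Cn (s' (t k)) + 1 / (real (t k) + 1)"] convergent_imp_Bseq[OF convergentI[OF B]]
    unfolding Bseq_def by (metis abs_le_D1 real_norm_def)
  have near: "\<bar>f (\<kappa> m \<xi>) - v\<bar> \<le> CM Mb * qq ^ m" if v: "\<And>k. F (t k) (\<kappa> (s' (t k)) \<xi>) = v" and \<xi>: "\<xi> \<in> K" for m \<xi> v
  proof (rule LIMSEQ_le_const2)
    show "(\<lambda>k. \<bar>F (t k) (\<kappa> m \<xi>) - v\<bar>) \<longlonglongrightarrow> \<bar>f (\<kappa> m \<xi>) - v\<bar>" by (intro tendsto_intros lim)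
    show "\<exists>N. \<forall>k\<ge>N. \<bar>F (t k) (\<kappa> m \<xi>) - v\<bar> \<le> CM Mb * qq ^ m"
    proof (intro exI[of _ m] allI impI)
      fix k assume k: "m \<le> k"
      have mk: "m \<le> s' (t k)" using k tge[of k] s'ge(2)[of "t k"] by linarith
      have "En (s' (t k)) (F (t k)) \<le> Mb" using F(2)[of "t k"] Mb[of k] by linarith
      then have "\<bar>F (t k) (\<kappa> m \<xi>) - F (t k) (\<kappa> (s' (t k)) \<xi>)\<bar> \<le> CM Mb * qq ^ m"
        by (rule prefix_decay[OF _ kappa_J(1)[OF \<xi>] order_refl kappa_J(1)[OF \<xi>] kappa_prefix[OF \<xi> mk] mk])
      then show "\<bar>F (t k) (\<kappa> m \<xi>) - v\<bar> \<le> CM Mb * qq ^ m" unfolding v .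
    qed
  qed
  have trv: "tr f \<xi> = v" if v: "\<And>k. F (t k) (\<kappa> (s' (t k)) \<xi>) = v" and \<xi>: "\<xi> \<in> K" for \<xi> v
  proof (rule ccontr)
    assume "tr f \<xi> \<noteq> v"
    then have "\<bar>tr f \<xi> - v\<bar> > 0" by simp
    then obtain m where "(2 * CM L + CM Mb) * qq ^ m < \<bar>tr f \<xi> - v\<bar>"
      using small_qq[of "\<bar>tr f \<xi> - v\<bar>" "2 * CM L + CM Mb"] by blast
    moreover have "\<bar>f (\<kappa> m \<xi>) - v\<bar> \<le> CM Mb * qq ^ m" using near[OF v \<xi>] .
    moreover have "\<bar>f (\<kappa> m \<xi>) - tr f \<xi>\<bar> \<le> 2 * CM L * qq ^ m" using tr_bound[OF fin kappa_J(1)[OF \<xi>] kappa_J(2)[OF \<xi>]] .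
    ultimately show False unfolding distrib_right by linarith
  qed
  have "tr f \<xi> = 1" if "\<xi> \<in> \<Phi>" for \<xi> using trv[of \<xi> 1] F(1) that Phi(2) by (auto simp: bdry_def)
  moreover have "tr f \<xi> = 0" if "\<xi> \<in> \<Psi>" for \<xi> using trv[of \<xi> 0] F(1) that Psi(2) by (auto simp: bdry_def)
  ultimately have "inA \<Phi> \<Psi> f" using tr_bval[OF fin] unfolding inA_def by blast
  then show ?thesis using fin by blast
qed

lemma capn_convergent_subseq:
  assumes "infinite {n. Cn n \<le> M}"
  shows "\<exists>s L. strict_mono (s :: nat \<Rightarrow> nat) \<and> (\<lambda>k. Cn (s k)) \<longlonglongrightarrow> L \<and> L \<le> M"
proof -
  define A where "A = {n. Cn n \<le> M \<and> n \<ge> n0}"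
  have "{n. Cn n \<le> M} \<subseteq> A \<union> {..<n0}" by (auto simp: A_def)
  then have "infinite A" using assms by (meson finite_UnI finite_lessThan finite_subset)
  then have e: "strict_mono (enumerate A)" "\<And>k. enumerate A k \<in> A"
    by (auto intro: strict_mono_enumerate enumerate_in_set)
  have "\<forall>k. Cn (enumerate A k) \<in> {0..M}" using e(2) Cn_nonneg by (auto simp: A_def)
  then obtain l r' where r': "l \<in> {0..M}" "strict_mono r'" "((\<lambda>k. Cn (enumerate A k)) \<circ> r') \<longlonglongrightarrow> l"
    using compact_Icc[of 0 M, unfolded compact_def, rule_format] by metis
  have "strict_mono (enumerate A \<circ> r')" using e(1) r'(2) by (rule strict_mono_o)
  then show ?thesis using r' by (intro exI[of _ "enumerate A \<circ> r'"] exI[of _ l]) (auto simp: o_def)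
qed

text \<open>If the capacities fell below L - e infinitely often, a second limit L' would be attained
  by some function, which would push all late capacities below L' + e / 2, and L with them. The
  upper bound comes from the function attaining L.\<close>

lemma capn_tendsto:
  assumes s: "strict_mono (s :: nat \<Rightarrow> nat)" "(\<lambda>k. Cn (s k)) \<longlonglongrightarrow> L"
  shows "Cn \<longlonglongrightarrow> L"
proof (rule metric_LIMSEQ_I)
  fix e :: real assume e: "e > 0"
  obtain f where f: "fin L f" "inA \<Phi> \<Psi> f" using capn_limit_attained[OF s] by blast
  obtain m where m: "\<forall>n\<ge>m. Cn n < L + e" using capn_eventually_less[OF f(2,1) e] by blast
  have "finite {n. Cn n \<le> L - e}"
  proof (rule ccontr)
    assume "infinite {n. Cn n \<le> L - e}"
    then obtain s' L' where s': "strict_mono (s' :: nat \<Rightarrow> nat)" "(\<lambda>k. Cn (s' k)) \<longlonglongrightarrow> L'" "L' \<le> L - e"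
      using capn_convergent_subseq by blast
    obtain f' where f': "fin L' f'" "inA \<Phi> \<Psi> f'" using capn_limit_attained[OF s'(1,2)] by blast
    obtain m' where m': "\<forall>n\<ge>m'. Cn n < L' + e / 2" using capn_eventually_less[OF f'(2,1), of "e / 2"] e by auto
    have "L \<le> L' + e / 2"
    proof (rule LIMSEQ_le_const2[OF s(2)], intro exI[of _ m'] allI impI)
      fix k assume "m' \<le> k"
      then have "m' \<le> s k" using seq_suble[OF s(1), of k] by linarith
      then show "Cn (s k) \<le> L' + e / 2" using m' by (simp add: less_imp_le)
    qed
    then show False using s'(3) e by linarith
  qed
  then obtain m2 where m2: "\<forall>n\<in>{n. Cn n \<le> L - e}. n < m2" using finite_nat_set_iff_bounded by blast
  have "dist (Cn n) L < e" if "n \<ge> max m m2" for n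
  proof -
    have "Cn n < L + e" using m that by simp
    moreover have "\<not> Cn n \<le> L - e" using m2 that by fastforce
    ultimately show ?thesis unfolding dist_real_def by linarith
  qed
  then show "\<exists>no. \<forall>n\<ge>no. dist (Cn n) L < e" by blast
qed

lemma capn_limit_le:
  assumes L: "Cn \<longlonglongrightarrow> L" and g: "inA \<Phi> \<Psi> g" "fin M g" shows "L \<le> M"
proof (rule field_le_epsilon)
  fix e :: real assume "e > 0"
  then obtain m where "\<forall>n\<ge>m. Cn n < M + e" using capn_eventually_less[OF g] by blast
  then show "L \<le> M + e" by (intro LIMSEQ_le_const2[OF L]) (auto intro!: exI[of _ m] less_imp_le)
qed

text \<open>Energy 0 forces a constant function, whose boundary values cannot be 1 on one set and 0
  on the other.\<close>

lemma capn_limit_pos: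
  assumes f: "fin L f" "inA \<Phi> \<Psi> f" shows "L > 0"
proof (rule ccontr)
  assume "\<not> L > 0"
  then have "En n f \<le> 0" for n using f(1) unfolding fin_def by (meson linorder_not_less order_trans)
  then have const: "f x = 0 + f []" if "x \<in> X" for x using energy_zero_const[of f x] that by simp
  obtain u where u: "bval f u" "\<forall>\<xi>\<in>\<Phi>. u \<xi> = 1" "\<forall>\<xi>\<in>\<Psi>. u \<xi> = 0" using f(2) by (auto simp: inA_def)
  obtain \<xi> \<eta> where e: "\<xi> \<in> \<Phi>" "\<eta> \<in> \<Psi>" using Phi(3) Psi(3) by blast
  have "bval (\<lambda>_. 0) (\<lambda>_. 0)" by (auto simp: bval_def)
  from bval_unique[OF u(1) this const] have "u \<xi> = 0 + f []" "u \<eta> = 0 + f []" using e Phi(2) Psi(2) by blast+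
  then show False using u e by simp
qed

text \<open>A change at one vertex leaves the boundary values untouched, so minimality makes a
  quadratic polynomial in t nonnegative.\<close>

lemma minimizer_harmonic:
  assumes L: "Cn \<longlonglongrightarrow> L" and f: "fin L f" "inA \<Phi> \<Psi> f" and x: "x \<in> X"
  shows "Lap f x = 0"
proof -
  let ?k = "lv x"
  have q: "0 \<le> - 2 * t * Lap f x + t\<^sup>2 * mm x" for t
  proof -
    let ?g = "\<lambda>y. f y + (if y = x then t else 0)"
    have "fin (L - 2 * t * Lap f x + t\<^sup>2 * mm x) ?g"
      unfolding fin_def
    proof
      fix n
      have "En n ?g \<le> En (max n (Suc ?k)) ?g" by (rule En_mono) simp
      also have "\<dots> = En (max n (Suc ?k)) f - 2 * t * Lap f x + t\<^sup>2 * mm x"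
        by (rule En_perturb[OF X_J[OF x]]) simp
      also have "\<dots> \<le> L - 2 * t * Lap f x + t\<^sup>2 * mm x" using f(1) unfolding fin_def by simp
      finally show "En n ?g \<le> \<dots>" .
    qed
    moreover have "inA \<Phi> \<Psi> ?g"
    proof -
      obtain u where u: "bval f u" "\<forall>\<xi>\<in>\<Phi>. u \<xi> = 1" "\<forall>\<xi>\<in>\<Psi>. u \<xi> = 0" using f(2) by (auto simp: inA_def)
      have "bval ?g u"
        unfolding bval_def
      proof (intro allI impI)
        fix e :: real assume "e > 0"
        then obtain m where m: "\<forall>n\<ge>m. \<forall>y\<in>Jn n. \<forall>\<xi>\<in>Kw y. \<bar>f y - u \<xi>\<bar> \<le> e" using u(1) unfolding bval_def by blast
        show "\<exists>n0. \<forall>n\<ge>n0. \<forall>y\<in>Jn n. \<forall>\<xi>\<in>Kw y. \<bar>?g y - u \<xi>\<bar> \<le> e"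
        proof (intro exI[of _ "max m (Suc ?k)"] allI impI ballI)
          fix n y \<xi> assume y: "max m (Suc ?k) \<le> n" "y \<in> Jn n" "\<xi> \<in> Kw y"
          then have "y \<noteq> x" using lev_eq[OF y(2)] by auto
          then show "\<bar>?g y - u \<xi>\<bar> \<le> e" using m[rule_format, OF _ y(2,3)] y(1) by simp
        qed
      qed
      then show ?thesis using u(2,3) unfolding inA_def by blast
    qed
    ultimately have "L \<le> L - 2 * t * Lap f x + t\<^sup>2 * mm x" using capn_limit_le[OF L] by blast
    then show ?thesis by simp
  qed
  have mp: "mm x > 0" using mm_pos[OF x] .
  have "0 \<le> - ((Lap f x)\<^sup>2 / mm x)"
  proof -
    \<comment> \<open>This t is where the parabola is lowest.\<close>
    have "- 2 * (Lap f x / mm x) * Lap f x + (Lap f x / mm x)\<^sup>2 * mm x = - ((Lap f x)\<^sup>2 / mm x)"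
      using mp by (simp add: power2_eq_square field_simps)
    then show ?thesis using q[of "Lap f x / mm x"] by simp
  qed
  then have "(Lap f x)\<^sup>2 / mm x \<le> 0" by simp
  then have "(Lap f x)\<^sup>2 \<le> 0" using mp by (simp add: divide_le_0_iff)
  then show ?thesis by simp
qed

text \<open>The midpoint is a competitor, so the half difference has energy 0 and f - g is constant;
  the common value 1 on \<Phi> makes the constant 0.\<close>

lemma minimizer_unique:
  assumes L: "Cn \<longlonglongrightarrow> L" and f: "fin L f" "bval f u" "\<forall>\<xi>\<in>\<Phi>. u \<xi> = 1" "\<forall>\<xi>\<in>\<Psi>. u \<xi> = 0"
    and g: "fin L g" "bval g v" "\<forall>\<xi>\<in>\<Phi>. v \<xi> = 1" "\<forall>\<xi>\<in>\<Psi>. v \<xi> = 0" and \<xi>: "\<xi> \<in> K"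
  shows "u \<xi> = v \<xi>"
proof -
  let ?h = "\<lambda>x. (f x + g x) / 2" and ?d = "\<lambda>x. (f x - g x) / 2"
  have "bval ?h (\<lambda>\<xi>. (u \<xi> + v \<xi>) / 2)"
    unfolding bval_def
  proof (intro allI impI)
    fix e :: real assume e: "e > 0"
    obtain m1 where m1: "\<forall>n\<ge>m1. \<forall>y\<in>Jn n. \<forall>\<xi>\<in>Kw y. \<bar>f y - u \<xi>\<bar> \<le> e" using f(2) e unfolding bval_def by blast
    obtain m2 where m2: "\<forall>n\<ge>m2. \<forall>y\<in>Jn n. \<forall>\<xi>\<in>Kw y. \<bar>g y - v \<xi>\<bar> \<le> e" using g(2) e unfolding bval_def by blast
    show "\<exists>n0. \<forall>n\<ge>n0. \<forall>y\<in>Jn n. \<forall>\<xi>\<in>Kw y. \<bar>?h y - (u \<xi> + v \<xi>) / 2\<bar> \<le> e"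
    proof (intro exI[of _ "max m1 m2"] allI impI ballI)
      fix n y \<xi> assume y: "max m1 m2 \<le> n" "y \<in> Jn n" "\<xi> \<in> Kw y"
      have "\<bar>f y - u \<xi>\<bar> \<le> e" using m1[rule_format, OF _ y(2,3)] y(1) by simp
      moreover have "\<bar>g y - v \<xi>\<bar> \<le> e" using m2[rule_format, OF _ y(2,3)] y(1) by simp
      ultimately have "\<bar>(f y - u \<xi>) + (g y - v \<xi>)\<bar> \<le> 2 * e" by linarith
      moreover have "?h y - (u \<xi> + v \<xi>) / 2 = ((f y - u \<xi>) + (g y - v \<xi>)) / 2" by (simp add: field_simps)
      ultimately show "\<bar>?h y - (u \<xi> + v \<xi>) / 2\<bar> \<le> e" by (simp only: abs_divide) simp
    qed
  qed
  then have hA: "inA \<Phi> \<Psi> ?h" unfolding inA_def using f(3,4) g(3,4) by fastforce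
  have d0: "En n ?d \<le> 0" for n
  proof -
    have "fin (L - En n ?d) ?h"
      unfolding fin_def
    proof
      fix k
      have "En k ?h \<le> En (max k n) ?h" "En n ?d \<le> En (max k n) ?d" by (auto intro: En_mono)
      moreover have "En (max k n) f \<le> L" "En (max k n) g \<le> L" using f(1) g(1) by (auto simp: fin_def)
      ultimately show "En k ?h \<le> L - En n ?d" using parallelogram[of "max k n" f g] by linarith
    qed
    then have "L \<le> L - En n ?d" using capn_limit_le[OF L hA] by blast
    then show ?thesis by simp
  qed
  have fg: "f x = g x + (f [] - g [])" if "x \<in> X" for x
    using energy_zero_const[of ?d x] d0 that by simp
  obtain \<eta> where \<eta>: "\<eta> \<in> \<Phi>" using Phi(3) by blast
  then have "u \<eta> = v \<eta> + (f [] - g [])" using bval_unique[OF f(2) g(2) fg] Phi(2) by blast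
  then have "f [] - g [] = 0" using f(3) g(3) \<eta> by simp
  then show ?thesis using bval_unique[OF f(2) g(2) fg \<xi>] by simp
qed

text \<open>\<open>lim\<close> alone says nothing about convergence. If the capacities exceeded
  every bound eventually, the resistances would tend to 0, against positivity; so a bounded
  subsequence exists, and \<open>capn_tendsto\<close> applies.\<close>

lemma limiting_resistance_eq:
  assumes R: "lim (\<lambda>n. effres N S \<rho> K \<gamma> lam n (\<kappa> n ` \<Phi>) (\<kappa> n ` \<Psi>)) > 0" (is "lim ?R > 0")
  shows "\<exists>L f. Cn \<longlonglongrightarrow> L \<and> fin L f \<and> inA \<Phi> \<Psi> f \<and> L > 0 \<and> lim ?R = 1 / L"
proof -
  have Rn: "?R n = 1 / Cn n" if "n \<ge> n0" for n using n0[OF that] by (simp add: effres_capn)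
  have "\<exists>M. infinite {n. Cn n \<le> M}"
  proof (rule ccontr)
    assume "\<not> ?thesis"
    then have fin: "finite {n. Cn n \<le> M}" for M by blast
    have "?R \<longlonglongrightarrow> 0"
    proof (rule metric_LIMSEQ_I)
      fix e :: real assume e: "e > 0"
      obtain m where m: "\<forall>n\<in>{n. Cn n \<le> 1 / e}. n < m" using fin[of "1 / e"] finite_nat_set_iff_bounded by blast
      have "dist (?R n) 0 < e" if "n \<ge> max m n0" for n
      proof -
        have "1 / e < Cn n" using m[rule_format, of n] that by (cases "Cn n \<le> 1 / e") auto
        moreover have "0 < 1 / e" using e by simp
        ultimately have "0 < Cn n" by linarith
        moreover from this have "1 / Cn n < e" using \<open>1 / e < Cn n\<close> e by (simp add: field_simps)
        ultimately show ?thesis using Rn[of n] that by simp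
      qed
      then show "\<exists>no. \<forall>n\<ge>no. dist (?R n) 0 < e" by blast
    qed
    then have "lim ?R = 0" by (rule limI)
    then show False using R by simp
  qed
  then obtain s L where s: "strict_mono (s :: nat \<Rightarrow> nat)" "(\<lambda>k. Cn (s k)) \<longlonglongrightarrow> L" using capn_convergent_subseq by blast
  have L: "Cn \<longlonglongrightarrow> L" using capn_tendsto[OF s] .
  obtain f where f: "fin L f" "inA \<Phi> \<Psi> f" using capn_limit_attained[OF s] by blast
  have Lp: "L > 0" using capn_limit_pos[OF f] .
  have "(\<lambda>n. 1 / Cn n) \<longlonglongrightarrow> 1 / L" using Lp by (intro tendsto_intros L) simp
  then have "?R \<longlonglongrightarrow> 1 / L"
    by (rule Lim_transform_eventually) (use Rn in \<open>auto simp: eventually_sequentially intro!: exI[of _ n0]\<close>)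
  then have "lim ?R = 1 / L" by (rule limI)
  then show ?thesis using L f Lp by blast
qed

end

theorem theorem4p2:
  fixes N :: nat and S :: "nat \<Rightarrow> 'a::euclidean_space \<Rightarrow> 'a" and \<rho> :: "nat \<Rightarrow> real"
    and K :: "'a set" and \<gamma> lam :: real and \<Phi> \<Psi> :: "'a set"
  assumes "N \<ge> 2"
    and "\<forall>i\<in>{1..N}. 0 < \<rho> i \<and> \<rho> i < 1 \<and> similitude (S i) (\<rho> i)"
    and "osc N S"
    and "compact K" and "K \<noteq> {}" and "K = (\<Union>i\<in>{1..N}. S i ` K)"
    and "0 < \<gamma>"
    and "0 < lam" and "lam < rmin N \<rho> powr hausdorff_dim K"
    and "closed \<Phi>" and "\<Phi> \<subseteq> K" and "closed \<Psi>" and "\<Psi> \<subseteq> K"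
    and "Rlim N S \<rho> K \<gamma> lam \<Phi> \<Psi> > 0"
  shows "\<exists>u\<in>DK N S \<rho> K \<gamma> lam. admissible K \<Phi> \<Psi> u \<and>
           ennreal (1 / Rlim N S \<rho> K \<gamma> lam \<Phi> \<Psi>) = EK N S \<rho> K \<gamma> lam u \<and>
           EK N S \<rho> K \<gamma> lam u =
             (INF u'\<in>{u'\<in>DK N S \<rho> K \<gamma> lam. admissible K \<Phi> \<Psi> u'}. EK N S \<rho> K \<gamma> lam u') \<and>
           (\<forall>u'\<in>DK N S \<rho> K \<gamma> lam. admissible K \<Phi> \<Psi> u' \<and>
              EK N S \<rho> K \<gamma> lam u' = EK N S \<rho> K \<gamma> lam u \<longrightarrow> (\<forall>\<xi>\<in>K. u' \<xi> = u \<xi>))"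
proof -
  interpret nrw N S \<rho> K \<gamma> lam
    by unfold_locales (fact assms)+
  define \<kappa> where "\<kappa> = (SOME \<kappa>. kappa_seq N S \<rho> K \<kappa>)"
  let ?R = "\<lambda>n. effres N S \<rho> K \<gamma> lam n (\<kappa> n ` \<Phi>) (\<kappa> n ` \<Psi>)"
  have "kappa_seq N S \<rho> K (\<lambda>n \<xi>. ray \<xi> n)" using ray by (simp add: kappa_seq_def)
  then have kap: "kappa_seq N S \<rho> K \<kappa>" unfolding \<kappa>_def by (rule someI[of "kappa_seq N S \<rho> K"])
  have Rl: "Rlim N S \<rho> K \<gamma> lam \<Phi> \<Psi> = lim ?R" unfolding Rlim_def Let_def \<kappa>_def ..
  have R: "lim ?R > 0" using assms(14) unfolding Rl .
  have nz: "\<not> (\<forall>n. ?R n = 0)"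
  proof
    assume "\<forall>n. ?R n = 0"
    then have "lim ?R = 0" by (intro limI) simp
    then show False using R by simp
  qed
  \<comment> \<open>Empty or intersecting sets make all finite resistances 0, so positivity excludes
    them.\<close>
  have ne: "\<Phi> \<noteq> {}" "\<Psi> \<noteq> {}"
    using nz capn_trivial[of \<Phi> \<Psi> \<kappa>] by (auto simp: effres_capn)
  have dj: "\<Phi> \<inter> \<Psi> = {}"
  proof (rule ccontr)
    assume "\<Phi> \<inter> \<Psi> \<noteq> {}"
    then have "\<kappa> n ` \<Phi> \<inter> \<kappa> n ` \<Psi> \<noteq> {}" for n by blast
    then show False using nz by (simp add: effres_capn)
  qed
  interpret two_sets N S \<rho> K \<gamma> lam \<Phi> \<Psi> \<kappa>
    by unfold_locales (use assms(10-13) ne dj kap in simp_all)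
  obtain L f where L: "Cn \<longlonglongrightarrow> L" and f: "fin L f" "inA \<Phi> \<Psi> f" and Lp: "L > 0" and RL: "lim ?R = 1 / L"
    using limiting_resistance_eq[OF R] by blast
  define u where "u = tr f"
  have um: "u \<in> borel_measurable borel" using tr_measurable[OF f(1)] by (simp add: u_def)
  have uc: "continuous_on K u" using tr_cont[OF f(1)] by (simp add: u_def)
  have ub: "bval f u" using tr_bval[OF f(1)] by (simp add: u_def)
  obtain v where v: "bval f v" "\<forall>\<xi>\<in>\<Phi>. v \<xi> = 1" "\<forall>\<xi>\<in>\<Psi>. v \<xi> = 0" using f(2) by (auto simp: inA_def)
  have uv: "u \<xi> = v \<xi>" if "\<xi> \<in> K" for \<xi> using bval_unique[OF ub v(1), of 0 \<xi>] that by simp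
  have u1: "\<forall>\<xi>\<in>\<Phi>. u \<xi> = 1" and u0: "\<forall>\<xi>\<in>\<Psi>. u \<xi> = 0" using uv v assms(11,13) by auto
  have adm: "admissible K \<Phi> \<Psi> u" using uc u1 u0 by (simp add: admissible_def)
  have Hf: "HH u x = f x" if "x \<in> X" for x
    by (rule HH_harmonic[OF that um uc ub]) (rule minimizer_harmonic[OF L f])
  have "EK N S \<rho> K \<gamma> lam u = EE f" unfolding EK_def by (rule EE_cong) (rule Hf)
  also have "EE f = ennreal L"
  \<comment> \<open>The function f is itself in \<open>inA\<close>, so its energy cannot be smaller
    than L.\<close>
  proof (rule antisym)
    show "EE f \<le> ennreal L" using f(1) fin_EE[of L f] Lp by simp
    have ft: "EE f < top" using \<open>EE f \<le> ennreal L\<close> by (simp add: le_less_trans)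
    then have ee: "EE f = ennreal (enn2real (EE f))" by simp
    then have "fin (enn2real (EE f)) f" using fin_EE[of "enn2real (EE f)" f] by simp
    then have "L \<le> enn2real (EE f)" by (rule capn_limit_le[OF L f(2)])
    then show "ennreal L \<le> EE f" by (subst ee) (rule ennreal_leI)
  qed
  finally have EKu: "EK N S \<rho> K \<gamma> lam u = ennreal L" .
  have uD: "u \<in> DK N S \<rho> K \<gamma> lam"
    unfolding DK_def using um uc EKu
    by (auto intro!: integrable_K continuous_intros simp: measurable_cong_sets[OF sets_nu refl])
  \<comment> \<open>A competitor on K is replaced by its Poisson extension: continuity gives it
    uniform boundary values, and its energy on the tree is \<open>EK\<close> by definition.
    Minimality and uniqueness in \<open>inA\<close> then apply.\<close>
  have comp: "fin (enn2real (EK N S \<rho> K \<gamma> lam u')) (HH u')"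
      "bval (HH u') u'" "EK N S \<rho> K \<gamma> lam u' = ennreal (enn2real (EK N S \<rho> K \<gamma> lam u'))"
    if u': "u' \<in> DK N S \<rho> K \<gamma> lam" "admissible K \<Phi> \<Psi> u'" for u'
  proof -
    have "u' \<in> borel_measurable borel" using u'(1) by (simp add: DK_def measurable_cong_sets[OF sets_nu refl])
    then show "bval (HH u') u'" using u'(2) by (intro HH_bval) (simp_all add: admissible_def)
    show ee: "EK N S \<rho> K \<gamma> lam u' = ennreal (enn2real (EK N S \<rho> K \<gamma> lam u'))" using u'(1) by (simp add: DK_def)
    then have "EE (HH u') \<le> ennreal (enn2real (EK N S \<rho> K \<gamma> lam u'))" by (simp add: EK_def)
    then show "fin (enn2real (EK N S \<rho> K \<gamma> lam u')) (HH u')" by (subst fin_EE) simp_all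
  qed
  have low: "ennreal L \<le> EK N S \<rho> K \<gamma> lam u'"
    if u': "u' \<in> DK N S \<rho> K \<gamma> lam" "admissible K \<Phi> \<Psi> u'" for u'
  proof -
    have "inA \<Phi> \<Psi> (HH u')" unfolding inA_def using comp(2)[OF u'] u'(2) by (auto simp: admissible_def)
    then have "L \<le> enn2real (EK N S \<rho> K \<gamma> lam u')" using capn_limit_le[OF L _ comp(1)[OF u']] by simp
    then show ?thesis by (subst comp(3)[OF u']) (rule ennreal_leI)
  qed
  have uniq: "\<forall>\<xi>\<in>K. u' \<xi> = u \<xi>"
    if u': "u' \<in> DK N S \<rho> K \<gamma> lam" "admissible K \<Phi> \<Psi> u'" and eq: "EK N S \<rho> K \<gamma> lam u' = EK N S \<rho> K \<gamma> lam u" for u'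
  proof
    fix \<xi> assume \<xi>: "\<xi> \<in> K"
    have "enn2real (EK N S \<rho> K \<gamma> lam u') = L" using eq EKu Lp by simp
    then have "fin L (HH u')" using comp(1)[OF u'] by simp
    moreover have "\<forall>\<xi>\<in>\<Phi>. u' \<xi> = 1" "\<forall>\<xi>\<in>\<Psi>. u' \<xi> = 0" using u'(2) by (auto simp: admissible_def)
    ultimately have "u \<xi> = u' \<xi>"
      using minimizer_unique[OF L f(1) ub u1 u0 _ comp(2)[OF u']] \<xi> by blast
    then show "u' \<xi> = u \<xi>" ..
  qed
  have "EK N S \<rho> K \<gamma> lam u =
      (INF u'\<in>{u'\<in>DK N S \<rho> K \<gamma> lam. admissible K \<Phi> \<Psi> u'}. EK N S \<rho> K \<gamma> lam u')"
  proof (rule antisym)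
    show "EK N S \<rho> K \<gamma> lam u \<le> (INF u'\<in>{u'\<in>DK N S \<rho> K \<gamma> lam. admissible K \<Phi> \<Psi> u'}. EK N S \<rho> K \<gamma> lam u')"
      unfolding EKu by (rule INF_greatest) (use low in simp)
    show "(INF u'\<in>{u'\<in>DK N S \<rho> K \<gamma> lam. admissible K \<Phi> \<Psi> u'}. EK N S \<rho> K \<gamma> lam u') \<le> EK N S \<rho> K \<gamma> lam u"
      by (rule INF_lower) (use uD adm in simp)
  qed
  moreover have "ennreal (1 / Rlim N S \<rho> K \<gamma> lam \<Phi> \<Psi>) = EK N S \<rho> K \<gamma> lam u"
    unfolding Rl RL EKu by simp
  ultimately show ?thesis using uD adm uniq by (intro bexI[of _ u]) auto
qed

end
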